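(* Let $n\geq2$, $d\geq1$, $\Omega\subset\mathbb{R}^n$ open, $0\leq\lambda\leq n-1$ and $\alpha=1-\frac{\lambda}{n-1}$. Let $f\in W^{1,1}_{\mathrm{loc}}(\Omega;\mathbb{R}^d)$ and let $N\subset\Omega$ be a set of Lebesgue measure zero. Suppose that for each $x\in N$ there exist $R=R(x)>0$ and $\mu=\mu(x)>0$ such that $B(x,R)\subset\Omega$ and $$\omega_f(x,r)\leq\begin{cases}\exp\bigl(-\mu\log^\alpha(1/r)\bigr), & \alpha>0,\\ \log^{-\mu}(1/r), & \alpha=0,\end{cases}\qquad 0<r\leq R.$$ If $\int_\Omega|Df|^n\log^\lambda(e+|Df|)\,dy<\infty$, then $\mathcal{H}^n(f(N))=0$.
   Context: $f$ is a fixed measurable (pointwise defined) representative. $B(x,r)$ is the open ball. The median modulus of continuity is $\omega_f(x,r)=\inf\{s\geq0: |\{y\in B(x,r): |f(y)-f(x)|\geq s\}|<\tfrac12|B(x,r)|\}$, where $|\cdot|$ is Lebesgue measure. $\mathcal{H}^n$ is the $n$-dimensional Hausdorff measure in $\mathbb{R}^d$. *)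

theory Defs
  imports "HOL-Analysis.Analysis"
begin

fun iter_partial :: "'a::euclidean_space list \<Rightarrow> ('a \<Rightarrow> real) \<Rightarrow> ('a \<Rightarrow> real)" where
  "iter_partial [] \<phi> = \<phi>"
| "iter_partial (i # is) \<phi> = (\<lambda>x. frechet_derivative (iter_partial is \<phi>) (at x) i)"

definition smooth_fun :: "('a::euclidean_space \<Rightarrow> real) \<Rightarrow> bool" where
  "smooth_fun \<phi> \<longleftrightarrow> (\<forall>is \<in> lists Basis. \<forall>x. iter_partial is \<phi> differentiable (at x))"

definition test_fun :: "'a::euclidean_space set \<Rightarrow> ('a \<Rightarrow> real) \<Rightarrow> bool" where
  "test_fun \<Omega> \<phi> \<longleftrightarrow> smooth_fun \<phi> \<and> compact (closure {x. \<phi> x \<noteq> 0}) \<and> closure {x. \<phi> x \<noteq> 0} \<subseteq> \<Omega>"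

definition locally_integrable_on :: "('a::euclidean_space \<Rightarrow> 'b::euclidean_space) \<Rightarrow> 'a set \<Rightarrow> bool" where
  "locally_integrable_on f \<Omega> \<longleftrightarrow> (\<forall>K. compact K \<and> K \<subseteq> \<Omega> \<longrightarrow> set_integrable lebesgue K f)"

definition weak_gradient_W11loc ::
  "('a::euclidean_space \<Rightarrow> 'b::euclidean_space) \<Rightarrow> 'a set \<Rightarrow> ('a \<Rightarrow> 'a \<Rightarrow> 'b) \<Rightarrow> bool" where
  "weak_gradient_W11loc f \<Omega> g \<longleftrightarrow>
     locally_integrable_on f \<Omega> \<and> (\<forall>i\<in>Basis. locally_integrable_on (g i) \<Omega>) \<and>
     (\<forall>\<phi> i. test_fun \<Omega> \<phi> \<and> i \<in> Basis \<longrightarrow>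
        (LINT y|lebesgue. iter_partial [i] \<phi> y *\<^sub>R f y) = - (LINT y|lebesgue. \<phi> y *\<^sub>R g i y))"

definition grad_norm :: "('a::euclidean_space \<Rightarrow> 'a \<Rightarrow> 'b::euclidean_space) \<Rightarrow> 'a \<Rightarrow> real" where
  "grad_norm g y = sqrt (\<Sum>i\<in>Basis. (norm (g i y))\<^sup>2)"

definition median_modulus :: "('a::euclidean_space \<Rightarrow> 'b::euclidean_space) \<Rightarrow> 'a \<Rightarrow> real \<Rightarrow> real" where
  "median_modulus f x r = Inf {s. s \<ge> 0 \<and>
     measure lebesgue {y \<in> ball x r. norm (f y - f x) \<ge> s} < measure lebesgue (ball x r) / 2}"

definition hausdorff_pre :: "nat \<Rightarrow> real \<Rightarrow> 'b::euclidean_space set \<Rightarrow> ennreal" where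
  "hausdorff_pre m \<delta> A = (INF C \<in> {C :: nat \<Rightarrow> 'b set. A \<subseteq> (\<Union>k. C k) \<and>
       (\<forall>k. bounded (C k) \<and> diameter (C k) \<le> \<delta>)}.
     (\<Sum>k. ennreal (unit_ball_vol (real m) * (diameter (C k) / 2) ^ m)))"

definition hausdorff_measure :: "nat \<Rightarrow> 'b::euclidean_space set \<Rightarrow> ennreal" where
  "hausdorff_measure m A = (SUP \<delta> \<in> {0<..}. hausdorff_pre m \<delta> A)"

end

theory Submission
  imports Defs
begin

text \<open>
  The covering is done in the target. Writing $u = |f - f(x)|$ and $\Phi(t) = t^n \log^\lambda(e+t)$,
  the key claim is that for $x \in N$ and every open $V \ni x$ there are arbitrarily small $\rho$ with
  $\varepsilon \rho^n \le \int_{V \cap \{u < \rho\}} (1 + \Phi(|Df|))$, where $\varepsilon$ depends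
  only on $n$, $\lambda$ and the exponent $\mu$ of $x$. The preimages of disjoint balls are disjoint,
  so Vitali's covering lemma bounds the Hausdorff content of $f(N)$ by a multiple of the energy of
  an open neighbourhood of the null set $N$, which can be made arbitrarily small.

  If the claim fails, the energy of the layers $\{u < 2^{-j}\}$ is tiny, so
  $v = \frac12 \log(h^2 + u^2)$ with $h = 2^{-J}$ satisfies $\int \Phi(|Df|) / (h^2+u^2)^{n/2} \lesssim \varepsilon J + C$.
  On the other hand $v$ is bounded below on half of a fixed ball around $x$, while the
  median modulus makes $v \approx -J \log 2$ on half of a ball of radius $2^{-K}$, where
  $\sum_{k \le K} k^{\alpha-1} \lesssim J$. Joining the two half-balls by segments (after mollifying $f$)
  gives $J \lesssim \int |Dv| \max(|z-x|, 2^{-K})^{1-n} dz$. Splitting dyadically, on the scale $2^{-k}$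
  with $k \ge 4J$ either $|Df| < 2^{k/2}$, which contributes a summable amount, or
  $\log(e + |Df|) \gtrsim k$; this yields $J \lesssim \tau' J + \tau (\varepsilon J + C) + C$ with
  $\tau'$ as small as desired, a contradiction for small $\varepsilon$ as $J \to \infty$.
\<close>

section \<open>Smooth bump functions\<close>

text \<open>Since \<open>f\<close> need not be continuous, small balls around points of
  \<open>N\<close> may have large images, and the energy ignores null sets; the value at x enters
  through the median alone. Hence the covering in the target, and half-balls in place of
  oscillation. The logarithm is dictated by scaling: if the claim fails, the layer at distance about
  2^(-j) from f(x) has energy at most epsilon 2^(-jn). After division by the nth power of the
  distance all layers count equally, so epsilon per layer competes with a drop of ln 2 per layer.
  The exponent alpha comes from a Young threshold: a weight k^lambda on the energy at scale 2^(-k)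
  gives the threshold k^(-lambda/(n-1)) = k^(alpha-1). Its sum up to K is of order K^alpha, or ln K
  if alpha = 0, and the assumed modulus makes this linear in J. The summand 1 in 1 + Phi bounds the
  measure of the layers too; this yields the half-ball on which v is bounded below. As epsilon
  depends on mu, \<open>N\<close> is first cut into countably many pieces with a common mu.\<close>

definition exp_inv :: "nat \<Rightarrow> real \<Rightarrow> real" where
  "exp_inv k t = (if t > 0 then exp (- (1 / t)) / t ^ k else 0)"

lemma exp_inv_nonneg: "exp_inv k t \<ge> 0"
  by (simp add: exp_inv_def)

text \<open>The single term of index k + 2 in the series of exp (1/t) pays for the division by t^k
  and leaves t^2 over.\<close>

lemma exp_inv_le: "exp_inv k t \<le> fact (k + 2) * t\<^sup>2"
proof (cases "t > 0")
  case True
  have "(1 / t) ^ (k + 2) /\<^sub>R fact (k + 2) \<le> (\<Sum>n. (1 / t) ^ n /\<^sub>R fact n)"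
    using True summable_exp_generic[of "1/t"] sum_le_suminf[of "\<lambda>n. (1 / t) ^ n /\<^sub>R fact n" "{k + 2}"]
    by (simp del: power_Suc fact_Suc add_2_eq_Suc')
  then have "(1 / t) ^ (k + 2) / fact (k + 2) \<le> exp (1 / t)"
    by (simp add: exp_def divide_inverse mult.commute)
  then have *: "1 \<le> exp (1 / t) * (fact (k + 2) * t ^ (k + 2))"
    using True by (simp add: field_simps power_one_over del: power_Suc fact_Suc add_2_eq_Suc')
  have "exp (- (1 / t)) = 1 / exp (1/t)"
    by (simp add: exp_minus field_simps)
  also have "\<dots> \<le> fact (k + 2) * t ^ (k + 2)"
    using * by (simp add: divide_le_eq mult.commute del: power_Suc fact_Suc add_2_eq_Suc')
  finally have "exp (- (1 / t)) / t ^ k \<le> fact (k + 2) * t ^ (k + 2) / t ^ k"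
    using True by (intro divide_right_mono) auto
  also have "\<dots> = fact (k + 2) * t\<^sup>2"
    using True by (simp add: power_add del: fact_Suc add_2_eq_Suc')
  finally show ?thesis using True by (simp add: exp_inv_def)
qed (simp add: exp_inv_def)

text \<open>The factor 1/t^k is carried along because it makes the family closed under
  differentiation. At the gluing point 0 the quadratic bound \<open>exp_inv_le\<close> forces the
  difference quotient to 0, for every k at once.\<close>

lemma DERIV_exp_inv:
  "(exp_inv k has_real_derivative exp_inv (k + 2) t - real k * exp_inv (k + 1) t) (at t)"
proof -
  consider "t > 0" | "t < 0" | "t = 0" by linarith
  then show ?thesis
  proof cases
    case 1
    have "((\<lambda>t. exp (- (1 / t)) / t ^ k) has_real_derivative
        exp_inv (k + 2) t - real k * exp_inv (k + 1) t) (at t)"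
      using 1 by (auto intro!: derivative_eq_intros simp: exp_inv_def field_simps power2_eq_square)
         (cases k; simp add: field_simps)
    then show ?thesis
      by (rule has_field_derivative_transform_within_open[of _ _ _ "{0<..}"])
        (use 1 in \<open>auto simp: exp_inv_def\<close>)
  next
    case 2
    have "((\<lambda>t. 0) has_real_derivative exp_inv (k + 2) t - real k * exp_inv (k + 1) t) (at t)"
      using 2 by (simp add: exp_inv_def)
    then show ?thesis
      by (rule has_field_derivative_transform_within_open[of _ _ _ "{..<0}"])
        (use 2 in \<open>auto simp: exp_inv_def\<close>)
  next
    case 3
    have "((\<lambda>h. exp_inv k h / h) \<longlongrightarrow> 0) (at 0)"
    proof (rule Lim_null_comparison)
      show "\<forall>\<^sub>F h in at 0. norm (exp_inv k h / h) \<le> fact (k + 2) * \<bar>h\<bar>"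
        unfolding eventually_at_filter
      proof (intro always_eventually allI impI)
        fix h :: real assume "h \<noteq> 0"
        then show "norm (exp_inv k h / h) \<le> fact (k + 2) * \<bar>h\<bar>"
          using exp_inv_le[of k h] exp_inv_nonneg[of k h]
          by (simp add: abs_divide divide_le_eq power2_eq_square mult.assoc del: fact_Suc add_2_eq_Suc')
      qed
      show "((\<lambda>h::real. fact (k + 2) * \<bar>h\<bar>) \<longlongrightarrow> 0) (at 0)"
        by (auto intro!: tendsto_eq_intros)
    qed
    then show ?thesis
      unfolding 3 by (simp add: DERIV_def exp_inv_def)
  qed
qed

inductive_set bump_alg :: "('a::euclidean_space \<Rightarrow> real) set" where
  const: "(\<lambda>_. c) \<in> bump_alg"
| coord: "(\<lambda>x. x \<bullet> b) \<in> bump_alg"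
| add: "F \<in> bump_alg \<Longrightarrow> H \<in> bump_alg \<Longrightarrow> (\<lambda>x. F x + H x) \<in> bump_alg"
| mult: "F \<in> bump_alg \<Longrightarrow> H \<in> bump_alg \<Longrightarrow> (\<lambda>x. F x * H x) \<in> bump_alg"
| exp_inv: "F \<in> bump_alg \<Longrightarrow> (\<lambda>x. exp_inv k (F x)) \<in> bump_alg"

lemma bump_alg_derivative:
  assumes "F \<in> bump_alg"
  shows "\<exists>F'. (\<forall>x. (F has_derivative F' x) (at x)) \<and> (\<forall>i. (\<lambda>x. F' x i) \<in> bump_alg)"
  using assms
proof induction
  case (const c)
  show ?case by (rule exI[of _ "\<lambda>_ _. 0"]) (auto intro: bump_alg.const)
next
  case (coord b)
  show ?case
    by (rule exI[of _ "\<lambda>_ h. h \<bullet> b"]) (auto intro!: bump_alg.const derivative_eq_intros)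
next
  case (add F H)
  then obtain F' H' where "\<forall>x. (F has_derivative F' x) (at x)" "\<forall>i. (\<lambda>x. F' x i) \<in> bump_alg"
    "\<forall>x. (H has_derivative H' x) (at x)" "\<forall>i. (\<lambda>x. H' x i) \<in> bump_alg" by blast
  then show ?case
    by (intro exI[of _ "\<lambda>x h. F' x h + H' x h"]) (auto intro!: bump_alg.add derivative_intros)
next
  case (mult F H)
  then obtain F' H' where "\<forall>x. (F has_derivative F' x) (at x)" "\<forall>i. (\<lambda>x. F' x i) \<in> bump_alg"
    "\<forall>x. (H has_derivative H' x) (at x)" "\<forall>i. (\<lambda>x. H' x i) \<in> bump_alg" by blast
  then show ?case using mult.hyps
    by (intro exI[of _ "\<lambda>x h. F x * H' x h + F' x h * H x"])
      (auto intro!: bump_alg.add bump_alg.mult has_derivative_mult)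
next
  case (exp_inv F k)
  then obtain F' where F': "\<forall>x. (F has_derivative F' x) (at x)" "\<forall>i. (\<lambda>x. F' x i) \<in> bump_alg"
    by blast
  have "((\<lambda>x. exp_inv k (F x)) has_derivative
      (\<lambda>h. (exp_inv (k + 2) (F x) + (- real k) * exp_inv (k + 1) (F x)) * F' x h)) (at x)" for x
    using has_derivative_compose[OF F'(1)[rule_format, of x]
        DERIV_exp_inv[of k "F x", unfolded has_field_derivative_def]]
    by simp
  moreover have "(\<lambda>x. (exp_inv (k + 2) (F x) + (- real k) * exp_inv (k + 1) (F x)) * F' x i) \<in> bump_alg" for i
    using F' exp_inv.hyps
    by (intro bump_alg.add bump_alg.mult bump_alg.const bump_alg.exp_inv) auto
  ultimately show ?case
    by (intro exI[of _ "\<lambda>x h. (exp_inv (k + 2) (F x) + (- real k) * exp_inv (k + 1) (F x)) * F' x h"]) simp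
qed

lemma bump_alg_differentiable: "F \<in> bump_alg \<Longrightarrow> F differentiable (at x)"
  using bump_alg_derivative unfolding differentiable_def by blast

lemma bump_alg_frechet:
  assumes "F \<in> bump_alg"
  shows "(\<lambda>x. frechet_derivative F (at x) i) \<in> bump_alg"
proof -
  obtain F' where F': "\<forall>x. (F has_derivative F' x) (at x)" "\<forall>i. (\<lambda>x. F' x i) \<in> bump_alg"
    using bump_alg_derivative[OF assms] by blast
  then have "frechet_derivative F (at x) = F' x" for x
    by (metis frechet_derivative_at)
  then show ?thesis using F' by simp
qed

lemma bump_alg_continuous: "F \<in> bump_alg \<Longrightarrow> continuous_on S F"
  using bump_alg_differentiable differentiable_imp_continuous_on
  by (metis differentiable_at_withinI differentiable_on_def)

lemma bump_alg_smooth: "F \<in> bump_alg \<Longrightarrow> smooth_fun F"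
proof -
  assume F: "F \<in> bump_alg"
  have "iter_partial is F \<in> bump_alg" for "is"
    by (induction "is") (auto intro: F bump_alg_frechet)
  then show ?thesis
    unfolding smooth_fun_def using bump_alg_differentiable by blast
qed

text \<open>Left unnormalised; the integral is divided out in \<open>mollify\<close>. The argument
  is e^2 - |w|^2, a polynomial in the coordinates that is positive exactly on the open ball of
  radius e.\<close>

definition bump :: "real \<Rightarrow> 'a::euclidean_space \<Rightarrow> real" where
  "bump e w = exp_inv 0 (e\<^sup>2 - w \<bullet> w)"

text \<open>The variable is y with z fixed: these are the functions against which the weak gradient
  is tested.\<close>

lemma bump_translate_alg: "(\<lambda>y. bump e (z - y)) \<in> bump_alg"
proof -
  have inner: "(\<lambda>y::'a. y \<bullet> y) \<in> bump_alg"
  proof -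
    have "(\<lambda>y::'a. \<Sum>b\<in>B. (y \<bullet> b) * (y \<bullet> b)) \<in> bump_alg" if "finite B" for B
      using that by (induction B) (auto intro!: bump_alg.intros)
    then show ?thesis
      by (subst euclidean_inner) simp
  qed
  have "(\<lambda>y. exp_inv 0 ((e\<^sup>2 + - (z \<bullet> z)) + (2 * (y \<bullet> z) + (-1) * (y \<bullet> y)))) \<in> bump_alg"
    by (intro bump_alg.intros inner)
  then show ?thesis
    by (simp add: bump_def algebra_simps inner_commute inner_diff)
qed

lemma bump_alg: "bump e \<in> bump_alg"
  using bump_translate_alg[of e 0] by (simp add: bump_def[abs_def])

lemma bump_nonneg: "bump e w \<ge> 0"
  by (simp add: bump_def exp_inv_nonneg)

lemma bump_pos_iff: "e > 0 \<Longrightarrow> bump e w > 0 \<longleftrightarrow> norm w < e"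
  by (simp add: bump_def exp_inv_def power2_norm_eq_inner[symmetric] )
    (metis norm_ge_zero power2_less_imp_less power_strict_mono
      less_imp_le pos2)

lemma bump_eq_0: "e > 0 \<Longrightarrow> norm w \<ge> e \<Longrightarrow> bump e w = 0"
  using bump_pos_iff[of e w] bump_nonneg[of e w] by linarith

lemma test_fun_bump:
  assumes "e > 0" "cball z e \<subseteq> \<Omega>"
  shows "test_fun \<Omega> (\<lambda>y. bump e (z - y))"
proof -
  have "{y. bump e (z - y) \<noteq> 0} \<subseteq> cball z e"
    using bump_eq_0[OF assms(1)] by (force simp: dist_norm not_le[symmetric])
  then have *: "closure {y. bump e (z - y) \<noteq> 0} \<subseteq> cball z e"
    by (rule closure_minimal) simp
  then have "compact (closure {y. bump e (z - y) \<noteq> 0})"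
    by (metis bounded_cball bounded_subset closed_closure compact_eq_bounded_closed)
  with * assms(2) show ?thesis
    unfolding test_fun_def using bump_alg_smooth[OF bump_translate_alg] by blast
qed

section \<open>Convolution with a bump function\<close>

definition bump_grad :: "('a::euclidean_space \<Rightarrow> real) \<Rightarrow> 'a \<Rightarrow> 'a" where
  "bump_grad \<eta> w = (\<Sum>i\<in>Basis. frechet_derivative \<eta> (at w) i *\<^sub>R i)"

lemma bump_grad_inner:
  fixes \<eta> :: "'a::euclidean_space \<Rightarrow> real"
  assumes "\<eta> \<in> bump_alg"
  shows "bump_grad \<eta> w \<bullet> h = frechet_derivative \<eta> (at w) h"
proof -
  have "linear (frechet_derivative \<eta> (at w))"
    by (intro linear_frechet_derivative bump_alg_differentiable assms)
  then have "frechet_derivative \<eta> (at w) (\<Sum>i\<in>Basis. (h \<bullet> i) *\<^sub>R i)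
      = (\<Sum>i\<in>Basis. (h \<bullet> i) * frechet_derivative \<eta> (at w) i)"
    by (simp add: linear_sum linear_cmul)
  then have "frechet_derivative \<eta> (at w) h = (\<Sum>i\<in>Basis. (h \<bullet> i) * frechet_derivative \<eta> (at w) i)"
    by (simp only: euclidean_representation)
  then show ?thesis
    by (simp add: bump_grad_def inner_sum_left inner_commute[of h] mult.commute)
qed

lemma bump_grad_has_derivative:
  "\<eta> \<in> bump_alg \<Longrightarrow> (\<eta> has_derivative (\<lambda>h. bump_grad \<eta> w \<bullet> h)) (at w)"
  using frechet_derivative_works[THEN iffD1, OF bump_alg_differentiable, of \<eta> w]
  by (simp add: bump_grad_inner)

lemma bump_grad_continuous:
  "\<eta> \<in> bump_alg \<Longrightarrow> continuous_on S (bump_grad \<eta>)"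
  unfolding bump_grad_def[abs_def]
  by (intro continuous_intros bump_alg_continuous[OF bump_alg_frechet])

text \<open>As \<open>F\<close> lives on a ball of radius M, only the values of \<open>p\<close> on
  that compact ball count, and there \<open>p\<close> is bounded.\<close>

lemma integrable_mult_continuous:
  fixes F :: "'a::euclidean_space \<Rightarrow> 'b::euclidean_space"
  assumes p: "continuous_on UNIV p" and F: "integrable lborel F"
    and M: "\<And>y. F y \<noteq> 0 \<Longrightarrow> norm y \<le> M"
  shows "integrable lborel (\<lambda>y. p y *\<^sub>R F y)"
proof -
  have "bounded (p ` cball 0 M)"
    by (intro compact_imp_bounded compact_continuous_image continuous_on_subset[OF p]) auto
  then obtain C where "\<And>v. v \<in> p ` cball 0 M \<Longrightarrow> norm v \<le> C"
    unfolding bounded_iff by blast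
  then have C: "\<bar>p y\<bar> \<le> C" if "norm y \<le> M" for y
    using that by force
  have [measurable]: "p \<in> borel_measurable borel" "F \<in> borel_measurable borel"
    using p F by (auto intro: borel_measurable_continuous_onI)
  show ?thesis
  proof (rule Bochner_Integration.integrable_bound[of _ "\<lambda>y. C *\<^sub>R F y"])
    show "AE y in lborel. norm (p y *\<^sub>R F y) \<le> norm (C *\<^sub>R F y)"
    proof (rule AE_I2)
      fix y show "norm (p y *\<^sub>R F y) \<le> norm (C *\<^sub>R F y)"
        using C[of y] M[of y] by (cases "F y = 0") (auto intro!: mult_right_mono)
    qed
  qed (use F in auto)
qed

text \<open>Differentiation under the integral sign: by uniform continuity of the gradient of \<eta>
  on one compact ball, its linearisation error at z - y is o(|w - z|) uniformly over all y in the
  support of \<open>F\<close>.\<close>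

lemma convolution_has_derivative:
  fixes F :: "'a::euclidean_space \<Rightarrow> 'b::euclidean_space"
  assumes \<eta>: "\<eta> \<in> bump_alg" and F: "integrable lborel F"
    and M: "\<And>y. F y \<noteq> 0 \<Longrightarrow> norm y \<le> M"
  shows "((\<lambda>z. \<integral>y. \<eta> (z - y) *\<^sub>R F y \<partial>lborel) has_derivative
     (\<lambda>h. \<integral>y. (bump_grad \<eta> (z - y) \<bullet> h) *\<^sub>R F y \<partial>lborel)) (at z)"
proof -
  have ci: "integrable lborel (\<lambda>y. \<eta> (w - y) *\<^sub>R F y)" for w
    by (rule integrable_mult_continuous[OF _ F M])
      (auto intro!: continuous_on_compose2[OF bump_alg_continuous[OF \<eta>, of UNIV]] continuous_intros)
  have gi: "integrable lborel (\<lambda>y. (bump_grad \<eta> (z - y) \<bullet> h) *\<^sub>R F y)" for h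
    by (rule integrable_mult_continuous[OF _ F M])
      (auto intro!: continuous_on_compose2[OF bump_grad_continuous[OF \<eta>, of UNIV]] continuous_intros)
  define I where "I = (\<integral>y. norm (F y) \<partial>lborel)"
  have I0: "I \<ge> 0" by (simp add: I_def)
  have lin: "linear (\<lambda>h. \<integral>y. (bump_grad \<eta> (z - y) \<bullet> h) *\<^sub>R F y \<partial>lborel)"
    by (rule linearI)
      (simp_all add: inner_add_right scaleR_add_left gi flip: integral_scaleR_right)
  let ?R = "\<lambda>w. (\<integral>y. \<eta> (w - y) *\<^sub>R F y \<partial>lborel) - (\<integral>y. \<eta> (z - y) *\<^sub>R F y \<partial>lborel)
          - (\<integral>y. (bump_grad \<eta> (z - y) \<bullet> (w - z)) *\<^sub>R F y \<partial>lborel)"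
  show ?thesis
    unfolding has_derivative_at_alt
  proof (intro conjI allI impI)
    show "bounded_linear (\<lambda>h. \<integral>y. (bump_grad \<eta> (z - y) \<bullet> h) *\<^sub>R F y \<partial>lborel)"
      using lin by (simp add: linear_conv_bounded_linear)
  next
    fix e :: real assume "e > 0"
    \<comment> \<open>I is the L1 norm of \<open>F\<close>; the added 1 avoids a zero
      denominator.\<close>
    define e' where "e' = e / (I + 1)"
    have e': "e' > 0" "e' * I \<le> e" using \<open>e > 0\<close> I0 by (auto simp: e'_def field_simps)
    \<comment> \<open>Contains z - y and every point within distance 1 of it, for all y of norm at
      most M; hence the restriction to |w - z| < 1 below.\<close>
    define K where "K = cball (0::'a) (norm z + M + 1)"
    have "uniformly_continuous_on K (bump_grad \<eta>)"
      unfolding K_def by (intro compact_uniformly_continuous bump_grad_continuous \<eta>) simp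
    then obtain d where d: "d > 0"
      "\<And>v w. v \<in> K \<Longrightarrow> w \<in> K \<Longrightarrow> dist v w < d \<Longrightarrow> dist (bump_grad \<eta> v) (bump_grad \<eta> w) < e'"
      unfolding uniformly_continuous_on_def using e'(1) by metis
    show "\<exists>d>0. \<forall>w. norm (w - z) < d \<longrightarrow>
       norm (?R w) \<le> e * norm (w - z)"
    proof (intro exI[of _ "min d 1"] conjI allI impI)
      fix w assume w: "norm (w - z) < min d 1"
      define r where "r y = \<eta> (w - y) - \<eta> (z - y) - bump_grad \<eta> (z - y) \<bullet> (w - z)" for y
      have r: "norm (r y) \<le> norm (w - z) * e'" if "norm y \<le> M" for y
      proof -
        have "norm (\<eta> (w - y) - \<eta> (z - y) - bump_grad \<eta> (z - y) \<bullet> ((w - y) - (z - y)))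
            \<le> norm ((w - y) - (z - y)) * e'"
        proof (rule differentiable_bound_linearization[of _ _ "ball (z - y) (min d 1)" \<eta> "\<lambda>v h. bump_grad \<eta> v \<bullet> h"])
          fix t :: real assume "t \<in> {0..1}"
          then have "norm (t *\<^sub>R (w - z)) \<le> 1 * norm (w - z)"
            unfolding norm_scaleR by (intro mult_right_mono) auto
          then show "z - y + t *\<^sub>R (w - y - (z - y)) \<in> ball (z - y) (min d 1)"
            using w by (simp add: dist_norm)
        next
          fix v show "(\<eta> has_derivative (\<lambda>h. bump_grad \<eta> v \<bullet> h)) (at v within ball (z - y) (min d 1))"
            by (rule has_derivative_at_withinI[OF bump_grad_has_derivative[OF \<eta>]])
        next
          fix v assume v: "v \<in> ball (z - y) (min d 1)"
          have "norm (z - y) \<le> norm z + M"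
            using norm_triangle_ineq4[of z y] that by linarith
          moreover have "norm v \<le> norm (z - y) + dist (z - y) v"
            by (metis add.commute dist_0_norm dist_commute dist_triangle)
          ultimately have "v \<in> K" "z - y \<in> K"
            using v by (auto simp: K_def)
          then have "norm (bump_grad \<eta> v - bump_grad \<eta> (z - y)) \<le> e'"
            using d(2)[of v "z - y"] v by (auto simp: dist_norm norm_minus_commute)
          then show "onorm ((\<bullet>) (bump_grad \<eta> v) - (\<bullet>) (bump_grad \<eta> (z - y))) \<le> e'"
            by (intro onorm_le)
              (auto simp: fun_diff_def inner_diff_left[symmetric]
                intro!: order.trans[OF Cauchy_Schwarz_ineq2] mult_right_mono)
        qed (use d in auto)
        then show ?thesis by (simp add: r_def)
      qed
      have "?R w = (\<integral>y. r y *\<^sub>R F y \<partial>lborel)"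
        using ci gi by (simp add: r_def scaleR_diff_left)
      moreover have "norm (\<integral>y. r y *\<^sub>R F y \<partial>lborel) \<le> (\<integral>y. (norm (w - z) * e') * norm (F y) \<partial>lborel)"
      proof (rule Bochner_Integration.integral_norm_bound_integral)
        show "integrable lborel (\<lambda>y. r y *\<^sub>R F y)"
          using ci gi by (simp add: r_def scaleR_diff_left)
        show "norm (r y *\<^sub>R F y) \<le> norm (w - z) * e' * norm (F y)" for y
          using r[of y] M[of y] by (cases "F y = 0") (auto intro!: mult_right_mono)
      qed (use F in auto)
      moreover have "\<dots> = (e' * I) * norm (w - z)"
        by (simp add: I_def)
      moreover have "\<dots> \<le> e * norm (w - z)"
        by (intro mult_right_mono e') simp
      ultimately show "norm (?R w) \<le> e * norm (w - z)"
        by (metis order.trans)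
    qed (use d in auto)
  qed
qed

section \<open>Affine changes of variables and density of continuous functions in L1\<close>

lemma nn_integral_lborel_affine:
  fixes f :: "'a::euclidean_space \<Rightarrow> ennreal"
  assumes [measurable]: "f \<in> borel_measurable borel" and c: "c \<noteq> 0"
  shows "(\<integral>\<^sup>+x. f (t + c *\<^sub>R x) \<partial>lborel) = ennreal (1 / \<bar>c\<bar> ^ DIM('a)) * (\<integral>\<^sup>+x. f x \<partial>lborel)"
proof -
  have "(\<integral>\<^sup>+x. f x \<partial>lborel) = ennreal (\<bar>c\<bar> ^ DIM('a)) * (\<integral>\<^sup>+x. f (t + c *\<^sub>R x) \<partial>lborel)"
    by (subst lborel_affine[OF c, of t])
      (simp add: nn_integral_density nn_integral_distr nn_integral_cmult)
  moreover have "ennreal (1 / \<bar>c\<bar> ^ DIM('a)) * ennreal (\<bar>c\<bar> ^ DIM('a)) = 1"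
    using c by (subst ennreal_mult[symmetric]) auto
  ultimately show ?thesis
    by (simp add: mult.assoc[symmetric])
qed

lemma nn_integral_lborel_reflect:
  fixes f :: "'a::euclidean_space \<Rightarrow> ennreal"
  assumes "f \<in> borel_measurable borel"
  shows "(\<integral>\<^sup>+y. f (z - y) \<partial>lborel) = (\<integral>\<^sup>+y. f y \<partial>lborel)"
  using nn_integral_lborel_affine[OF assms, of "-1" z] by simp

text \<open>Two dominated convergences. First the values of \<open>F\<close> are projected to a
  large ball of the target, dominated by |F|. Then \<open>measurable_on\<close> supplies continuous
  functions converging to \<open>F\<close> off a negligible set; composed with the same projection
  they are uniformly bounded, which is a dominating function on a ball of finite measure.\<close>

lemma continuous_L1_approx:
  fixes F :: "'a::euclidean_space \<Rightarrow> 'b::euclidean_space"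
  assumes F: "integrable lborel F" and e: "e > 0"
  obtains p where "continuous_on UNIV p"
    "(\<integral>\<^sup>+y\<in>cball x R. ennreal (norm (F y - p y)) \<partial>lborel) < ennreal e"
proof -
  have [measurable]: "F \<in> borel_measurable borel" using F by auto
  let ?Q = "\<lambda>m. closest_point (cball (0::'b) (real (Suc m)))"
  have cont: "continuous_on A (?Q m)" for A m
    by (intro continuous_on_closest_point) auto
  have [measurable]: "?Q m \<in> borel_measurable borel" for m
    by (intro borel_measurable_continuous_onI cont)
  note [simp del] = of_nat_Suc
  have [measurable]: "cball x R \<in> sets borel" by (simp add: borel_closed)
  have "(\<lambda>m. (\<integral>\<^sup>+y. norm (F y - ?Q m (F y)) \<partial>lborel)) \<longlonglongrightarrow> 0"
  proof (rule nn_integral_dominated_convergence_norm[where w="\<lambda>y. norm (F y)"])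
    show "AE y in lborel. norm (?Q m (F y)) \<le> norm (F y)" for m
      using closest_point_lipschitz[of "cball (0::'b) (real (Suc m))" "F _" 0]
      by (intro AE_I2) (simp add: closest_point_self)
    show "(\<integral>\<^sup>+ x. ennreal (norm (F x)) \<partial>lborel) < \<infinity>"
      using F by (simp add: integrable_iff_bounded)
    show "AE y in lborel. (\<lambda>i. ?Q i (F y)) \<longlonglongrightarrow> F y"
    proof (intro AE_I2 tendsto_eventually)
      fix y
      obtain N where "norm (F y) \<le> real N" using real_arch_simple by blast
      then show "\<forall>\<^sub>F i in sequentially. ?Q i (F y) = F y"
        by (intro eventually_sequentiallyI[of N] closest_point_self) auto
    qed
  qed auto
  then have "\<forall>\<^sub>F m in sequentially. (\<integral>\<^sup>+y. norm (F y - ?Q m (F y)) \<partial>lborel) < ennreal (e / 2)"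
    using e by (intro order_tendstoD) auto
  then obtain m where m: "(\<integral>\<^sup>+y. norm (F y - ?Q m (F y)) \<partial>lborel) < ennreal (e / 2)"
    unfolding eventually_sequentially by blast
  have "F measurable_on UNIV"
    by (rule lebesgue_measurable_imp_measurable_on) (auto intro: measurable_completion)
  then obtain Z g where Z: "negligible Z" and g: "\<And>n. continuous_on UNIV (g n)"
    "\<And>y. y \<notin> Z \<Longrightarrow> (\<lambda>n. g n y) \<longlonglongrightarrow> F y"
    unfolding measurable_on_def by auto
  have [measurable]: "g n \<in> borel_measurable borel" for n
    using g(1) by (rule borel_measurable_continuous_onI)
  let ?T = "?Q m"
  let ?d = "\<lambda>n. \<integral>\<^sup>+y. norm (indicator (cball x R) y *\<^sub>R ?T (F y) - indicator (cball x R) y *\<^sub>R ?T (g n y)) \<partial>lborel"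
  have "(\<lambda>n. ?d n) \<longlonglongrightarrow> 0"
  proof (rule nn_integral_dominated_convergence_norm[where w="\<lambda>y. real (Suc m) * indicator (cball x R) y"])
    show "AE y in lborel. norm (indicator (cball x R) y *\<^sub>R ?T (g n y)) \<le> real (Suc m) * indicator (cball x R) y" for n
      using closest_point_in_set[of "cball (0::'b) (real (Suc m))"] by (intro AE_I2) (auto simp: indicator_def)
    show "(\<integral>\<^sup>+ y. ennreal (real (Suc m) * indicator (cball x R) y) \<partial>lborel) < \<infinity>"
    proof -
      have "(\<integral>\<^sup>+ y. ennreal (real (Suc m) * indicator (cball x R) y) \<partial>lborel)
          = (\<integral>\<^sup>+ y. ennreal (real (Suc m)) * indicator (cball x R) y \<partial>lborel)"
        by (intro nn_integral_cong) (simp add: indicator_def)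
      then show ?thesis
        using emeasure_lborel_cball_finite[of x R]
        by (simp add: nn_integral_cmult_indicator ennreal_mult_less_top ennreal_mult_eq_top_iff less_top[symmetric])
    qed
    have "AE y in lebesgue. y \<notin> Z"
      using Z by (simp add: negligible_iff_null_sets AE_not_in)
    then have "AE y in lborel. y \<notin> Z"
      by (simp add: AE_completion_iff)
    then show "AE y in lborel. (\<lambda>n. indicator (cball x R) y *\<^sub>R ?T (g n y)) \<longlonglongrightarrow> indicator (cball x R) y *\<^sub>R ?T (F y)"
    proof eventually_elim
      case (elim y)
      have "isCont ?T (F y)"
        by (rule continuous_on_interior[OF cont[of UNIV]]) auto
      then show ?case
        by (intro tendsto_scaleR tendsto_const isCont_tendsto_compose[OF _ g(2)[OF elim]])
    qed
  qed measurable
  then have "\<forall>\<^sub>F n in sequentially. ?d n < ennreal (e / 2)"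
    using e by (intro order_tendstoD) auto
  then obtain n where n: "?d n < ennreal (e / 2)"
    unfolding eventually_sequentially by blast
  show thesis
  proof
    show "continuous_on UNIV (\<lambda>y. ?T (g n y))"
      by (rule continuous_on_compose2[OF cont g(1)]) auto
    have "(\<integral>\<^sup>+y\<in>cball x R. ennreal (norm (F y - ?T (g n y))) \<partial>lborel)
       \<le> (\<integral>\<^sup>+y. ennreal (norm (F y - ?T (F y))) + ennreal (norm (indicator (cball x R) y *\<^sub>R ?T (F y) - indicator (cball x R) y *\<^sub>R ?T (g n y))) \<partial>lborel)"
      by (intro nn_integral_mono)
        (auto simp: indicator_def ennreal_plus[symmetric] intro!: ennreal_leI norm_diff_triangle_ineq order.trans[OF _ norm_triangle_ineq] simp del: ennreal_plus)
    also have "\<dots> < ennreal (e/2) + ennreal (e/2)"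
      using m n by (subst nn_integral_add) (auto intro: add_strict_mono)
    also have "\<dots> = ennreal e" using e by (simp flip: ennreal_plus)
    finally show "(\<integral>\<^sup>+y\<in>cball x R. ennreal (norm (F y - ?T (g n y))) \<partial>lborel) < ennreal e" .
  qed
qed


section \<open>Mollification and its convergence in L1\<close>

definition mollify :: "real \<Rightarrow> ('a::euclidean_space \<Rightarrow> 'b::euclidean_space) \<Rightarrow> 'a \<Rightarrow> 'b" where
  "mollify e F z = (1 / (\<integral>w. bump e (w::'a) \<partial>lborel)) *\<^sub>R (\<integral>y. bump e (z - y) *\<^sub>R F y \<partial>lborel)"

lemma linear_basis_sum:
  fixes f :: "'a::euclidean_space \<Rightarrow> 'b::real_vector"
  assumes "linear f"
  shows "f h = (\<Sum>i\<in>Basis. (h \<bullet> i) *\<^sub>R f i)"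
proof -
  have "f (\<Sum>i\<in>Basis. (h \<bullet> i) *\<^sub>R i) = (\<Sum>i\<in>Basis. (h \<bullet> i) *\<^sub>R f i)"
    by (simp only: linear_sum[OF assms] linear_cmul[OF assms])
  then show ?thesis by (simp only: euclidean_representation)
qed

lemma ennreal_add3_less:
  fixes X Y :: ennreal
  assumes "X < ennreal a" "Y \<le> ennreal b" "0 \<le> b"
  shows "X + (Y + X) < ennreal (a + b + a)"
proof -
  obtain x where x: "X = ennreal x" "0 \<le> x"
    using assms(1) by (cases X) (auto simp: top_unique)
  obtain y where y: "Y = ennreal y" "0 \<le> y"
    using assms(2) by (cases Y) (auto simp: top_unique)
  have "x < a" "y \<le> b" using assms x y by (auto simp: ennreal_less_iff)
  then have "x + (y + x) < a + b + a" by linarith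
  then show ?thesis
    using x y by (simp add: ennreal_plus[symmetric] ennreal_less_iff del: ennreal_plus)
qed

lemma integrable_bump:
  assumes "e > 0"
  shows "integrable lborel (bump e :: 'a::euclidean_space \<Rightarrow> real)"
proof -
  have "integrable lborel (indicator (cball 0 e) :: 'a \<Rightarrow> real)"
    using emeasure_lborel_cball_finite[of "0::'a" e] by (intro integrable_real_indicator) auto
  then have "integrable lborel (\<lambda>y::'a. bump e y *\<^sub>R (indicator (cball 0 e) y :: real))"
    by (rule integrable_mult_continuous[where M=e, OF bump_alg_continuous[OF bump_alg]])
      (simp add: indicator_def dist_norm split: if_splits)
  moreover have "(\<lambda>y::'a. bump e y *\<^sub>R (indicator (cball 0 e) y :: real)) = bump e"
    using bump_eq_0[OF assms, where 'a = 'a] by (auto simp: indicator_def fun_eq_iff dist_norm)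
  ultimately show ?thesis by simp
qed

lemma measurable_bump [measurable]: "(bump e :: 'a::euclidean_space \<Rightarrow> real) \<in> borel_measurable borel"
  by (intro borel_measurable_continuous_onI bump_alg_continuous bump_alg)

lemma integral_bump_pos:
  assumes "e > 0"
  shows "(\<integral>w. bump e (w::'a::euclidean_space) \<partial>lborel) > 0"
proof (rule ccontr)
  assume "\<not> ?thesis"
  moreover have "(\<integral>w. bump e (w::'a) \<partial>lborel) \<ge> 0"
    by (simp add: bump_nonneg)
  ultimately have "(\<integral>w. bump e (w::'a) \<partial>lborel) = 0" by simp
  then have "AE w in lborel. bump e (w::'a) = 0"
    using integral_nonneg_eq_0_iff_AE[OF integrable_bump[OF assms]] bump_nonneg by auto
  then have "AE w in lborel. (w::'a) \<notin> ball 0 e"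
    by eventually_elim (use bump_pos_iff[OF assms] in force)
  then have "emeasure lborel (ball (0::'a) e) = 0"
    by (subst (asm) AE_iff_measurable[of "ball 0 e"]) auto
  then show False
    using assms content_ball_pos[of e "0::'a"] by (simp add: measure_def)
qed

lemma nn_integral_bump:
  fixes y z :: "'a::euclidean_space"
  assumes "e > 0"
  shows "(\<integral>\<^sup>+y. ennreal (bump e (z - y)) \<partial>lborel) = ennreal (\<integral>w. bump e (w::'a) \<partial>lborel)"
    and "(\<integral>\<^sup>+z. ennreal (bump e (z - y)) \<partial>lborel) = ennreal (\<integral>w. bump e (w::'a) \<partial>lborel)"
proof -
  have *: "(\<integral>\<^sup>+w. ennreal (bump e (w::'a)) \<partial>lborel) = ennreal (\<integral>w. bump e (w::'a) \<partial>lborel)"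
    by (intro nn_integral_eq_integral integrable_bump assms AE_I2 bump_nonneg)
  show "(\<integral>\<^sup>+y. ennreal (bump e (z - y)) \<partial>lborel) = ennreal (\<integral>w. bump e (w::'a) \<partial>lborel)"
    using nn_integral_lborel_reflect[of "\<lambda>w. ennreal (bump e w)" z] * by simp
  show "(\<integral>\<^sup>+z. ennreal (bump e (z - y)) \<partial>lborel) = ennreal (\<integral>w. bump e (w::'a) \<partial>lborel)"
    using nn_integral_lborel_affine[of "\<lambda>w. ennreal (bump e w)" 1 "- y"] * by simp
qed

lemma mollify_has_derivative:
  fixes F :: "'a::euclidean_space \<Rightarrow> 'b::euclidean_space"
  assumes F: "integrable lborel F" and M: "\<And>y. F y \<noteq> 0 \<Longrightarrow> norm y \<le> M"
  shows "(mollify e F has_derivative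
     (\<lambda>h. (1 / (\<integral>w. bump e (w::'a) \<partial>lborel)) *\<^sub>R
       (\<integral>y. (bump_grad (bump e) (z - y) \<bullet> h) *\<^sub>R F y \<partial>lborel))) (at z)"
  unfolding mollify_def[abs_def]
  by (intro has_derivative_scaleR_right convolution_has_derivative[OF bump_alg F M])

lemma mollify_continuous:
  fixes F :: "'a::euclidean_space \<Rightarrow> 'b::euclidean_space"
  assumes "integrable lborel F" and "\<And>y. F y \<noteq> 0 \<Longrightarrow> norm y \<le> M"
  shows "continuous_on S (mollify e F)"
  using mollify_has_derivative[OF assms]
  by (intro continuous_at_imp_continuous_on ballI has_derivative_continuous)

text \<open>The derivative falls on the bump and \<open>weak\<close> moves it to \<open>F\<close>.
  That identity is assumed for this z and e only, so the lemma applies wherever the ball of radius e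
  around z fits into the domain of the weak gradient.\<close>

lemma mollify_gradient:
  fixes F :: "'a::euclidean_space \<Rightarrow> 'b::euclidean_space" and G :: "'a \<Rightarrow> 'a \<Rightarrow> 'b"
  assumes F: "integrable lborel F" and M: "\<And>y. F y \<noteq> 0 \<Longrightarrow> norm y \<le> M"
    and weak: "\<And>i. i \<in> Basis \<Longrightarrow>
      (\<integral>y. (bump_grad (bump e) (z - y) \<bullet> i) *\<^sub>R F y \<partial>lborel) = (\<integral>y. bump e (z - y) *\<^sub>R G i y \<partial>lborel)"
  shows "(mollify e F has_derivative (\<lambda>h. \<Sum>i\<in>Basis. (h \<bullet> i) *\<^sub>R mollify e (G i) z)) (at z)"
proof -
  let ?D = "\<lambda>h. (1 / (\<integral>w. bump e (w::'a) \<partial>lborel)) *\<^sub>R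
       (\<integral>y. (bump_grad (bump e) (z - y) \<bullet> h) *\<^sub>R F y \<partial>lborel)"
  have D: "(mollify e F has_derivative ?D) (at z)"
    by (rule mollify_has_derivative[OF F M])
  have "?D h = (\<Sum>i\<in>Basis. (h \<bullet> i) *\<^sub>R mollify e (G i) z)" for h
  proof -
    have "linear ?D" using D has_derivative_linear by blast
    then have "?D h = (\<Sum>i\<in>Basis. (h \<bullet> i) *\<^sub>R ?D i)"
      by (rule linear_basis_sum)
    also have "\<dots> = (\<Sum>i\<in>Basis. (h \<bullet> i) *\<^sub>R mollify e (G i) z)"
      by (intro sum.cong) (simp_all add: weak mollify_def)
    finally show ?thesis .
  qed
  then show ?thesis using D by simp
qed

text \<open>The normalised bump is a probability density, so the constant \<open>F z\<close> may be
  brought under the integral.\<close>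

lemma mollify_diff_le:
  fixes F :: "'a::euclidean_space \<Rightarrow> 'b::euclidean_space"
  assumes F: "integrable lborel F" and M: "\<And>y. F y \<noteq> 0 \<Longrightarrow> norm y \<le> M" and e: "e > 0"
  shows "ennreal (norm (mollify e F z - F z)) \<le>
    ennreal (1 / (\<integral>w. bump e (w::'a) \<partial>lborel)) * (\<integral>\<^sup>+y. ennreal (bump e (z - y)) * ennreal (norm (F y - F z)) \<partial>lborel)"
proof -
  let ?m = "\<integral>w. bump e (w::'a) \<partial>lborel"
  have m: "?m > 0" using integral_bump_pos[OF e] .
  have m': "(\<integral>y. bump e (z - y) \<partial>lborel) = ?m"
    using nn_integral_bump(1)[OF e, of z] m
    by (subst integral_eq_nn_integral) (auto simp: bump_nonneg)
  have i2: "integrable lborel (\<lambda>y. bump e (z - y))"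
    using nn_integral_bump(1)[OF e, of z]
    by (intro integrableI_bounded) (auto simp: bump_nonneg)
  have i1: "integrable lborel (\<lambda>y. bump e (z - y) *\<^sub>R F y)"
    by (rule integrable_mult_continuous[OF _ F M])
      (auto intro!: bump_alg_continuous bump_translate_alg)
  have eq: "mollify e F z - F z = (1 / ?m) *\<^sub>R (\<integral>y. bump e (z - y) *\<^sub>R (F y - F z) \<partial>lborel)"
    using m i1 i2 by (simp add: mollify_def scaleR_diff_right m')
  have "ennreal (norm (\<integral>y. bump e (z - y) *\<^sub>R (F y - F z) \<partial>lborel))
      \<le> (\<integral>\<^sup>+y. norm (bump e (z - y) *\<^sub>R (F y - F z)) \<partial>lborel)"
    using i1 i2 by (intro integral_norm_bound_ennreal) (auto simp: scaleR_diff_right)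
  also have "\<dots> = (\<integral>\<^sup>+y. ennreal (bump e (z - y)) * ennreal (norm (F y - F z)) \<partial>lborel)"
    by (simp add: bump_nonneg ennreal_mult)
  finally have "ennreal (1 / ?m) * ennreal (norm (\<integral>y. bump e (z - y) *\<^sub>R (F y - F z) \<partial>lborel)) \<le>
     ennreal (1 / ?m) * (\<integral>\<^sup>+y. ennreal (bump e (z - y)) * ennreal (norm (F y - F z)) \<partial>lborel)"
    by (rule mult_left_mono) simp
  then show ?thesis
    using m by (simp add: eq ennreal_mult[symmetric])
qed

text \<open>Compare with a continuous \<open>p\<close> close to \<open>F\<close> in L1. Averaging
  does not increase the L1 norm of F - p and moves \<open>p\<close> by at most b, which gives three
  thirds of \<epsilon>. The gap between S and S' is the room into which averages centred in the
  smaller ball reach.\<close>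

lemma mollify_L1:
  fixes F :: "'a::euclidean_space \<Rightarrow> 'b::euclidean_space"
  assumes F: "integrable lborel F" and M: "\<And>y. F y \<noteq> 0 \<Longrightarrow> norm y \<le> M" and S: "S < S'"
  shows "(\<lambda>k. \<integral>\<^sup>+z\<in>ball x S. ennreal (norm (mollify (1 / Suc k) F z - F z)) \<partial>lborel) \<longlonglongrightarrow> 0"
proof (rule order_tendstoI)
  fix a :: ennreal assume "0 < a"
  then obtain \<epsilon> :: real where \<epsilon>: "\<epsilon> > 0" "ennreal \<epsilon> \<le> a"
    by (cases a) (auto intro: that[of 1])
  have [measurable]: "F \<in> borel_measurable borel" using F by auto
  obtain p where p: "continuous_on UNIV p"
    "(\<integral>\<^sup>+y\<in>cball x S'. ennreal (norm (F y - p y)) \<partial>lborel) < ennreal (\<epsilon> / 3)"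
    using continuous_L1_approx[OF F, of "\<epsilon>/3" x S'] \<epsilon> by auto
  have [measurable]: "cball x S' \<in> sets borel" "ball x S \<in> sets borel"
    by (simp_all add: borel_closed borel_open)
  have [measurable]: "p \<in> borel_measurable borel"
    using p(1) by (rule borel_measurable_continuous_onI)
  define b where "b = \<epsilon> / (3 * (measure lborel (ball x S) + 1))"
  have b: "b > 0" "ennreal b * emeasure lborel (ball x S) \<le> ennreal (\<epsilon> / 3)"
  proof -
    show "b > 0" using \<epsilon> by (auto simp: b_def intro!: divide_pos_pos mult_pos_pos add_nonneg_pos)
    have "emeasure lborel (ball x S) = ennreal (measure lborel (ball x S))"
      using emeasure_lborel_ball_finite by (intro emeasure_eq_ennreal_measure) (auto simp: less_top[symmetric])
    moreover have "b * measure lborel (ball x S) \<le> \<epsilon> / 3"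
      using \<epsilon> by (auto simp: b_def field_simps add_pos_nonneg)
    ultimately show "ennreal b * emeasure lborel (ball x S) \<le> ennreal (\<epsilon> / 3)"
      using \<open>b > 0\<close> by (auto simp: ennreal_mult[symmetric] intro!: ennreal_leI)
  qed
  have "uniformly_continuous_on (cball x S') p"
    by (intro compact_uniformly_continuous continuous_on_subset[OF p(1)]) auto
  then obtain d where d: "d > 0"
    "\<And>v w. v \<in> cball x S' \<Longrightarrow> w \<in> cball x S' \<Longrightarrow> dist v w < d \<Longrightarrow> dist (p v) (p w) < b"
    unfolding uniformly_continuous_on_def using b(1) by metis
  define A where "A y = ennreal (norm (F y - p y)) * indicator (cball x S') y" for y
  have A_meas [measurable]: "A \<in> borel_measurable borel" by (simp add: A_def[abs_def])
  have main: "(\<integral>\<^sup>+z\<in>ball x S. ennreal (norm (mollify e F z - F z)) \<partial>lborel) < a"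
    if e: "e > 0" "e < d" "e < S' - S" for e
  proof -
    let ?E = "\<lambda>z. \<integral>\<^sup>+y. ennreal (bump e (z - y)) * A y \<partial>lborel"
    let ?m = "\<integral>w. bump e (w::'a) \<partial>lborel"
    have m: "?m > 0" using integral_bump_pos[OF e(1)] .
    have mm: "ennreal (1 / ?m) * ennreal ?m = 1"
      using m by (simp add: ennreal_mult[symmetric])
    have pt: "ennreal (norm (mollify e F z - F z)) \<le>
        ennreal (1 / ?m) * ?E z + (ennreal b + A z)"
      if z: "z \<in> ball x S" for z
    proof -
      have zc: "z \<in> cball x S'" using z S by auto
      have "ennreal (bump e (z - y)) * ennreal (norm (F y - F z))
          \<le> ennreal (bump e (z - y)) * A y + ennreal (bump e (z - y)) * (ennreal b + A z)" for y
      proof (cases "norm (z - y) < e")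
        case True
        then have yc: "y \<in> cball x S'"
          using z e dist_triangle[of x y z] by (auto simp: dist_norm)
        have "norm (p y - p z) \<le> b"
          using d(2)[OF yc zc] True e by (simp add: dist_norm norm_minus_commute)
        then have "norm (F y - F z) \<le> norm (F y - p y) + (b + norm (F z - p z))"
          using norm_triangle_ineq[of "F y - p y" "p y - p z"]
            norm_triangle_ineq[of "F y - p z" "p z - F z"] by (simp add: norm_minus_commute)
        then have "ennreal (norm (F y - F z)) \<le> A y + (ennreal b + A z)"
          using b(1) zc yc by (auto simp: A_def ennreal_plus[symmetric] intro!: ennreal_leI simp del: ennreal_plus)
        then show ?thesis
          by (simp add: mult_left_mono distrib_left[symmetric])
      next
        case False
        then show ?thesis using bump_eq_0[OF e(1), of "z - y"] by simp
      qed
      then have "(\<integral>\<^sup>+y. ennreal (bump e (z - y)) * ennreal (norm (F y - F z)) \<partial>lborel)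
         \<le> (\<integral>\<^sup>+y. ennreal (bump e (z - y)) * A y + ennreal (bump e (z - y)) * (ennreal b + A z) \<partial>lborel)"
        by (intro nn_integral_mono)
      also have "\<dots> = ?E z + ennreal ?m * (ennreal b + A z)"
        by (subst nn_integral_add) (auto simp: nn_integral_multc nn_integral_bump[OF e(1)])
      finally have "ennreal (1 / ?m) * (\<integral>\<^sup>+y. ennreal (bump e (z - y)) * ennreal (norm (F y - F z)) \<partial>lborel)
        \<le> ennreal (1 / ?m) * (?E z + ennreal ?m * (ennreal b + A z))"
        by (rule mult_left_mono) simp
      also have "\<dots> = ennreal (1 / ?m) * ?E z + (ennreal b + A z)"
        by (simp only: distrib_left mult.assoc[symmetric] mm mult_1)
      finally show ?thesis
        using mollify_diff_le[OF F M e(1), of z] by (meson order.trans)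
    qed
    have "(\<integral>\<^sup>+z\<in>ball x S. ennreal (norm (mollify e F z - F z)) \<partial>lborel)
      \<le> (\<integral>\<^sup>+z. ennreal (1 / ?m) * ?E z + (ennreal b * indicator (ball x S) z + A z) \<partial>lborel)"
      by (intro nn_integral_mono) (auto simp: indicator_def intro!: order.trans[OF pt])
    also have "\<dots> = (\<integral>\<^sup>+z. ennreal (1 / ?m) * ?E z \<partial>lborel)
        + (ennreal b * emeasure lborel (ball x S) + (\<integral>\<^sup>+z. A z \<partial>lborel))"
      by (subst nn_integral_add, measurable)
        (subst nn_integral_add, auto simp: nn_integral_cmult_indicator)
    \<comment> \<open>Tonelli: integrating the bump over its centre z returns its full mass, so
      smearing \<open>A\<close> preserves the integral.\<close>
    also have "(\<integral>\<^sup>+z. ennreal (1 / ?m) * ?E z \<partial>lborel)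
        = ennreal (1 / ?m) * (\<integral>\<^sup>+y. (\<integral>\<^sup>+z. ennreal (bump e (z - y)) * A y \<partial>lborel) \<partial>lborel)"
      by (subst nn_integral_cmult, measurable) (subst lborel_pair.Fubini', auto)
    also have "\<dots> = (\<integral>\<^sup>+z. A z \<partial>lborel)"
      by (simp add: nn_integral_multc nn_integral_bump[OF e(1)] nn_integral_cmult mult.assoc[symmetric] mm)
    also have "(\<integral>\<^sup>+z. A z \<partial>lborel) + (ennreal b * emeasure lborel (ball x S) + (\<integral>\<^sup>+z. A z \<partial>lborel))
       < ennreal (\<epsilon>/3 + \<epsilon>/3 + \<epsilon>/3)"
      using p(2) b(2) \<epsilon> by (intro ennreal_add3_less) (auto simp: A_def)
    also have "\<dots> = ennreal \<epsilon>" by simp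
    finally show ?thesis using \<epsilon>(2) by simp
  qed
  obtain N where N: "1 / Suc N < min d (S' - S)"
    using nat_approx_posE[of "min d (S' - S)"] d S by auto
  show "\<forall>\<^sub>F k in sequentially. (\<integral>\<^sup>+z\<in>ball x S. ennreal (norm (mollify (1 / Suc k) F z - F z)) \<partial>lborel) < a"
  proof (intro eventually_sequentiallyI[of N] main)
    fix k assume "N \<le> k"
    then have "1 / real (Suc k) \<le> 1 / real (Suc N)" by (intro divide_left_mono) auto
    with N show "1 / real (Suc k) < d" "1 / real (Suc k) < S' - S" by auto
  qed auto
qed auto

section \<open>Integrals along segments\<close>

lemma sets_ball_borel [measurable]: "ball x r \<in> sets borel"
  by (simp add: borel_open)

text \<open>The sum M + tS stands in for the maximum of M and tS, at the cost of a constant, because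
  the integrand then has the primitive -4 / (M + tS).\<close>

lemma nn_integral_kernel_le:
  fixes M S :: real
  assumes "M > 0" "S > 0"
  shows "(\<integral>\<^sup>+t\<in>{0..1}. ennreal (S * (4 / (M + t * S)\<^sup>2)) \<partial>lborel) \<le> ennreal (4 / M)"
proof -
  have pos: "M + t * S > 0" if "t \<ge> 0" for t
    using assms that by (intro add_pos_nonneg) auto
  have "(\<integral>\<^sup>+t. ennreal (S * (4 / (M + t * S)\<^sup>2)) * indicator {0..1} t \<partial>lborel)
      = ennreal ((- 4 / (M + 1 * S)) - (- 4 / (M + 0 * S)))"
  proof (rule nn_integral_FTC_Icc)
    fix t :: real assume t: "t \<in> {0..1}"
    then show "((\<lambda>t. - 4 / (M + t * S)) has_real_derivative S * (4 / (M + t * S)\<^sup>2)) (at t)"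
      using pos[of t] by (auto intro!: derivative_eq_intros simp: power2_eq_square)
    show "0 \<le> S * (4 / (M + t * S)\<^sup>2)" using assms by simp
  qed auto
  also have "\<dots> \<le> ennreal (4 / M)"
    using assms by (intro ennreal_leI) auto
  finally show ?thesis .
qed

text \<open>Two of the n factors suffice for integrability in t; the other n - 2 are bounded below
  by M.\<close>

lemma power_max_le:
  fixes M S t :: real
  assumes "n \<ge> 2" "M > 0" "S > 0" "t \<ge> 0"
  shows "1 / max M (t * S) ^ n \<le> (1 / M ^ (n - 2)) * (4 / (M + t * S)\<^sup>2)"
proof -
  let ?m = "max M (t * S)"
  have m: "?m > 0" "M \<le> ?m" "(M + t * S) / 2 \<le> ?m" using assms by auto
  have "1 / ?m ^ n = (1 / ?m ^ (n - 2)) * (1 / ?m\<^sup>2)"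
  proof -
    obtain k where "n = k + 2" using assms(1) by (metis add.commute le_Suc_ex)
    then show ?thesis by (simp add: power_add power2_eq_square)
  qed
  also have "\<dots> \<le> (1 / M ^ (n - 2)) * (1 / ((M + t * S) / 2)\<^sup>2)"
    using assms m by (intro mult_mono divide_left_mono power_mono mult_pos_pos zero_less_power) (auto intro!: add_pos_nonneg)
  finally show ?thesis by (simp add: power_divide)
qed

text \<open>For fixed y' the map y -> d y' + c y scales volume by c^n and lands in \<open>Z\<close>;
  the variable y' then contributes only the volume of its ball. Either endpoint of a segment can
  play the role of y.\<close>

lemma segment_mean_le:
  fixes W :: "'a::euclidean_space \<Rightarrow> ennreal"
  assumes [measurable]: "W \<in> borel_measurable borel" and c: "c > 0"
    and r: "0 \<le> r" and sub: "\<And>y y'. y \<in> ball x q \<Longrightarrow> y' \<in> ball x r \<Longrightarrow> d *\<^sub>R y' + c *\<^sub>R y \<in> Z"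
    and [measurable]: "Z \<in> sets borel"
  shows "(\<integral>\<^sup>+y'\<in>ball x r. (\<integral>\<^sup>+y\<in>ball x q. W (d *\<^sub>R y' + c *\<^sub>R y) \<partial>lborel) \<partial>lborel)
     \<le> ennreal (unit_ball_vol (real DIM('a)) * r ^ DIM('a) / c ^ DIM('a)) * (\<integral>\<^sup>+z\<in>Z. W z \<partial>lborel)"
proof -
  let ?I = "\<integral>\<^sup>+z\<in>Z. W z \<partial>lborel"
  have inner: "(\<integral>\<^sup>+y\<in>ball x q. W (d *\<^sub>R y' + c *\<^sub>R y) \<partial>lborel) \<le> ennreal (1 / c ^ DIM('a)) * ?I"
    if "y' \<in> ball x r" for y'
  proof -
    have "(\<integral>\<^sup>+y\<in>ball x q. W (d *\<^sub>R y' + c *\<^sub>R y) \<partial>lborel)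
        \<le> (\<integral>\<^sup>+y. W (d *\<^sub>R y' + c *\<^sub>R y) * indicator Z (d *\<^sub>R y' + c *\<^sub>R y) \<partial>lborel)"
      using sub[OF _ that] by (intro nn_integral_mono) (auto simp: indicator_def)
    also have "\<dots> = ennreal (1 / c ^ DIM('a)) * ?I"
      using c nn_integral_lborel_affine[of "\<lambda>z. W z * indicator Z z" c "d *\<^sub>R y'"] by simp
    finally show ?thesis .
  qed
  have "(\<integral>\<^sup>+y'\<in>ball x r. (\<integral>\<^sup>+y\<in>ball x q. W (d *\<^sub>R y' + c *\<^sub>R y) \<partial>lborel) \<partial>lborel)
      \<le> (\<integral>\<^sup>+y'. (ennreal (1 / c ^ DIM('a)) * ?I) * indicator (ball x r) y' \<partial>lborel)"
    using inner by (intro nn_integral_mono) (auto simp: indicator_def)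
  also have "\<dots> = (ennreal (1 / c ^ DIM('a)) * ?I) * emeasure lborel (ball x r)"
    by (subst nn_integral_cmult_indicator) auto
  also have "\<dots> = ennreal (unit_ball_vol (real DIM('a)) * r ^ DIM('a) / c ^ DIM('a)) * ?I"
  proof -
    have "ennreal (unit_ball_vol (real DIM('a)) * r ^ DIM('a) / c ^ DIM('a))
        = ennreal (1 / c ^ DIM('a)) * ennreal (unit_ball_vol (real DIM('a)) * r ^ DIM('a))"
      using r c by (simp add: ennreal_mult[symmetric])
    then show ?thesis
      by (simp only: emeasure_ball[OF r] mult_ac)
  qed
  finally show ?thesis .
qed

text \<open>At time t the segment point z is an affine image of each endpoint. Changing variables in
  the endpoint with the larger scaled coefficient gives the Jacobian factor \<rho>^(-n), where
  \<rho> is the maximum of tS and (1-t)s. Since z lies within tS + (1-t)s <= 2\<rho> of x and \<rho>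
  >= s/2, this factor is bounded by a kernel in z and t alone.\<close>

lemma segment_energy:
  fixes W :: "'a::euclidean_space \<Rightarrow> ennreal"
  assumes [measurable]: "W \<in> borel_measurable borel" and n: "DIM('a) \<ge> 2" and s: "0 < s" "s \<le> S"
    and t: "0 \<le> t" "t \<le> 1"
  shows "(\<integral>\<^sup>+y\<in>ball x S. (\<integral>\<^sup>+y'\<in>ball x s. W ((1 - t) *\<^sub>R y' + t *\<^sub>R y) \<partial>lborel) \<partial>lborel)
    \<le> ennreal (unit_ball_vol (real DIM('a)) * s ^ DIM('a) * S ^ DIM('a)) *
       (\<integral>\<^sup>+z\<in>ball x S. W z * ennreal (1 / max (max (dist x z) s / 2) (t * S) ^ DIM('a)) \<partial>lborel)"
proof -
  define n where "n = DIM('a)"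
  define \<omega> where "\<omega> = unit_ball_vol (real DIM('a))"
  have \<omega>: "\<omega> > 0" unfolding \<omega>_def by simp
  have S: "S > 0" using s by simp
  define Z where "Z = ball x (t * S + (1 - t) * s)"
  have [measurable]: "Z \<in> sets borel" by (simp add: Z_def borel_open)
  define \<rho> where "\<rho> = max (t * S) ((1 - t) * s)"
  have \<rho>s: "\<rho> \<ge> s / 2"
  proof (cases "t \<ge> 1/2")
    case True
    then have "1/2 * s \<le> t * S" using s by (intro mult_mono) auto
    then show ?thesis by (simp add: \<rho>_def)
  next
    case False
    then have "1/2 * s \<le> (1 - t) * s" using s by (intro mult_right_mono) auto
    then show ?thesis by (simp add: \<rho>_def)
  qed
  then have \<rho>: "\<rho> > 0" using s by simp
  have sub: "(1 - t) *\<^sub>R y' + t *\<^sub>R y \<in> Z" if "y \<in> ball x S" "y' \<in> ball x s" for y y'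
  proof -
    have "x - ((1 - t) *\<^sub>R y' + t *\<^sub>R y) = (1 - t) *\<^sub>R (x - y') + t *\<^sub>R (x - y)"
      by (simp add: algebra_simps)
    then have "dist x ((1 - t) *\<^sub>R y' + t *\<^sub>R y) \<le> (1 - t) * dist x y' + t * dist x y"
      using t norm_triangle_ineq[of "(1 - t) *\<^sub>R (x - y')" "t *\<^sub>R (x - y)"] by (simp add: dist_norm)
    also have "\<dots> < (1 - t) * s + t * S"
    proof (cases "t = 0")
      case False
      then have "t * dist x y < t * S" using t that by simp
      moreover have "(1 - t) * dist x y' \<le> (1 - t) * s" using t that by (intro mult_left_mono) auto
      ultimately show ?thesis by linarith
    qed (use that in simp)
    finally show ?thesis by (simp add: Z_def add.commute)
  qed
  let ?W = "\<lambda>y' y. W ((1 - t) *\<^sub>R y' + t *\<^sub>R y)"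
  let ?J = "\<integral>\<^sup>+y\<in>ball x S. (\<integral>\<^sup>+y'\<in>ball x s. ?W y' y \<partial>lborel) \<partial>lborel"
  have J: "?J \<le> ennreal (\<omega> * s ^ n * S ^ n / \<rho> ^ n) * (\<integral>\<^sup>+z\<in>Z. W z \<partial>lborel)"
  \<comment> \<open>Which endpoint to substitute for: y when tS dominates, y' otherwise. The bound
    has the same form in both cases.\<close>
  proof (cases "t * S \<ge> (1 - t) * s")
    case True
    then have r: "\<rho> = t * S" by (simp add: \<rho>_def)
    then have t0: "t > 0" using \<rho> S t by (auto simp: zero_less_mult_iff)
    have "?J = (\<integral>\<^sup>+y. (\<integral>\<^sup>+y'. ?W y' y * indicator (ball x s) y' * indicator (ball x S) y \<partial>lborel) \<partial>lborel)"
      by (intro nn_integral_cong nn_integral_multc[symmetric]) measurable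
    also have "\<dots> = (\<integral>\<^sup>+y'. (\<integral>\<^sup>+y. ?W y' y * indicator (ball x s) y' * indicator (ball x S) y \<partial>lborel) \<partial>lborel)"
      by (rule lborel_pair.Fubini') measurable
    also have "\<dots> = (\<integral>\<^sup>+y'\<in>ball x s. (\<integral>\<^sup>+y\<in>ball x S. ?W y' y \<partial>lborel) \<partial>lborel)"
      by (subst nn_integral_multc[symmetric], measurable) (simp add: mult_ac)
    also have "\<dots> \<le> ennreal (\<omega> * s ^ n / t ^ n) * (\<integral>\<^sup>+z\<in>Z. W z \<partial>lborel)"
      unfolding \<omega>_def n_def using sub s t0 by (intro segment_mean_le) auto
    also have "\<omega> * s ^ n / t ^ n = \<omega> * s ^ n * S ^ n / \<rho> ^ n"
      using S by (simp add: r power_mult_distrib)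
    finally show ?thesis .
  next
    case False
    then have r: "\<rho> = (1 - t) * s" by (simp add: \<rho>_def)
    then have t0: "1 - t > 0" using \<rho> s t by (auto simp: zero_less_mult_iff)
    have "?J = (\<integral>\<^sup>+y\<in>ball x S. (\<integral>\<^sup>+y'\<in>ball x s. W (t *\<^sub>R y + (1 - t) *\<^sub>R y') \<partial>lborel) \<partial>lborel)"
      by (simp add: add.commute)
    also have "\<dots> \<le> ennreal (\<omega> * S ^ n / (1 - t) ^ n) * (\<integral>\<^sup>+z\<in>Z. W z \<partial>lborel)"
      unfolding \<omega>_def n_def using sub S t0 by (intro segment_mean_le) (auto simp: add.commute)
    also have "\<omega> * S ^ n / (1 - t) ^ n = \<omega> * s ^ n * S ^ n / \<rho> ^ n"
      using s by (simp add: r power_mult_distrib)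
    finally show ?thesis .
  qed
  have pt: "ennreal (1 / \<rho> ^ n) * indicator Z z \<le>
     ennreal (1 / max (max (dist x z) s / 2) (t * S) ^ n) * indicator (ball x S) z" for z
  proof (cases "z \<in> Z")
    case True
    have "t * S + (1 - t) * s \<le> t * S + (1 - t) * S"
      using s t by (intro add_left_mono mult_left_mono) auto
    then have "z \<in> ball x S" using True by (simp add: Z_def algebra_simps)
    moreover have "dist x z \<le> 2 * \<rho>" using True by (simp add: Z_def \<rho>_def)
    then have "max (max (dist x z) s / 2) (t * S) \<le> \<rho>" using \<rho>s by (simp add: \<rho>_def)
    moreover have "max (max (dist x z) s / 2) (t * S) > 0" using s by (simp add: less_max_iff_disj)
    ultimately show ?thesis
      using True \<rho> by (auto intro!: ennreal_leI divide_left_mono power_mono mult_pos_pos zero_less_power)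
  qed simp
  have "?J \<le> ennreal (\<omega> * s ^ n * S ^ n) * (ennreal (1 / \<rho> ^ n) * (\<integral>\<^sup>+z\<in>Z. W z \<partial>lborel))"
    using J \<omega> s \<rho> by (simp add: mult.assoc[symmetric] ennreal_mult[symmetric])
  also have "ennreal (1 / \<rho> ^ n) * (\<integral>\<^sup>+z\<in>Z. W z \<partial>lborel) = (\<integral>\<^sup>+z. W z * (ennreal (1 / \<rho> ^ n) * indicator Z z) \<partial>lborel)"
    by (subst nn_integral_cmult[symmetric]) (auto simp: mult_ac)
  also have "\<dots> \<le> (\<integral>\<^sup>+z. W z * (ennreal (1 / max (max (dist x z) s / 2) (t * S) ^ n) * indicator (ball x S) z) \<partial>lborel)"
    by (intro nn_integral_mono mult_left_mono pt) simp
  finally show ?thesis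
    by (simp add: \<omega>_def n_def mult.assoc mult_left_mono)
qed

text \<open>After \<open>segment_energy\<close> at each t, Tonelli allows integrating over t for
  fixed z: S dt / max (M, tS)^n has integral of order M^(1-n), with M half of the maximum of |x - z|
  and s. The result is the Riesz kernel of a first-order potential, cut off at s.\<close>

lemma double_integral_kernel:
  fixes W :: "'a::euclidean_space \<Rightarrow> ennreal" and v :: "'a \<Rightarrow> real"
  assumes [measurable]: "W \<in> borel_measurable borel" and n: "DIM('a) \<ge> 2" and s: "0 < s" "s \<le> S"
    and v: "\<And>y y'. y \<in> ball x S \<Longrightarrow> y' \<in> ball x s \<Longrightarrow>
      ennreal \<bar>v y - v y'\<bar> \<le> ennreal (2 * S) * (\<integral>\<^sup>+t\<in>{0..1}. W ((1 - t) *\<^sub>R y' + t *\<^sub>R y) \<partial>lborel)"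
  shows "(\<integral>\<^sup>+y\<in>ball x S. (\<integral>\<^sup>+y'\<in>ball x s. ennreal \<bar>v y - v y'\<bar> \<partial>lborel) \<partial>lborel)
    \<le> ennreal (unit_ball_vol (real DIM('a)) * s ^ DIM('a) * S ^ DIM('a) * 2 ^ (DIM('a) + 2)) *
       (\<integral>\<^sup>+z\<in>ball x S. W z * ennreal (1 / max (dist x z) s ^ (DIM('a) - 1)) \<partial>lborel)"
proof -
  let ?W = "\<lambda>t y' y. W ((1 - t) *\<^sub>R y' + t *\<^sub>R y)"
  let ?T = "\<lambda>t y' y. ennreal (2 * S) * ?W t y' y * indicator {0..1} t * indicator (ball x s) y' * indicator (ball x S) y"
  define n where "n = DIM('a)"
  have n2: "n \<ge> 2" using n by (simp add: n_def)
  define C where "C = unit_ball_vol (real DIM('a)) * s ^ DIM('a) * S ^ DIM('a)"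
  have S: "S > 0" using s by simp
  have C: "C \<ge> 0" using s by (simp add: C_def)
  let ?I = "indicator :: _ \<Rightarrow> _ \<Rightarrow> ennreal"
  let ?K = "\<lambda>z t. ennreal (1 / max (max (dist x z) s / 2) (t * S) ^ n)"
  have "(\<integral>\<^sup>+y\<in>ball x S. (\<integral>\<^sup>+y'\<in>ball x s. ennreal \<bar>v y - v y'\<bar> \<partial>lborel) \<partial>lborel)
     \<le> (\<integral>\<^sup>+y. (\<integral>\<^sup>+y'. (ennreal (2 * S) * (\<integral>\<^sup>+t\<in>{0..1}. ?W t y' y \<partial>lborel)) * ?I (ball x s) y' \<partial>lborel) * ?I (ball x S) y \<partial>lborel)"
  proof (intro nn_integral_mono)
    fix y
    show "(\<integral>\<^sup>+y'\<in>ball x s. ennreal \<bar>v y - v y'\<bar> \<partial>lborel) * ?I (ball x S) y \<le>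
      (\<integral>\<^sup>+y'. (ennreal (2 * S) * (\<integral>\<^sup>+t\<in>{0..1}. ?W t y' y \<partial>lborel)) * ?I (ball x s) y' \<partial>lborel) * ?I (ball x S) y"
    proof (cases "y \<in> ball x S")
      case True
      have "ennreal \<bar>v y - v y'\<bar> * ?I (ball x s) y' \<le>
          ennreal (2 * S) * (\<integral>\<^sup>+t\<in>{0..1}. ?W t y' y \<partial>lborel) * ?I (ball x s) y'" for y'
        using v[OF True, of y'] by (cases "y' \<in> ball x s") simp_all
      then show ?thesis
        by (rule mult_right_mono[OF nn_integral_mono]) simp
    qed simp
  qed
  also have "\<dots> = (\<integral>\<^sup>+y. (\<integral>\<^sup>+y'. (\<integral>\<^sup>+t. ?T t y' y \<partial>lborel) \<partial>lborel) \<partial>lborel)"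
    by (simp add: nn_integral_multc[symmetric] nn_integral_cmult[symmetric] mult.assoc)
  also have "\<dots> = (\<integral>\<^sup>+y. (\<integral>\<^sup>+t. (\<integral>\<^sup>+y'. ?T t y' y \<partial>lborel) \<partial>lborel) \<partial>lborel)"
    by (intro nn_integral_cong lborel_pair.Fubini') measurable
  also have "\<dots> = (\<integral>\<^sup>+t. (\<integral>\<^sup>+y. (\<integral>\<^sup>+y'. ?T t y' y \<partial>lborel) \<partial>lborel) \<partial>lborel)"
    by (intro lborel_pair.Fubini') measurable
  also have "\<dots> = (\<integral>\<^sup>+t. ennreal (2 * S) * (\<integral>\<^sup>+y\<in>ball x S. (\<integral>\<^sup>+y'\<in>ball x s. ?W t y' y \<partial>lborel) \<partial>lborel) * ?I {0..1} t \<partial>lborel)"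
    by (simp add: nn_integral_multc[symmetric] nn_integral_cmult[symmetric] mult_ac)
  also have "\<dots> \<le> (\<integral>\<^sup>+t. ennreal (2 * S) * (ennreal C * (\<integral>\<^sup>+z\<in>ball x S. W z * ?K z t \<partial>lborel)) * ?I {0..1} t \<partial>lborel)"
  proof (intro nn_integral_mono)
    fix t :: real
    show "ennreal (2 * S) * (\<integral>\<^sup>+y\<in>ball x S. (\<integral>\<^sup>+y'\<in>ball x s. ?W t y' y \<partial>lborel) \<partial>lborel) * ?I {0..1} t
      \<le> ennreal (2 * S) * (ennreal C * (\<integral>\<^sup>+z\<in>ball x S. W z * ?K z t \<partial>lborel)) * ?I {0..1} t"
    proof (cases "t \<in> {0..1}")
      case True
      then show ?thesis
        unfolding C_def n_def using s n by (intro mult_left_mono mult_right_mono segment_energy) auto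
    qed simp
  qed
  also have "\<dots> = (\<integral>\<^sup>+t. (\<integral>\<^sup>+z. ennreal (2 * C) * W z * ?I (ball x S) z * (ennreal S * ?K z t * ?I {0..1} t) \<partial>lborel) \<partial>lborel)"
    using S C by (simp add: nn_integral_multc[symmetric] nn_integral_cmult[symmetric] mult_ac ennreal_mult)
  also have "\<dots> = (\<integral>\<^sup>+z. (\<integral>\<^sup>+t. ennreal (2 * C) * W z * ?I (ball x S) z * (ennreal S * ?K z t * ?I {0..1} t) \<partial>lborel) \<partial>lborel)"
    by (intro lborel_pair.Fubini') measurable
  also have "\<dots> = (\<integral>\<^sup>+z. ennreal (2 * C) * W z * ?I (ball x S) z * (\<integral>\<^sup>+t. ennreal S * ?K z t * ?I {0..1} t \<partial>lborel) \<partial>lborel)"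
    by (intro nn_integral_cong nn_integral_cmult) measurable
  also have "\<dots> \<le> (\<integral>\<^sup>+z. ennreal (2 * C) * W z * ?I (ball x S) z * ennreal (2 ^ (n + 1) / max (dist x z) s ^ (n - 1)) \<partial>lborel)"
  proof (intro nn_integral_mono mult_left_mono)
    fix z
    define M where "M = max (dist x z) s / 2"
    have M: "M > 0" using s by (simp add: M_def less_max_iff_disj)
    have "(\<integral>\<^sup>+t. ennreal S * ?K z t * ?I {0..1} t \<partial>lborel)
       \<le> (\<integral>\<^sup>+t. ennreal (1 / M ^ (n - 2)) * (ennreal (S * (4 / (M + t * S)\<^sup>2)) * ?I {0..1} t) \<partial>lborel)"
    proof (intro nn_integral_mono)
      fix t :: real
      show "ennreal S * ?K z t * ?I {0..1} t \<le> ennreal (1 / M ^ (n - 2)) * (ennreal (S * (4 / (M + t * S)\<^sup>2)) * ?I {0..1} t)"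
      proof (cases "t \<in> {0..1}")
        case True
        then have "S * (1 / max M (t * S) ^ n) \<le> S * ((1 / M ^ (n - 2)) * (4 / (M + t * S)\<^sup>2))"
          using S n2 M by (intro mult_left_mono power_max_le) auto
        then show ?thesis
          using True S M by (simp add: M_def[symmetric] ennreal_mult[symmetric] ennreal_leI mult_ac)
      qed simp
    qed
    also have "\<dots> = ennreal (1 / M ^ (n - 2)) * (\<integral>\<^sup>+t\<in>{0..1}. (ennreal (S * (4 / (M + t * S)\<^sup>2))) \<partial>lborel)"
      by (intro nn_integral_cmult) measurable
    also have "\<dots> \<le> ennreal (1 / M ^ (n - 2)) * ennreal (4 / M)"
      by (intro mult_left_mono nn_integral_kernel_le M S) simp
    also have "\<dots> = ennreal (4 / M ^ (n - 1))"
    proof -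
      have "M ^ (n - 1) = M ^ (n - 2) * M" using n2 by (metis Suc_diff_le diff_Suc_Suc numeral_2_eq_2 power_Suc2 One_nat_def)
      then show ?thesis using M by (simp add: ennreal_mult[symmetric])
    qed
    also have "4 / M ^ (n - 1) = 2 ^ (n + 1) / max (dist x z) s ^ (n - 1)"
    proof -
      have "(2::real) ^ (n + 1) = 4 * 2 ^ (n - 1)" using n2 by (cases n) auto
      then show ?thesis by (simp add: M_def power_divide)
    qed
    finally show "(\<integral>\<^sup>+t. ennreal S * ?K z t * ?I {0..1} t \<partial>lborel) \<le> ennreal (2 ^ (n + 1) / max (dist x z) s ^ (n - 1))" .
  qed simp
  also have "\<dots> = (\<integral>\<^sup>+z. ennreal (C * 2 ^ (n + 2)) * (W z * ennreal (1 / max (dist x z) s ^ (n - 1)) * ?I (ball x S) z) \<partial>lborel)"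
  proof (intro nn_integral_cong)
    fix z
    have "ennreal (2 * C) * ennreal (2 ^ (n + 1) / max (dist x z) s ^ (n - 1)) = ennreal (C * 2 ^ (n + 2)) * ennreal (1 / max (dist x z) s ^ (n - 1))"
      using C s by (simp add: ennreal_mult[symmetric])
    moreover have "a * w * i * b = c * (w * d * i)" if "a * b = c * d" for a b c d w i :: ennreal
    proof -
      have "a * w * i * b = (a * b) * (w * i)" by (simp only: mult_ac)
      also have "\<dots> = c * (w * d * i)" unfolding that by (simp only: mult_ac)
      finally show ?thesis .
    qed
    ultimately show "ennreal (2 * C) * W z * ?I (ball x S) z * ennreal (2 ^ (n + 1) / max (dist x z) s ^ (n - 1))
      = ennreal (C * 2 ^ (n + 2)) * (W z * ennreal (1 / max (dist x z) s ^ (n - 1)) * ?I (ball x S) z)"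
      by blast
  qed
  also have "\<dots> = ennreal (C * 2 ^ (n + 2)) * (\<integral>\<^sup>+z\<in>ball x S. W z * ennreal (1 / max (dist x z) s ^ (n - 1)) \<partial>lborel)"
    by (intro nn_integral_cmult) measurable
  finally show ?thesis unfolding C_def n_def .
qed

section \<open>The regularised logarithmic potential\<close>

text \<open>For positive h this is the logarithm of \<open>reg_dist\<close>, and its own gradient
  has norm at most 1 / \<open>reg_dist\<close>. The parameter h keeps it smooth and bounded below at
  p.\<close>

definition log_potential :: "real \<Rightarrow> 'b::real_normed_vector \<Rightarrow> 'b \<Rightarrow> real" where
  "log_potential h p z = ln (h\<^sup>2 + (norm (z - p))\<^sup>2) / 2"

definition reg_dist :: "real \<Rightarrow> 'b::real_normed_vector \<Rightarrow> 'b \<Rightarrow> real" where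
  "reg_dist h p z = sqrt (h\<^sup>2 + (norm (z - p))\<^sup>2)"

lemma reg_dist_pos: "h > 0 \<Longrightarrow> reg_dist h p z > 0"
  by (simp add: reg_dist_def add_pos_nonneg)

lemma reg_dist_ge: "h > 0 \<Longrightarrow> h \<le> reg_dist h p z"
  unfolding reg_dist_def by (intro real_le_rsqrt) simp

lemma reg_dist_ge_norm: "norm (z - p) \<le> reg_dist h p z"
  unfolding reg_dist_def by (intro real_le_rsqrt) simp

lemma continuous_on_reg_dist: "continuous_on T (reg_dist h p)"
  unfolding reg_dist_def[abs_def] by (intro continuous_intros)

lemma continuous_on_log_potential: "h > 0 \<Longrightarrow> continuous_on T (log_potential h p)"
proof -
  assume h: "h > 0"
  have "h\<^sup>2 + (norm (z - p))\<^sup>2 \<noteq> 0" for z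
    using h by (metis add_pos_nonneg zero_le_power2 zero_less_power less_irrefl)
  then show ?thesis
    unfolding log_potential_def[abs_def] by (intro continuous_intros) auto
qed

lemma log_potential_has_derivative:
  fixes p :: "'b::real_inner"
  assumes "h > 0" "(q has_derivative q') (at t within T)"
  shows "((\<lambda>t. log_potential h p (q t)) has_derivative
      (\<lambda>u. ((q t - p) \<bullet> q' u) / (reg_dist h p (q t))\<^sup>2)) (at t within T)"
proof -
  have pos: "h\<^sup>2 + (q t - p) \<bullet> (q t - p) > 0"
    using assms(1) by (intro add_pos_nonneg) auto
  have "((\<lambda>t. ln (h\<^sup>2 + (q t - p) \<bullet> (q t - p)) / 2) has_derivative
      (\<lambda>u. ((q t - p) \<bullet> q' u) / (h\<^sup>2 + (q t - p) \<bullet> (q t - p)))) (at t within T)"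
    using pos by (auto intro!: derivative_eq_intros assms(2) simp: inner_commute fun_eq_iff field_simps)
  then show ?thesis
    using pos by (simp add: log_potential_def reg_dist_def power2_norm_eq_inner)
qed

lemma grad_norm_L2_set: "grad_norm G z = L2_set (\<lambda>i. norm (G i z)) Basis"
  by (simp add: grad_norm_def L2_set_def)

lemma grad_norm_nonneg: "0 \<le> grad_norm G z"
  by (simp add: grad_norm_L2_set)

lemma norm_gradient_apply_le:
  fixes G :: "'a::euclidean_space \<Rightarrow> 'a \<Rightarrow> 'b::euclidean_space"
  shows "norm (\<Sum>i\<in>Basis. (d \<bullet> i) *\<^sub>R G i z) \<le> norm d * grad_norm G z"
proof -
  have "norm (\<Sum>i\<in>Basis. (d \<bullet> i) *\<^sub>R G i z) \<le> (\<Sum>i\<in>Basis. \<bar>d \<bullet> i\<bar> * \<bar>norm (G i z)\<bar>)"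
    by (rule sum_norm_le) simp
  also have "\<dots> \<le> L2_set (\<lambda>i. d \<bullet> i) Basis * L2_set (\<lambda>i. norm (G i z)) Basis"
    by (rule L2_set_mult_ineq)
  also have "L2_set (\<lambda>i. d \<bullet> i) Basis = norm d"
    by (subst euclidean_dist_l2[of d 0, simplified dist_0_norm, simplified]) (simp add: L2_set_def dist_norm)
  finally show ?thesis by (simp add: grad_norm_L2_set)
qed

lemma grad_norm_le_add:
  "grad_norm G z \<le> grad_norm H z + (\<Sum>i\<in>Basis. norm (G i z - H i z))"
proof -
  have "grad_norm G z \<le> L2_set (\<lambda>i. norm (H i z) + norm (G i z - H i z)) Basis"
    unfolding grad_norm_L2_set
    by (intro L2_set_mono) (auto intro: norm_triangle_sub)
  also have "\<dots> \<le> grad_norm H z + L2_set (\<lambda>i. norm (G i z - H i z)) Basis"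
    unfolding grad_norm_L2_set by (rule L2_set_triangle_ineq)
  also have "L2_set (\<lambda>i. norm (G i z - H i z)) Basis \<le> (\<Sum>i\<in>Basis. norm (G i z - H i z))"
    by (rule L2_set_le_sum) simp
  finally show ?thesis by simp
qed

lemma grad_norm_le_sum: "grad_norm G z \<le> (\<Sum>i\<in>Basis. norm (G i z))"
  unfolding grad_norm_L2_set by (rule L2_set_le_sum) simp

lemma nn_integral_Icc_continuous:
  fixes w :: "real \<Rightarrow> real"
  assumes w: "continuous_on UNIV w" and nonneg: "\<And>t. 0 \<le> w t"
  shows "(\<integral>\<^sup>+t\<in>{a..b}. ennreal (w t) \<partial>lborel) = ennreal (integral {a..b} w)"
proof -
  have [measurable]: "w \<in> borel_measurable borel"
    using w by (rule borel_measurable_continuous_onI)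
  have "(w has_integral integral {a..b} w) {a..b}"
    by (intro integrable_integral integrable_continuous_interval continuous_on_subset[OF w]) simp
  then have "((\<lambda>t. if t \<in> {a..b} then w t else 0) has_integral integral {a..b} w) UNIV"
    by (simp only: has_integral_restrict_UNIV)
  then have "((\<lambda>t. w t * indicator {a..b} t) has_integral integral {a..b} w) UNIV"
    by (rule has_integral_eq[rotated]) (simp add: indicator_def)
  then have "(\<integral>\<^sup>+t. ennreal (w t * indicator {a..b} t) \<partial>lborel) = ennreal (integral {a..b} w)"
    by (intro nn_integral_has_integral_lborel) (auto simp: nonneg)
  then show ?thesis by (simp add: ennreal_mult ennreal_indicator nonneg)
qed

text \<open>With q the map along the segment and U the regularised distance, the derivative is (q -
  p) . q' / U^2. Cauchy-Schwarz and |q - p| <= U leave |q'| / U, and the endpoints are at most 2S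
  apart. This serves the mollified maps, for which the fundamental theorem of calculus holds along
  every segment.\<close>

lemma log_potential_segment_le:
  fixes f :: "'a::euclidean_space \<Rightarrow> 'b::euclidean_space"
  assumes h: "h > 0" and s: "0 < s" "s \<le> S"
    and der: "\<And>z. z \<in> ball x S \<Longrightarrow> (f has_derivative (\<lambda>d. \<Sum>i\<in>Basis. (d \<bullet> i) *\<^sub>R G i z)) (at z)"
    and f: "continuous_on UNIV f" and G: "\<And>i. i \<in> Basis \<Longrightarrow> continuous_on UNIV (G i)"
    and y: "y \<in> ball x S" "y' \<in> ball x s"
  shows "ennreal \<bar>log_potential h p (f y) - log_potential h p (f y')\<bar> \<le>
    ennreal (2 * S) * (\<integral>\<^sup>+t\<in>{0..1}. ennreal (grad_norm G ((1 - t) *\<^sub>R y' + t *\<^sub>R y) / reg_dist h p (f ((1 - t) *\<^sub>R y' + t *\<^sub>R y))) \<partial>lborel)"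
proof -
  define z where "z t = (1 - t) *\<^sub>R y' + t *\<^sub>R y" for t :: real
  have z_ball: "z t \<in> ball x S" if "t \<in> {0..1}" for t
    using that y s convexD_alt[OF convex_ball, of y' x S y t] by (auto simp: z_def)
  have zc: "continuous_on T z" for T
    unfolding z_def[abs_def] by (intro continuous_intros)
  define w where "w t = 2 * S * (grad_norm G (z t) / reg_dist h p (f (z t)))" for t
  have gc: "continuous_on UNIV (grad_norm G)"
    unfolding grad_norm_def[abs_def] by (intro continuous_intros G)
  have fz: "continuous_on UNIV (\<lambda>t. f (z t))"
    by (rule continuous_on_compose2[OF f zc]) auto
  have "continuous_on UNIV (\<lambda>t. reg_dist h p (f (z t)))"
    by (rule continuous_on_compose2[OF continuous_on_reg_dist fz]) auto
  moreover have "continuous_on UNIV (\<lambda>t. grad_norm G (z t))"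
    by (rule continuous_on_compose2[OF gc zc]) auto
  ultimately have w: "continuous_on UNIV w"
    unfolding w_def[abs_def] using reg_dist_pos[OF h, of p]
    by (intro continuous_intros) (auto simp: less_imp_neq[symmetric])
  have w0: "w t \<ge> 0" for t
    using s reg_dist_pos[OF h, of p "f (z t)"] grad_norm_nonneg[of G "z t"] by (simp add: w_def)
  define D where "D t = (\<Sum>i\<in>Basis. ((y - y') \<bullet> i) *\<^sub>R G i (z t))" for t
  define q' where "q' t = ((f (z t) - p) \<bullet> D t) / (reg_dist h p (f (z t)))\<^sup>2" for t
  have der_q: "((\<lambda>t. log_potential h p (f (z t))) has_vector_derivative q' t) (at t within {0..1})"
    if t: "t \<in> {0..1}" for t
  proof -
    have "(z has_derivative (\<lambda>u. u *\<^sub>R (y - y'))) (at t within {0..1})"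
      unfolding z_def[abs_def] by (auto intro!: derivative_eq_intros simp: algebra_simps)
    from has_derivative_compose[OF this der[OF z_ball[OF t]]]
    have "((\<lambda>t. f (z t)) has_derivative (\<lambda>u. u *\<^sub>R D t)) (at t within {0..1})"
      by (simp add: D_def scaleR_sum_right)
    from log_potential_has_derivative[OF h this, of p]
    show ?thesis
      by (simp add: has_vector_derivative_def q'_def)
  qed
  have q'_le: "norm (q' t) \<le> w t" if t: "t \<in> {0..1}" for t
  proof -
    have U: "reg_dist h p (f (z t)) > 0" (is "?U > 0") using reg_dist_pos[OF h] .
    have "norm (y - y') \<le> dist x y + dist x y'"
      by (metis dist_commute dist_norm dist_triangle)
    also have "\<dots> \<le> 2 * S" using y s by auto
    finally have d: "norm (y - y') \<le> 2 * S" .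
    have "norm (q' t) \<le> (norm (f (z t) - p) * norm (D t)) / ?U\<^sup>2"
      unfolding q'_def using U by (simp add: divide_right_mono Cauchy_Schwarz_ineq2)
    also have "\<dots> \<le> (?U * (norm (y - y') * grad_norm G (z t))) / ?U\<^sup>2"
      unfolding D_def using U
      by (intro divide_right_mono mult_mono reg_dist_ge_norm norm_gradient_apply_le) auto
    also have "\<dots> = norm (y - y') * (grad_norm G (z t) / ?U)"
      using U by (simp add: power2_eq_square)
    also have "\<dots> \<le> w t"
      unfolding w_def using d U grad_norm_nonneg[of G "z t"] by (intro mult_right_mono) auto
    finally show ?thesis .
  qed
  have "(q' has_integral (log_potential h p (f (z 1)) - log_potential h p (f (z 0)))) {0..1}"
    by (intro fundamental_theorem_of_calculus der_q) auto
  then have "norm (log_potential h p (f (z 1)) - log_potential h p (f (z 0))) \<le> integral {0..1} w"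
    using integral_norm_bound_integral[of q' "{0..1}" w] q'_le
      integrable_continuous_interval[OF continuous_on_subset[OF w]]
    by (auto simp: has_integral_iff)
  then have "ennreal \<bar>log_potential h p (f y) - log_potential h p (f y')\<bar> \<le> (\<integral>\<^sup>+t\<in>{0..1}. ennreal (w t) \<partial>lborel)"
    by (simp add: nn_integral_Icc_continuous[OF w w0] z_def ennreal_leI)
  also have "\<dots> = (\<integral>\<^sup>+t. ennreal (2 * S) * (ennreal (grad_norm G (z t) / reg_dist h p (f (z t))) * indicator {0..1} t) \<partial>lborel)"
  proof -
    have "ennreal (w t) = ennreal (2 * S) * ennreal (grad_norm G (z t) / reg_dist h p (f (z t)))" for t
      unfolding w_def using s by (intro ennreal_mult') simp
    then show ?thesis by (simp only: mult.assoc)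
  qed
  also have "\<dots> = ennreal (2 * S) * (\<integral>\<^sup>+t\<in>{0..1}. ennreal (grad_norm G (z t) / reg_dist h p (f (z t))) \<partial>lborel)"
  proof (rule nn_integral_cmult)
    have "continuous_on UNIV (\<lambda>t. w t / (2 * S))" using s w by (intro continuous_intros) auto
    then have [measurable]: "(\<lambda>t. grad_norm G (z t) / reg_dist h p (f (z t))) \<in> borel_measurable borel"
      using s by (auto simp: w_def dest!: borel_measurable_continuous_onI)
    show "(\<lambda>t. ennreal (grad_norm G (z t) / reg_dist h p (f (z t))) * indicator {0..1} t) \<in> borel_measurable lborel"
      by measurable
  qed
  finally show ?thesis by (simp add: z_def)
qed


text \<open>Mollify, apply the inequality for smooth maps and pass to the limit: Fatou on the left,
  in each of the two integrals, dominated convergence on the right. As \<open>reg_dist\<close> is at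
  least h and the kernel at most s^(1-n), with h and s fixed during the limit, the right-hand
  integrands are dominated by a multiple of the integrable gradient.\<close>

lemma reg_dist_double_integral:
  fixes F :: "'a::euclidean_space \<Rightarrow> 'b::euclidean_space" and G :: "'a \<Rightarrow> 'a \<Rightarrow> 'b"
  assumes n: "DIM('a) \<ge> 2" and h: "h > 0" and s: "0 < s" "s \<le> S" "S < S'"
    and F: "integrable lborel F" "\<And>y. F y \<noteq> 0 \<Longrightarrow> norm y \<le> M"
    and G: "\<And>i. i \<in> Basis \<Longrightarrow> integrable lborel (G i)" "\<And>i y. i \<in> Basis \<Longrightarrow> G i y \<noteq> 0 \<Longrightarrow> norm y \<le> M"
    and weak: "\<And>i e z. i \<in> Basis \<Longrightarrow> e > 0 \<Longrightarrow> cball z e \<subseteq> cball x S' \<Longrightarrow>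
      (\<integral>y. (bump_grad (bump e) (z - y) \<bullet> i) *\<^sub>R F y \<partial>lborel) = (\<integral>y. bump e (z - y) *\<^sub>R G i y \<partial>lborel)"
  shows "(\<integral>\<^sup>+y\<in>ball x S. (\<integral>\<^sup>+y'\<in>ball x s. ennreal \<bar>log_potential h p (F y) - log_potential h p (F y')\<bar> \<partial>lborel) \<partial>lborel)
    \<le> ennreal (unit_ball_vol (real DIM('a)) * s ^ DIM('a) * S ^ DIM('a) * 2 ^ (DIM('a) + 2)) *
       (\<integral>\<^sup>+z\<in>ball x S. ennreal (grad_norm G z / reg_dist h p (F z)) * ennreal (1 / max (dist x z) s ^ (DIM('a) - 1)) \<partial>lborel)"
proof -
  let ?I = "\<lambda>v y. \<integral>\<^sup>+y'\<in>ball x s. ennreal \<bar>v y - v y'\<bar> \<partial>lborel"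
  let ?B = "ball x S" and ?h = "ennreal (1 / h)" and ?s = "ennreal (1 / s ^ (DIM('a) - 1))"
  have [measurable]: "F \<in> borel_measurable borel" using F by auto
  have Gm [measurable]: "i \<in> Basis \<Longrightarrow> G i \<in> borel_measurable borel" for i using G(1)[of i] by auto
  have [measurable]: "reg_dist h p \<in> borel_measurable borel" "log_potential h p \<in> borel_measurable borel"
    using h by (auto intro!: borel_measurable_continuous_onI continuous_on_reg_dist continuous_on_log_potential)
  have gm [measurable]: "grad_norm H \<in> borel_measurable borel"
    if "\<And>i. i \<in> Basis \<Longrightarrow> H i \<in> borel_measurable borel" for H :: "'a \<Rightarrow> 'a \<Rightarrow> 'b"
    unfolding grad_norm_def[abs_def] using that by measurable
  define mF where "mF k = mollify (1 / real (Suc k)) F" for k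
  define mG where "mG k i = mollify (1 / real (Suc k)) (G i)" for k i
  have mF_cont: "continuous_on UNIV (mF k)" for k
    unfolding mF_def by (rule mollify_continuous[OF F])
  have mG_cont: "i \<in> Basis \<Longrightarrow> continuous_on UNIV (mG k i)" for k i
    unfolding mG_def by (rule mollify_continuous[OF G])
  have [measurable]: "mF k \<in> borel_measurable borel" for k
    by (rule borel_measurable_continuous_onI[OF mF_cont])
  have mGm [measurable]: "i \<in> Basis \<Longrightarrow> mG k i \<in> borel_measurable borel" for k i
    by (rule borel_measurable_continuous_onI[OF mG_cont])
  \<comment> \<open>Convergence in L1 gives convergence almost everywhere only along a
    subsequence.\<close>
  obtain r where r: "strict_mono r"
    and ae: "AE z in lborel. (\<lambda>k. indicator (?B) z *\<^sub>R (mF (r k) z - F z)) \<longlonglongrightarrow> 0"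
  proof -
    let ?u = "\<lambda>k z. indicator (?B) z *\<^sub>R (mF k z - F z)"
    have int: "integrable lborel (?u k)" for k
    proof -
      have "integrable lborel (\<lambda>z. indicator (cball x S) z *\<^sub>R mF k z)"
        using borel_integrable_compact[OF compact_cball continuous_on_subset[OF mF_cont]] by blast
      then have "integrable lborel (\<lambda>z. indicator (?B) z *\<^sub>R (indicator (cball x S) z *\<^sub>R mF k z) - indicator (?B) z *\<^sub>R F z)"
        using F(1) by (intro Bochner_Integration.integrable_diff integrable_mult_indicator[of "?B"]) auto
      moreover have "(\<lambda>z. indicator (?B) z *\<^sub>R (indicator (cball x S) z *\<^sub>R mF k z) - indicator (?B) z *\<^sub>R F z) = ?u k"
        by (auto simp: indicator_def fun_eq_iff)
      ultimately show ?thesis by simp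
    qed
    have "(\<lambda>k. ennreal (\<integral>z. norm (?u k z) \<partial>lborel)) \<longlonglongrightarrow> ennreal 0"
    proof -
      have "ennreal (\<integral>z. norm (?u k z) \<partial>lborel) = (\<integral>\<^sup>+z\<in>?B. ennreal (norm (mF k z - F z)) \<partial>lborel)" for k
        by (subst nn_integral_eq_integral[OF integrable_norm[OF int[of k]], symmetric])
          (auto intro!: nn_integral_cong simp: indicator_def)
      then show ?thesis
        using mollify_L1[OF F s(3), of x] by (simp add: mF_def)
    qed
    then have "(\<lambda>k. \<integral>z. norm (?u k z) \<partial>lborel) \<longlonglongrightarrow> 0"
      by (subst (asm) tendsto_ennreal_iff) auto
    from tendsto_L1_AE_subseq[OF int this] show thesis using that by blast
  qed
  obtain K0 where K0: "1 / real (Suc K0) < S' - S"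
    using nat_approx_posE[of "S' - S"] s by auto
  \<comment> \<open>After the shift by \<open>K0\<close> every mollification radius is below S' - S,
    so the identity \<open>weak\<close> is available for each k and not merely eventually.\<close>
  define \<rho> where "\<rho> k = r (k + K0)" for k
  have \<rho>: "filterlim \<rho> at_top sequentially"
    unfolding \<rho>_def[abs_def]
    by (rule filterlim_compose[OF filterlim_subseq[OF r] filterlim_add_const_nat_at_top])
  have \<rho>_small: "1 / real (Suc (\<rho> k)) < S' - S" for k
  proof -
    have "K0 \<le> \<rho> k" using seq_suble[OF r, of "k + K0"] by (simp add: \<rho>_def)
    then have "1 / real (Suc (\<rho> k)) \<le> 1 / real (Suc K0)" by (intro divide_left_mono) auto
    then show ?thesis using K0 by simp
  qed
  define v where "v z = log_potential h p (F z)" for z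
  define vk where "vk k z = log_potential h p (mF (\<rho> k) z)" for k z
  have [measurable]: "v \<in> borel_measurable borel" "vk k \<in> borel_measurable borel" for k
    by (simp_all add: v_def[abs_def] vk_def[abs_def])
  have conv: "AE z in lborel. z \<in> ?B \<longrightarrow> (\<lambda>k. mF (\<rho> k) z) \<longlonglongrightarrow> F z"
    using ae
  proof eventually_elim
    case (elim z)
    show ?case
    proof
      assume "z \<in> ?B"
      then have "(\<lambda>k. mF (r k) z - F z) \<longlonglongrightarrow> 0" using elim by simp
      then have "(\<lambda>k. mF (r k) z) \<longlonglongrightarrow> F z" by (rule LIM_zero_cancel)
      from LIMSEQ_ignore_initial_segment[OF this, of K0] show "(\<lambda>k. mF (\<rho> k) z) \<longlonglongrightarrow> F z"
        by (simp add: \<rho>_def)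
    qed
  qed
  have vconv: "AE z in lborel. z \<in> ?B \<longrightarrow> (\<lambda>k. vk k z) \<longlonglongrightarrow> v z"
    using conv
  proof eventually_elim
    case (elim z)
    have "isCont (log_potential h p) (F z)"
      by (rule continuous_on_interior[OF continuous_on_log_potential[OF h, of UNIV]]) auto
    from isCont_tendsto_compose[OF this] elim show ?case unfolding v_def vk_def by blast
  qed
  have Uconv: "AE z in lborel. z \<in> ?B \<longrightarrow> (\<lambda>k. reg_dist h p (mF (\<rho> k) z)) \<longlonglongrightarrow> reg_dist h p (F z)"
    using conv
  proof eventually_elim
    case (elim z)
    have "isCont (reg_dist h p) (F z)"
      by (rule continuous_on_interior[OF continuous_on_reg_dist[of UNIV]]) auto
    from isCont_tendsto_compose[OF this] elim show ?case by blast
  qed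
  define \<kappa> where "\<kappa> z = ennreal (1 / max (dist x z) s ^ (DIM('a) - 1))" for z
  have [measurable]: "\<kappa> \<in> borel_measurable borel" unfolding \<kappa>_def[abs_def] by measurable
  have \<kappa>_le: "\<kappa> z \<le> ?s" for z
    unfolding \<kappa>_def using s
    by (intro ennreal_leI divide_left_mono power_mono mult_pos_pos zero_less_power) (auto simp: less_max_iff_disj)
  define C where "C = ennreal (unit_ball_vol (real DIM('a)) * s ^ DIM('a) * S ^ DIM('a) * 2 ^ (DIM('a) + 2))"
  let ?d = "\<lambda>k z. \<Sum>i\<in>Basis. ennreal (norm (mG (\<rho> k) i z - G i z))"
  let ?g = "\<lambda>z. \<Sum>i\<in>Basis. ennreal (norm (G i z))"
  let ?W = "\<lambda>k z. ennreal (grad_norm G z / reg_dist h p (mF (\<rho> k) z)) * \<kappa> z"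
  let ?Y = "\<lambda>z. ennreal (grad_norm G z / reg_dist h p (F z)) * \<kappa> z"
  \<comment> \<open>The mollified gradients have no common pointwise bound, so they are split:
    \<open>A\<close> keeps the original gradient and mollifies only the values of \<open>F\<close>,
    while \<open>E\<close> carries the L1 error of the gradients.\<close>
  define A where "A k = (\<integral>\<^sup>+z\<in>?B. ?W k z \<partial>lborel)" for k
  define E where "E k = ?h * (?s *
      (\<Sum>i\<in>Basis. \<integral>\<^sup>+z\<in>?B. ennreal (norm (mG (\<rho> k) i z - G i z)) \<partial>lborel))" for k
  have step: "(\<integral>\<^sup>+y\<in>?B. ?I (vk k) y \<partial>lborel) \<le> C * (A k + E k)" for k
  proof -
    let ?w = "\<lambda>z. ennreal (grad_norm (mG (\<rho> k)) z / reg_dist h p (mF (\<rho> k) z))"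
    have Gk [measurable]: "grad_norm (mG (\<rho> k)) \<in> borel_measurable borel" "grad_norm G \<in> borel_measurable borel"
      by (auto intro!: gm mGm Gm)
    have der: "(mF (\<rho> k) has_derivative (\<lambda>d. \<Sum>i\<in>Basis. (d \<bullet> i) *\<^sub>R mG (\<rho> k) i z)) (at z)"
      if z: "z \<in> ?B" for z
      unfolding mF_def mG_def
    proof (rule mollify_gradient[OF F weak])
      show "cball z (1 / real (Suc (\<rho> k))) \<subseteq> cball x S'"
        using z \<rho>_small[of k] by (auto simp: subset_iff intro: order.trans[OF dist_triangle[of _ _ z]])
    qed auto
    have "(\<integral>\<^sup>+y\<in>?B. ?I (vk k) y \<partial>lborel)
       \<le> C * (\<integral>\<^sup>+z\<in>?B. ?w z * \<kappa> z \<partial>lborel)"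
      unfolding C_def \<kappa>_def
      by (rule double_integral_kernel[OF _ n s(1,2)])
        (auto simp: vk_def simp del: mem_ball intro!: log_potential_segment_le[OF h s(1,2) der mF_cont mG_cont])
    also have "(\<integral>\<^sup>+z\<in>?B. ?w z * \<kappa> z \<partial>lborel) \<le>
      (\<integral>\<^sup>+z. ?W k z * indicator (?B) z
        + ?h * (?s * (\<Sum>i\<in>Basis. ennreal (norm (mG (\<rho> k) i z - G i z)) * indicator (?B) z)) \<partial>lborel)"
    proof (rule nn_integral_mono)
      fix z
      let ?U = "reg_dist h p (mF (\<rho> k) z)" and ?e = "\<Sum>i\<in>Basis. norm (mG (\<rho> k) i z - G i z)"
      have U: "?U > 0" "h \<le> ?U" using reg_dist_pos[OF h] reg_dist_ge[OF h] by auto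
      have "grad_norm (mG (\<rho> k)) z / ?U \<le> grad_norm G z / ?U + ?e / ?U"
        using U grad_norm_le_add[of "mG (\<rho> k)" z G] by (simp add: add_divide_distrib[symmetric] divide_right_mono)
      also have "?e / ?U \<le> ?e / h"
        using U h by (intro divide_left_mono) (auto intro: sum_nonneg)
      finally have "?w z \<le> ennreal (grad_norm G z / ?U + ?e / h)" by (intro ennreal_leI) simp
      also have "\<dots> = ennreal (grad_norm G z / ?U) + ?h * ?d k z"
        using U h grad_norm_nonneg[of G z] by (simp add: ennreal_plus sum_nonneg sum_ennreal flip: ennreal_mult')
      finally have "?w z * \<kappa> z \<le> (ennreal (grad_norm G z / ?U) + ?h * ?d k z) * \<kappa> z"
        by (rule mult_right_mono) simp
      also have "\<dots> \<le> ennreal (grad_norm G z / ?U) * \<kappa> z + (?h * ?d k z) * ?s"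
        unfolding distrib_right by (intro add_left_mono mult_left_mono \<kappa>_le) simp
      finally show "?w z * \<kappa> z * indicator (?B) z \<le> ennreal (grad_norm G z / ?U) * \<kappa> z * indicator (?B) z
        + ?h * (?s * (\<Sum>i\<in>Basis. ennreal (norm (mG (\<rho> k) i z - G i z)) * indicator (?B) z))"
        by (cases "z \<in> ?B") (simp_all add: mult_ac)
    qed
    also have "\<dots> = A k + E k"
      unfolding A_def E_def
      by (subst nn_integral_add, simp, simp, subst nn_integral_cmult, simp, subst nn_integral_cmult, simp,
          subst nn_integral_sum, simp, simp)
    finally show ?thesis by (simp add: mult_left_mono)
  qed
  have "A \<longlonglongrightarrow> (\<integral>\<^sup>+z\<in>?B. ?Y z \<partial>lborel)"
    unfolding A_def
  proof (rule nn_integral_dominated_convergence[where w="\<lambda>z. ?h * (?s * ?g z)"])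
    have [measurable]: "grad_norm G \<in> borel_measurable borel" by (auto intro!: gm Gm)
    show "(\<lambda>z. ?W k z * indicator (?B) z) \<in> borel_measurable lborel" for k
      by measurable
    show "(\<lambda>z. ?Y z * indicator (?B) z) \<in> borel_measurable lborel"
      by measurable
    show "(\<lambda>z. ?h * (?s * ?g z)) \<in> borel_measurable lborel"
      by measurable
    show "AE z in lborel. ?W k z * indicator (?B) z
       \<le> ?h * (?s * ?g z)" for k
    proof (rule AE_I2)
      fix z
      let ?U = "reg_dist h p (mF (\<rho> k) z)"
      have U: "?U > 0" "h \<le> ?U" using reg_dist_pos[OF h] reg_dist_ge[OF h] by auto
      have "grad_norm G z / ?U \<le> (1 / h) * (\<Sum>i\<in>Basis. norm (G i z))"
        using U h grad_norm_le_sum[of G z] by (auto simp: intro!: frac_le grad_norm_nonneg sum_nonneg)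
      then have "ennreal (grad_norm G z / ?U) \<le> ?h * ?g z"
        using h by (simp add: sum_ennreal ennreal_leI flip: ennreal_mult')
      then have "ennreal (grad_norm G z / ?U) * \<kappa> z \<le> ?h * ?g z * ?s"
        by (intro mult_mono \<kappa>_le) auto
      then show "ennreal (grad_norm G z / ?U) * \<kappa> z * indicator (?B) z
       \<le> ?h * (?s * ?g z)"
        by (cases "z \<in> ?B") (simp_all add: mult_ac)
    qed
    have "(\<integral>\<^sup>+z. ennreal (norm (G i z)) \<partial>lborel) < top" if "i \<in> Basis" for i
      using G(1)[OF that] by (simp add: integrable_iff_bounded)
    then have "(\<Sum>i\<in>Basis. \<integral>\<^sup>+z. ennreal (norm (G i z)) \<partial>lborel) < top"
      by simp
    then show "(\<integral>\<^sup>+z. ?h * (?s * ?g z) \<partial>lborel) < \<infinity>"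
      by (simp add: nn_integral_cmult nn_integral_sum ennreal_mult_less_top del: sum_ennreal)
    show "AE z in lborel. (\<lambda>k. ?W k z * indicator (?B) z)
        \<longlonglongrightarrow> ?Y z * indicator (?B) z"
      using Uconv
    proof eventually_elim
      case (elim z)
      show ?case
      proof (cases "z \<in> ?B")
        case True
        have "(\<lambda>k. ennreal (grad_norm G z / reg_dist h p (mF (\<rho> k) z))) \<longlonglongrightarrow> ennreal (grad_norm G z / reg_dist h p (F z))"
          using elim True reg_dist_pos[OF h, of p "F z"] by (intro tendsto_ennrealI tendsto_divide tendsto_const) auto
        then have "(\<lambda>k. \<kappa> z * ennreal (grad_norm G z / reg_dist h p (mF (\<rho> k) z))) \<longlonglongrightarrow> \<kappa> z * ennreal (grad_norm G z / reg_dist h p (F z))"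
          by (rule ennreal_tendsto_cmult[rotated]) (simp add: \<kappa>_def)
        then show ?thesis using True by (simp add: mult.commute)
      qed simp
    qed
  qed
  moreover have "E \<longlonglongrightarrow> ?h * (?s * (\<Sum>i\<in>(Basis::'a set). 0))"
    unfolding E_def
  proof (intro ennreal_tendsto_cmult tendsto_sum)
    fix i :: 'a assume i: "i \<in> Basis"
    show "(\<lambda>k. \<integral>\<^sup>+z\<in>?B. ennreal (norm (mG (\<rho> k) i z - G i z)) \<partial>lborel) \<longlonglongrightarrow> 0"
      using filterlim_compose[OF mollify_L1[OF G(1)[OF i] G(2)[OF i] s(3), of x] \<rho>] by (simp add: mG_def)
  qed auto
  ultimately have "(\<lambda>k. C * (A k + E k)) \<longlonglongrightarrow> C * ((\<integral>\<^sup>+z\<in>?B. ?Y z \<partial>lborel)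
      + ?h * (?s * (\<Sum>i\<in>(Basis::'a set). 0)))"
    by (intro ennreal_tendsto_cmult tendsto_add) (auto simp: C_def)
  then have lim: "liminf (\<lambda>k. C * (A k + E k)) = C * (\<integral>\<^sup>+z\<in>?B. ?Y z \<partial>lborel)"
    by (simp add: lim_imp_Liminf)
  \<comment> \<open>First use of Fatou, in y' for almost every fixed y; the outer integral follows
    below.\<close>
  have inner: "AE y in lborel. y \<in> ?B \<longrightarrow> ?I v y
      \<le> liminf (\<lambda>k. ?I (vk k) y)"
    using vconv
  proof eventually_elim
    case (elim y)
    show ?case
    proof
      assume y: "y \<in> ?B"
      have "AE y' in lborel. ennreal \<bar>v y - v y'\<bar> * indicator (ball x s) y'
         = liminf (\<lambda>k. ennreal \<bar>vk k y - vk k y'\<bar> * indicator (ball x s) y')"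
        using vconv
      proof eventually_elim
        case (elim y')
        show ?case
        proof (cases "y' \<in> ball x s")
          case True
          then have "(\<lambda>k. vk k y') \<longlonglongrightarrow> v y'" using elim s by auto
          then have "(\<lambda>k. ennreal \<bar>vk k y - vk k y'\<bar>) \<longlonglongrightarrow> ennreal \<bar>v y - v y'\<bar>"
            using \<open>y \<in> ?B \<longrightarrow> (\<lambda>k. vk k y) \<longlonglongrightarrow> v y\<close> y by (intro tendsto_ennrealI tendsto_rabs tendsto_diff) auto
          from lim_imp_Liminf[OF _ this] show ?thesis using True by simp
        qed (simp add: Liminf_const)
      qed
      then have "?I v y
         = (\<integral>\<^sup>+y'. liminf (\<lambda>k. ennreal \<bar>vk k y - vk k y'\<bar> * indicator (ball x s) y') \<partial>lborel)"
        by (rule nn_integral_cong_AE)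
      also have "\<dots> \<le> liminf (\<lambda>k. ?I (vk k) y)"
        by (rule nn_integral_liminf) measurable
      finally show "?I v y
         \<le> liminf (\<lambda>k. ?I (vk k) y)" .
    qed
  qed
  have "(\<integral>\<^sup>+y\<in>?B. ?I v y \<partial>lborel)
     \<le> (\<integral>\<^sup>+y. liminf (\<lambda>k. ?I (vk k) y * indicator (?B) y) \<partial>lborel)"
  proof (rule nn_integral_mono_AE)
    show "AE y in lborel. ?I v y * indicator (?B) y
      \<le> liminf (\<lambda>k. ?I (vk k) y * indicator (?B) y)"
      using inner
    proof eventually_elim
      case (elim y)
      then show ?case by (cases "y \<in> ?B") simp_all
    qed
  qed
  also have "\<dots> \<le> liminf (\<lambda>k. \<integral>\<^sup>+y\<in>?B. ?I (vk k) y \<partial>lborel)"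
    by (rule nn_integral_liminf) measurable
  also have "\<dots> \<le> liminf (\<lambda>k. C * (A k + E k))"
    by (intro Liminf_mono always_eventually allI step)
  finally show ?thesis unfolding lim by (simp add: v_def C_def \<kappa>_def)
qed


section \<open>Borel representatives, and the weak gradient tested with bumps\<close>

lemma borel_representative:
  fixes f :: "'a::euclidean_space \<Rightarrow> 'b::euclidean_space"
  assumes "f \<in> borel_measurable lebesgue"
  obtains F where "F \<in> borel_measurable borel" "AE x in lborel. f x = F x"
proof -
  have "\<exists>F\<in>borel_measurable lborel. AE x in lborel. f x \<bullet> b = F x" for b
    using assms by (intro completion_ex_borel_measurable_real) auto
  then have "\<forall>b. \<exists>F. F \<in> borel_measurable borel \<and> (AE x in lborel. f x \<bullet> b = F x)"
    by auto
  then obtain F where F: "\<And>b. F b \<in> borel_measurable borel" "\<And>b. AE x in lborel. f x \<bullet> b = F b x"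
    by (auto simp: choice_iff)
  show thesis
  proof
    show "(\<lambda>x. \<Sum>b\<in>Basis. F b x *\<^sub>R b) \<in> borel_measurable borel"
      using F(1) by measurable
    have "AE x in lborel. \<forall>b\<in>Basis. f x \<bullet> b = F b x"
      by (intro AE_finite_allI F(2)) simp
    then show "AE x in lborel. f x = (\<Sum>b\<in>Basis. F b x *\<^sub>R b)"
    proof eventually_elim
      case (elim x)
      have "f x = (\<Sum>b\<in>Basis. (f x \<bullet> b) *\<^sub>R b)" by (simp add: euclidean_representation)
      then show ?case using elim by simp
    qed
  qed
qed

text \<open>Mollification and Tonelli run on Borel functions and \<open>lborel\<close>, whereas the
  weak gradient lives on the completed measure. Cutting off at a compact \<open>K\<close> also
  supplies the bounded support that mollification asks for.\<close>

lemma integrable_representative: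
  fixes f :: "'a::euclidean_space \<Rightarrow> 'b::euclidean_space"
  assumes f: "set_integrable lebesgue K f" and K: "K \<in> sets borel"
  obtains F where "integrable lborel F" "\<And>y. F y \<noteq> 0 \<Longrightarrow> y \<in> K"
    "AE y in lborel. indicator K y *\<^sub>R f y = F y"
proof -
  have "(\<lambda>y. indicator K y *\<^sub>R f y) \<in> borel_measurable lebesgue"
    using f unfolding set_integrable_def by (rule borel_measurable_integrable)
  then obtain F where F [measurable]: "F \<in> borel_measurable borel"
    and ae: "AE y in lborel. indicator K y *\<^sub>R f y = F y"
    by (rule borel_representative)
  have [measurable]: "K \<in> sets borel" by (rule K)
  have ae': "AE y in lborel. indicator K y *\<^sub>R f y = indicator K y *\<^sub>R F y"
    using ae by eventually_elim (auto simp: indicator_def)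
  have "integrable lebesgue (\<lambda>y. indicator K y *\<^sub>R F y)"
  proof (rule integrable_cong_AE_imp)
    show "integrable lebesgue (\<lambda>y. indicator K y *\<^sub>R f y)"
      using f by (simp add: set_integrable_def)
    show "(\<lambda>y. indicator K y *\<^sub>R F y) \<in> borel_measurable lebesgue"
      by (intro measurable_completion) measurable
    show "AE y in lebesgue. indicator K y *\<^sub>R f y = indicator K y *\<^sub>R F y"
      using ae' by (rule AE_completion)
  qed
  then have "integrable lborel (\<lambda>y. indicator K y *\<^sub>R F y)"
    by (subst (asm) integrable_completion) measurable
  with ae' show thesis
    by (intro that[of "\<lambda>y. indicator K y *\<^sub>R F y"]) (auto split: split_indicator_asm)
qed

text \<open>The minus sign of the reflected variable cancels the one in the definition of the weak
  gradient.\<close>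

lemma frechet_derivative_bump_translate:
  fixes y z i :: "'a::euclidean_space"
  shows "frechet_derivative (\<lambda>y. bump e (z - y)) (at y) i = - (bump_grad (bump e) (z - y) \<bullet> i)"
proof -
  have "((\<lambda>y. z - y) has_derivative (\<lambda>h. - h)) (at y)"
    by (auto intro!: derivative_eq_intros)
  from has_derivative_compose[OF this bump_grad_has_derivative[OF bump_alg]]
  have "((\<lambda>y. bump e (z - y)) has_derivative (\<lambda>h. - (bump_grad (bump e) (z - y) \<bullet> h))) (at y)"
    by simp
  from frechet_derivative_at[OF this] show ?thesis by metis
qed

text \<open>The inequality is strict because an open set is needed on which the bump vanishes. The
  sphere |w| = e is harmless later, since \<open>K\<close> there contains the closed ball.\<close>

lemma bump_grad_eq_0:
  fixes w :: "'a::euclidean_space"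
  assumes e: "e > 0" and w: "norm w > e"
  shows "bump_grad (bump e) w = 0"
proof -
  have "open {v::'a. norm v > e}"
    by (intro open_Collect_less continuous_intros)
  from has_derivative_transform_within_open[OF has_derivative_const this, where x = w and g = "bump e"]
  have "(bump e has_derivative (\<lambda>h. 0)) (at w)"
    using w by (simp add: bump_eq_0[OF e])
  from frechet_derivative_at[OF this, symmetric] show ?thesis
    by (simp add: bump_grad_def)
qed

lemma weak_gradient_bump:
  fixes f :: "'a::euclidean_space \<Rightarrow> 'b::euclidean_space"
  assumes sob: "weak_gradient_W11loc f \<Omega> g" and K: "K \<subseteq> \<Omega>"
    and i: "i \<in> Basis" and e: "e > 0" "cball z e \<subseteq> K"
    and F: "F \<in> borel_measurable borel" "AE y in lborel. indicator K y *\<^sub>R f y = F y"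
    and G: "G \<in> borel_measurable borel" "AE y in lborel. indicator K y *\<^sub>R g i y = G y"
  shows "(\<integral>y. (bump_grad (bump e) (z - y) \<bullet> i) *\<^sub>R F y \<partial>lborel) = (\<integral>y. bump e (z - y) *\<^sub>R G y \<partial>lborel)"
proof -
  let ?b = "\<lambda>y. bump_grad (bump e) (z - y) \<bullet> i" and ?e = "\<lambda>y. bump e (z - y)"
  have [measurable]: "F \<in> borel_measurable borel" "G \<in> borel_measurable borel" by fact+
  have [measurable]: "bump_grad (bump e) \<in> borel_measurable (borel :: 'a measure)"
    by (intro borel_measurable_continuous_onI bump_grad_continuous bump_alg)
  have out: "y \<in> K" if "norm (z - y) \<le> e" for y
    using that e(2) by (auto simp: dist_norm)
  have z1: "?b y *\<^sub>R f y = ?b y *\<^sub>R (indicator K y *\<^sub>R f y)" for y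
    using out[of y] bump_grad_eq_0[OF e(1), of "z - y"] by (cases "norm (z - y) \<le> e") auto
  have z2: "?e y *\<^sub>R g i y = ?e y *\<^sub>R (indicator K y *\<^sub>R g i y)" for y
    using out[of y] bump_eq_0[OF e(1), of "z - y"] by (cases "norm (z - y) \<le> e") auto
  have "test_fun \<Omega> (\<lambda>y. ?e y)"
    using e K by (intro test_fun_bump) auto
  then have "(LINT y|lebesgue. iter_partial [i] (\<lambda>y. ?e y) y *\<^sub>R f y)
      = - (LINT y|lebesgue. ?e y *\<^sub>R g i y)"
    using sob i unfolding weak_gradient_W11loc_def by blast
  then have eq: "(LINT y|lebesgue. ?b y *\<^sub>R f y) = (LINT y|lebesgue. ?e y *\<^sub>R g i y)"
    by (simp add: frechet_derivative_bump_translate)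
  have "(\<integral>y. ?b y *\<^sub>R F y \<partial>lborel) = (\<integral>y. ?b y *\<^sub>R F y \<partial>lebesgue)"
    by (rule integral_completion[symmetric]) measurable
  also have "\<dots> = (LINT y|lebesgue. ?b y *\<^sub>R f y)"
  proof (rule integral_cong_AE)
    show *: "(\<lambda>y. ?b y *\<^sub>R F y) \<in> borel_measurable lebesgue"
      by (intro measurable_completion) measurable
    show ae: "AE y in lebesgue. ?b y *\<^sub>R F y = ?b y *\<^sub>R f y"
      unfolding z1 by (rule AE_completion, rule eventually_mono[OF F(2)]) simp
    show "(\<lambda>y. ?b y *\<^sub>R f y) \<in> borel_measurable lebesgue"
      using * ae by (rule borel_measurable_AE)
  qed
  also note eq
  also have "(LINT y|lebesgue. ?e y *\<^sub>R g i y) = (\<integral>y. ?e y *\<^sub>R G y \<partial>lebesgue)"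
  proof (rule integral_cong_AE)
    show *: "(\<lambda>y. ?e y *\<^sub>R G y) \<in> borel_measurable lebesgue"
      by (intro measurable_completion) measurable
    show ae: "AE y in lebesgue. ?e y *\<^sub>R g i y = ?e y *\<^sub>R G y"
      unfolding z2 by (rule AE_completion, rule eventually_mono[OF G(2)]) simp
    show "(\<lambda>y. ?e y *\<^sub>R g i y) \<in> borel_measurable lebesgue"
      by (rule borel_measurable_AE[OF *]) (use ae in \<open>auto elim: eventually_mono\<close>)
  qed
  also have "\<dots> = (\<integral>y. ?e y *\<^sub>R G y \<partial>lborel)"
    by (rule integral_completion) measurable
  finally show ?thesis .
qed

text \<open>Restrict the double integral of |v(y) - v(y')| to a half-measure set in each ball. There
  v(y) >= ln a and v(y') <= ln (h^2 + b^2) / 2, and the product of the two measures cancels the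
  factor s^n S^n. The constant is therefore independent of both radii, which lets s shrink with J
  later.\<close>

lemma sobolev_capacity:
  fixes f :: "'a::euclidean_space \<Rightarrow> 'b::euclidean_space"
  assumes n: "DIM('a) \<ge> 2" and sob: "weak_gradient_W11loc f \<Omega> g" and K: "cball x S' \<subseteq> \<Omega>"
    and s: "0 < s" "s \<le> S" "S < S'" and h: "h > 0" and a: "a > 0" and b: "b \<ge> 0"
    and half_a: "measure lebesgue (ball x S) / 2 \<le> measure lebesgue {y \<in> ball x S. a \<le> norm (f y - p)}"
    and half_b: "measure lebesgue (ball x s) / 2 \<le> measure lebesgue {y \<in> ball x s. norm (f y - p) \<le> b}"
  shows "ennreal (ln a - ln (h\<^sup>2 + b\<^sup>2) / 2) \<le> ennreal (2 ^ (DIM('a) + 4) / unit_ball_vol (real DIM('a))) *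
    (\<integral>\<^sup>+z\<in>ball x S. ennreal (grad_norm g z / reg_dist h p (f z)) * ennreal (1 / max (dist x z) s ^ (DIM('a) - 1)) \<partial>lebesgue)"
proof -
  let ?n = "DIM('a)"
  define \<omega> where "\<omega> = unit_ball_vol (real ?n)"
  have \<omega>: "\<omega> > 0" by (simp add: \<omega>_def)
  have S: "S > 0" using s by simp
  define K where "K = cball x S'"
  have KO: "K \<subseteq> \<Omega>" and Kc: "compact K" and Kb: "K \<in> sets borel"
    using assms(3) by (auto simp: K_def intro: borel_closed)
  have fint: "set_integrable lebesgue K f" and gint: "\<And>i. i \<in> Basis \<Longrightarrow> set_integrable lebesgue K (g i)"
    using sob KO Kc unfolding weak_gradient_W11loc_def locally_integrable_on_def by auto
  obtain F where F: "integrable lborel F" "\<And>y. F y \<noteq> 0 \<Longrightarrow> y \<in> K" "AE y in lborel. indicator K y *\<^sub>R f y = F y"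
    using integrable_representative[OF fint Kb] by metis
  have "\<exists>G. integrable lborel G \<and> (\<forall>y. G y \<noteq> 0 \<longrightarrow> y \<in> K) \<and> (AE y in lborel. indicator K y *\<^sub>R g i y = G y)"
    if "i \<in> Basis" for i
    using integrable_representative[OF gint[OF that] Kb] by metis
  then obtain G where G: "\<And>i. i \<in> Basis \<Longrightarrow> integrable lborel (G i)" "\<And>i y. i \<in> Basis \<Longrightarrow> G i y \<noteq> 0 \<Longrightarrow> y \<in> K"
    "\<And>i. i \<in> Basis \<Longrightarrow> AE y in lborel. indicator K y *\<^sub>R g i y = G i y"
    by metis
  have [measurable]: "F \<in> borel_measurable borel" using F by auto
  have M: "norm y \<le> norm x + S'" if "y \<in> K" for y
    using that norm_triangle_ineq2[of y x] by (auto simp: K_def dist_norm norm_minus_commute)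
  define v where "v y = log_potential h p (F y)" for y
  let ?t = "ennreal (\<omega> * s ^ ?n / 2) * ennreal (\<omega> * S ^ ?n / 2)" and ?u = "ennreal (\<omega> * s ^ ?n * S ^ ?n * 2 ^ (?n + 2))"
  let ?Y = "\<lambda>y. \<integral>\<^sup>+y'\<in>ball x s. ennreal \<bar>v y - v y'\<bar> \<partial>lborel"
  let ?X = "\<integral>\<^sup>+y\<in>ball x S. ?Y y \<partial>lborel"
  let ?\<kappa> = "\<lambda>z. ennreal (1 / max (dist x z) s ^ (?n - 1))"
  define I where "I = (\<integral>\<^sup>+z\<in>ball x S. ennreal (grad_norm G z / reg_dist h p (F z)) * ?\<kappa> z \<partial>lborel)"
  have main: "?X
      \<le> ?u * I"
    unfolding v_def I_def \<omega>_def
  proof (rule reg_dist_double_integral[OF n h s F(1) _ G(1), where M = "norm x + S'"])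
    fix i z :: 'a and e :: real assume *: "i \<in> Basis" "e > 0" "cball z e \<subseteq> cball x S'"
    then show "(\<integral>y. (bump_grad (bump e) (z - y) \<bullet> i) *\<^sub>R F y \<partial>lborel) = (\<integral>y. bump e (z - y) *\<^sub>R G i y \<partial>lborel)"
      using G(1)[of i] G(3)[of i] F
      by (intro weak_gradient_bump[OF sob KO, of i e z F "G i"]) (auto simp: K_def)
  qed (use F G M in auto)
  have I_eq: "I = (\<integral>\<^sup>+z\<in>ball x S. ennreal (grad_norm g z / reg_dist h p (f z)) * ?\<kappa> z \<partial>lebesgue)"
    unfolding I_def nn_integral_completion
  proof (rule nn_integral_cong_AE)
    have "AE z in lborel. \<forall>i\<in>Basis. indicator K z *\<^sub>R g i z = G i z"
      by (intro AE_finite_allI G(3)) simp_all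
    with F(3) show "AE z in lborel. ennreal (grad_norm G z / reg_dist h p (F z)) * ?\<kappa> z * indicator (ball x S) z
        = ennreal (grad_norm g z / reg_dist h p (f z)) * ?\<kappa> z * indicator (ball x S) z"
    proof eventually_elim
      case (elim z)
      show ?case
      proof (cases "z \<in> ball x S")
        case True
        then have "z \<in> K" using s by (auto simp: K_def)
        then have "F z = f z" "\<And>i. i \<in> Basis \<Longrightarrow> G i z = g i z" using elim by auto
        then show ?thesis by (simp add: grad_norm_def)
      qed simp
    qed
  qed
  \<comment> \<open>Transfers a half-measure hypothesis from \<open>f\<close> to its Borel
    representative; inside \<open>K\<close> the two agree almost everywhere.\<close>
  have half: "ennreal (\<omega> * r ^ ?n / 2) \<le> emeasure lborel {y \<in> ball x r. P (F y)}"
    if le: "measure lebesgue (ball x r) / 2 \<le> measure lebesgue {y \<in> ball x r. P (f y)}"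
      and r: "0 < r" "r \<le> S" and P: "{v. P v} \<in> sets borel" for r P
  proof -
    have PF: "{y \<in> ball x r. P (F y)} \<in> sets borel"
    proof -
      have "ball x r \<inter> F -` {v. P v} \<in> sets borel"
        using measurable_sets[OF \<open>F \<in> borel_measurable borel\<close> P] by (intro sets.Int) auto
      then show ?thesis by (simp add: Int_def vimage_def)
    qed
    have "{y \<in> ball x r. P (indicator K y *\<^sub>R f y)} \<in> sets lebesgue"
    proof -
      have "(\<lambda>y. indicator K y *\<^sub>R f y) \<in> borel_measurable lebesgue"
        using fint unfolding set_integrable_def by (rule borel_measurable_integrable)
      from measurable_sets[OF this P]
      have "{y. P (indicator K y *\<^sub>R f y)} \<in> sets lebesgue" by (simp add: vimage_def)
      then have "ball x r \<inter> {y. P (indicator K y *\<^sub>R f y)} \<in> sets lebesgue" by (intro sets.Int) auto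
      then show ?thesis by (simp add: Int_def)
    qed
    moreover have "{y \<in> ball x r. P (indicator K y *\<^sub>R f y)} = {y \<in> ball x r. P (f y)}"
      using r s by (auto simp: K_def)
    ultimately have Pf: "{y \<in> ball x r. P (f y)} \<in> sets lebesgue" by simp
    have "emeasure lebesgue {y \<in> ball x r. P (f y)} = emeasure lebesgue {y \<in> ball x r. P (F y)}"
    proof (rule emeasure_eq_AE[OF _ Pf])
      show "AE y in lebesgue. (y \<in> {y \<in> ball x r. P (f y)}) = (y \<in> {y \<in> ball x r. P (F y)})"
      proof (intro AE_completion)
        show "AE y in lborel. (y \<in> {y \<in> ball x r. P (f y)}) = (y \<in> {y \<in> ball x r. P (F y)})"
          using F(3)
        proof eventually_elim
          case (elim y)
          then show ?case using r s by (cases "y \<in> ball x r") (auto simp: K_def)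
        qed
      qed
    qed (use PF in auto)
    then have eq: "measure lebesgue {y \<in> ball x r. P (f y)} = measure lborel {y \<in> ball x r. P (F y)}"
      using PF by (simp add: measure_def)
    have "emeasure lborel {y \<in> ball x r. P (F y)} \<noteq> \<infinity>"
    proof -
      have "emeasure lborel {y \<in> ball x r. P (F y)} \<le> emeasure lborel (ball x r)"
        by (intro emeasure_mono) auto
      also have "\<dots> < \<infinity>" using emeasure_lborel_ball_finite by simp
      finally show ?thesis by simp
    qed
    then have "emeasure lborel {y \<in> ball x r. P (F y)} = ennreal (measure lborel {y \<in> ball x r. P (F y)})"
      by (simp add: emeasure_eq_ennreal_measure)
    moreover have "measure lebesgue (ball x r) = \<omega> * r ^ ?n"
      using r by (simp add: \<omega>_def content_ball)
    ultimately show ?thesis using le eq by (simp add: ennreal_leI)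
  qed
  define A where "A = {y \<in> ball x S. a \<le> norm (F y - p)}"
  define B where "B = {y \<in> ball x s. norm (F y - p) \<le> b}"
  have [measurable]: "A \<in> sets borel" "B \<in> sets borel" by (simp_all add: A_def B_def)
  have Am: "ennreal (\<omega> * S ^ ?n / 2) \<le> emeasure lborel A"
    unfolding A_def using S half_a by (intro half) measurable
  have Bm: "ennreal (\<omega> * s ^ ?n / 2) \<le> emeasure lborel B"
    unfolding B_def using s half_b by (intro half) measurable
  define c where "c = ln a - ln (h\<^sup>2 + b\<^sup>2) / 2"
  show ?thesis
  proof (cases "c > 0")
    case False
    then show ?thesis by (simp add: c_def ennreal_neg)
  next
    case True
    have vA: "ln a \<le> v y" if "y \<in> A" for y
    proof -
      have "a\<^sup>2 \<le> (norm (F y - p))\<^sup>2" using that a by (intro power_mono) (auto simp: A_def)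
      then have "ln (a\<^sup>2) \<le> ln (h\<^sup>2 + (norm (F y - p))\<^sup>2)"
        using a by (intro ln_mono) (auto intro: add_increasing)
      then show ?thesis using a by (simp add: v_def log_potential_def ln_realpow)
    qed
    have vB: "v y \<le> ln (h\<^sup>2 + b\<^sup>2) / 2" if "y \<in> B" for y
      using that h b by (auto simp: v_def log_potential_def B_def intro!: divide_right_mono ln_mono add_pos_nonneg power_mono)
    have "ennreal c * (?t)
        \<le> ennreal c * (emeasure lborel B * emeasure lborel A)"
      by (intro mult_left_mono mult_mono Am Bm) auto
    also have "\<dots> = (\<integral>\<^sup>+y. (\<integral>\<^sup>+y'. ennreal c * indicator B y' \<partial>lborel) * indicator A y \<partial>lborel)"
      by (simp add: nn_integral_cmult_indicator mult.assoc nn_integral_cmult)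
    also have "\<dots> \<le> ?X"
    proof (rule nn_integral_mono)
      fix y
      show "(\<integral>\<^sup>+y'. ennreal c * indicator B y' \<partial>lborel) * indicator A y
        \<le> ?Y y * indicator (ball x S) y"
      proof (cases "y \<in> A")
        case y: True
        have "ennreal c * indicator B y' \<le> ennreal \<bar>v y - v y'\<bar> * indicator (ball x s) y'" for y'
        proof (cases "y' \<in> B")
          case True
          then have "c \<le> \<bar>v y - v y'\<bar>" using vA[OF y] vB[OF True] by (simp add: c_def)
          then show ?thesis using True by (simp add: B_def ennreal_leI)
        qed simp
        then have "(\<integral>\<^sup>+y'. ennreal c * indicator B y' \<partial>lborel) \<le> ?Y y"
          by (rule nn_integral_mono)
        then show ?thesis using y by (simp add: A_def)
      qed simp
    qed
    also note main
    finally have le: "ennreal c * (?t)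
       \<le> ?u * I" .
    \<comment> \<open>The reciprocal of the product of the two half-volumes.\<close>
    define q where "q = 4 / (\<omega> * \<omega> * s ^ ?n * S ^ ?n)"
    have q: "q \<ge> 0" using \<omega> s S by (simp add: q_def)
    have "ennreal q * (ennreal c * (?t))
       \<le> ennreal q * (?u * I)"
      by (rule mult_left_mono[OF le]) simp
    also have "ennreal q * (ennreal c * (?t)) = ennreal c"
      using True \<omega> s S by (simp add: ennreal_mult[symmetric] q_def)
    also have "ennreal q * (?u * I)
        = ennreal (2 ^ (?n + 4) / \<omega>) * I"
    proof -
      have "q * (\<omega> * s ^ ?n * S ^ ?n * 2 ^ (?n + 2)) = 2 ^ (?n + 4) / \<omega>"
        using \<omega> s S by (simp add: q_def power_add)
      then show ?thesis
        using q \<omega> s S by (simp add: mult.assoc[symmetric] ennreal_mult[symmetric])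
    qed
    finally show ?thesis unfolding I_eq c_def \<omega>_def .
  qed
qed

section \<open>Scales and the Orlicz energy\<close>

definition modulus_bound :: "real \<Rightarrow> real \<Rightarrow> real \<Rightarrow> real" where
  "modulus_bound \<alpha> \<mu> r = (if \<alpha> > 0 then exp (- \<mu> * (ln (1 / r)) powr \<alpha>) else (ln (1 / r)) powr (- \<mu>))"

text \<open>Telescoping with \<alpha> m^(\<alpha>-1) <= m^\<alpha> - (m-1)^\<alpha>. This is
  m^\<alpha> times the inequality (1 - 1/m)^\<alpha> <= 1 - \<alpha>/m, an instance of weighted
  AM-GM for the numbers 1 - 1/m and 1.\<close>

lemma sum_powr_le:
  fixes \<alpha> :: real
  assumes a: "0 < \<alpha>" "\<alpha> \<le> 1"
  shows "(\<Sum>k=1..K. real k powr (\<alpha> - 1)) \<le> real K powr \<alpha> / \<alpha>"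
proof (induction K)
  case (Suc K)
  have "real (Suc K) powr (\<alpha> - 1) \<le> (real (Suc K) powr \<alpha> - real K powr \<alpha>) / \<alpha>"
  proof (cases "K = 0")
    case True
    then show ?thesis using a by simp
  next
    case False
    define m where "m = real (Suc K)"
    have m: "m > 0" "real K = m - 1" "m > 1" using False by (auto simp: m_def)
    have "(1 - 1/m) powr \<alpha> * 1 powr (1 - \<alpha>) \<le> \<alpha> * (1 - 1/m) + (1 - \<alpha>) * 1"
      using a m by (intro Youngs_inequality_0) auto
    then have "m powr \<alpha> * (1 - 1/m) powr \<alpha> \<le> m powr \<alpha> * (1 - \<alpha> / m)"
      by (intro mult_left_mono) (auto simp: algebra_simps)
    moreover have "m powr \<alpha> * (1 - 1/m) powr \<alpha> = (m - 1) powr \<alpha>"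
      using m by (simp add: powr_mult[symmetric] algebra_simps)
    moreover have "m powr \<alpha> * (1 - \<alpha> / m) = m powr \<alpha> - \<alpha> * m powr (\<alpha> - 1)"
      using m by (simp add: powr_diff algebra_simps)
    ultimately have "\<alpha> * m powr (\<alpha> - 1) \<le> m powr \<alpha> - (m - 1) powr \<alpha>" by simp
    then have "\<alpha> * m powr (\<alpha> - 1) \<le> m powr \<alpha> - real K powr \<alpha>" by (simp only: m(2))
    then show ?thesis unfolding m_def[symmetric] using a by (simp add: pos_le_divide_eq mult.commute)
  qed
  then show ?case using Suc by (simp add: diff_divide_distrib)
qed simp

text \<open>The same telescoping at \<alpha> = 0, from ln (1 - 1/m) <= -1/m. The exponent is written
  0 - 1 to match the sum for general \<alpha>.\<close>

lemma sum_inverse_le: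
  assumes "K \<ge> 1"
  shows "(\<Sum>k=1..K. real k powr (0 - 1)) \<le> 1 + ln (real K)"
  using assms
proof (induction K rule: nat_induct_at_least)
  case (Suc K)
  have "ln (1 - 1 / real (Suc K)) \<le> - (1 / real (Suc K))"
    using ln_add_one_self_le_self2[of "- (1 / real (Suc K))"] Suc by simp
  moreover have "1 - 1 / real (Suc K) = real K / real (Suc K)" by (simp add: field_simps)
  moreover have "ln (real K / real (Suc K)) = ln (real K) - ln (real (Suc K))"
    using Suc by (simp add: ln_div)
  moreover have "real (Suc K) powr (0 - 1) = 1 / real (Suc K)"
    by (simp add: powr_minus_divide)
  ultimately show ?case using Suc by simp
qed simp

lemma ln_two_bounds: "1/2 \<le> ln (2::real)" "ln (2::real) \<le> 1"
  using ln2_ge_two_thirds ln_le_minus_one[of "2::real"] by auto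

text \<open>Here the shape of the modulus is used. Bringing it below 2^(-J) takes K of order
  J^(1/\<alpha>) dyadic scales if \<alpha> > 0, and exponentially many in J if \<alpha> = 0; in both
  cases the sum of k^(\<alpha>-1) over these scales stays linear in J.\<close>

lemma modulus_scale_choice:
  fixes \<alpha> \<mu> :: real
  assumes \<mu>: "\<mu> > 0" and \<alpha>: "0 \<le> \<alpha>" "\<alpha> \<le> 1"
  obtains C where "C \<ge> 0" "\<And>J. \<exists>K\<ge>1. (\<forall>r. 0 < r \<and> r \<le> (1/2) ^ K \<longrightarrow> modulus_bound \<alpha> \<mu> r \<le> (1/2) ^ J) \<and>
      (\<Sum>k=1..K. real k powr (\<alpha> - 1)) \<le> C * (real J + 1)"
proof -
  let ?Q = "\<lambda>J K. \<forall>r. 0 < r \<and> r \<le> (1/2) ^ K \<longrightarrow> modulus_bound \<alpha> \<mu> r \<le> (1/2) ^ J"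
  have L: "ln (1 / r) \<ge> real K * ln 2" if "0 < r" "r \<le> (1/2) ^ K" for r :: real and K
  proof -
    have "2 ^ K \<le> 1 / r" using that by (simp add: field_simps power_divide)
    then have "ln (2 ^ K) \<le> ln (1 / r)" by (intro ln_mono) auto
    then show ?thesis by (simp add: ln_realpow)
  qed
  have half: "(1/2::real) ^ J = exp (- (real J * ln 2))" for J
    by (simp add: exp_minus exp_of_nat_mult power_one_over inverse_eq_divide)
  show thesis
  proof (cases "\<alpha> > 0")
    case True
    have "\<exists>K\<ge>1. ?Q J K \<and>
      (\<Sum>k=1..K. real k powr (\<alpha> - 1)) \<le> ((2 / \<mu> + 4) / \<alpha>) * (real J + 1)" for J
    proof -
      \<comment> \<open>Solves \<mu> q^\<alpha> = J. For J = 0 this is 0, hence the added 1 in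
        \<open>K\<close>.\<close>
      define q where "q = (real J / \<mu>) powr (1 / \<alpha>)"
      define K where "K = nat \<lceil>q\<rceil> + 1"
      have q0: "q \<ge> 0" by (simp add: q_def)
      have qa: "q powr \<alpha> = real J / \<mu>" using True \<mu> by (simp add: q_def powr_powr)
      have Kq: "q \<le> real K" "real K \<le> q + 2" "K \<ge> 1" unfolding K_def using q0 by linarith+
      have "modulus_bound \<alpha> \<mu> r \<le> (1/2) ^ J" if r: "0 < r" "r \<le> (1/2) ^ K" for r
      proof -
        have "ln 2 * (real J / \<mu>) \<le> ln 2 powr \<alpha> * real K powr \<alpha>"
        proof (rule mult_mono)
          \<comment> \<open>As ln 2 <= 1 and \<alpha> <= 1, one has (K ln 2)^\<alpha> >= ln 2 *
            K^\<alpha>, which matches the ln 2 in 2^(-J) = exp (-J ln 2).\<close>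
          have "ln (2::real) powr 1 \<le> ln 2 powr \<alpha>"
            using \<alpha> ln_two_bounds by (intro powr_mono') auto
          then show "ln (2::real) \<le> ln 2 powr \<alpha>" using ln_two_bounds by simp
          show "real J / \<mu> \<le> real K powr \<alpha>"
            unfolding qa[symmetric] using Kq q0 \<alpha> by (intro powr_mono2) auto
        qed (use \<mu> in auto)
        also have "\<dots> = (real K * ln 2) powr \<alpha>" by (simp add: powr_mult mult.commute)
        also have "\<dots> \<le> ln (1 / r) powr \<alpha>"
          using L[OF r] \<alpha> ln_two_bounds by (intro powr_mono2) auto
        finally have "real J * ln 2 \<le> \<mu> * ln (1 / r) powr \<alpha>"
          using \<mu> by (simp add: field_simps)
        then show ?thesis using True by (simp add: modulus_bound_def half)
      qed
      moreover have "real K powr \<alpha> \<le> 2 * (real J / \<mu>) + 4"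
      proof (cases "q \<ge> 2")
        case q2: True
        have "real K powr \<alpha> \<le> (2 * q) powr \<alpha>" using Kq q2 \<alpha> by (intro powr_mono2) auto
        also have "\<dots> = 2 powr \<alpha> * (real J / \<mu>)" using q0 by (simp add: powr_mult qa)
        also have "\<dots> \<le> 2 powr 1 * (real J / \<mu>)"
          using \<alpha> \<mu> by (intro mult_right_mono powr_mono) auto
        finally show ?thesis by simp
      next
        case False
        have "real K powr \<alpha> \<le> 4 powr \<alpha>" using Kq False \<alpha> by (intro powr_mono2) auto
        also have "\<dots> \<le> 4 powr 1" using \<alpha> by (intro powr_mono) auto
        finally show ?thesis using \<mu> by (simp add: add_increasing)
      qed
      moreover have "2 * (real J / \<mu>) + 4 \<le> (2 / \<mu> + 4) * (real J + 1)"
        using \<mu> by (simp add: field_simps)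
      ultimately show ?thesis
        using Kq(3) sum_powr_le[OF True \<alpha>(2), of K]
          divide_right_mono[of "real K powr \<alpha>" "(2 / \<mu> + 4) * (real J + 1)" \<alpha>] True
        by (intro exI[of _ K]) auto
    qed
    then show thesis using that[of "(2 / \<mu> + 4) / \<alpha>"] True \<mu> by auto
  next
    case False
    then have \<alpha>0: "\<alpha> = 0" using \<alpha> by simp
    have "\<exists>K\<ge>1. ?Q J K \<and>
      (\<Sum>k=1..K. real k powr (\<alpha> - 1)) \<le> (4 + 1 / \<mu>) * (real J + 1)" for J
    proof -
      \<comment> \<open>The modulus is at most 2^(-J) once ln (1/r) >= q. The factor 2 in
        \<open>K\<close> compensates for ln 2 >= 1/2.\<close>
      define q where "q = 2 powr (real J / \<mu>)"
      define K where "K = nat \<lceil>2 * q\<rceil>"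
      have q1: "q \<ge> 1" using \<mu> by (simp add: q_def ge_one_powr_ge_zero)
      have Kq: "2 * q \<le> real K" "real K \<le> 4 * q" "K \<ge> 1" unfolding K_def using q1 by linarith+
      have "modulus_bound \<alpha> \<mu> r \<le> (1/2) ^ J" if r: "0 < r" "r \<le> (1/2) ^ K" for r
      proof -
        have "q \<le> real K * (1/2)" using Kq by simp
        also have "\<dots> \<le> real K * ln 2" using ln_two_bounds by (intro mult_left_mono) auto
        also have "\<dots> \<le> ln (1 / r)" by (rule L[OF r])
        finally have "ln (1 / r) powr (- \<mu>) \<le> q powr (- \<mu>)"
          using q1 \<mu> by (intro powr_mono2') auto
        also have "\<dots> = (1/2) ^ J"
          using \<mu> by (simp add: q_def powr_powr powr_minus_divide powr_realpow power_one_over)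
        finally show ?thesis using \<alpha>0 by (simp add: modulus_bound_def)
      qed
      moreover have "(\<Sum>k=1..K. real k powr (\<alpha> - 1)) \<le> (4 + 1 / \<mu>) * (real J + 1)"
      proof -
        have "ln (real K) \<le> ln (4 * q)" using Kq q1 by (intro ln_mono) auto
        also have "\<dots> = 2 * ln 2 + real J / \<mu> * ln 2"
          using q1 ln_realpow[of "2::real" 2] by (simp add: ln_mult q_def ln_powr)
        also have "\<dots> \<le> 2 * 1 + real J / \<mu> * 1"
          using ln_two_bounds \<mu> by (intro add_mono mult_left_mono) auto
        also have "\<dots> + 1 \<le> (4 + 1 / \<mu>) * (real J + 1)"
          using \<mu> by (simp add: field_simps)
        finally show ?thesis using sum_inverse_le[OF Kq(3)] \<alpha>0 by simp
      qed
      ultimately show ?thesis using Kq(3) by blast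
    qed
    then show thesis using that[of "4 + 1 / \<mu>"] \<mu> by auto
  qed
qed

text \<open>Above the threshold c X^(n-1) >= 1, hence X <= c X^n. It acts as Young's inequality with
  an explicit threshold, which is what gets summed over the scales.\<close>

lemma power_dichotomy:
  fixes X c :: real
  assumes n: "n \<ge> 2" and X: "X \<ge> 0" and c: "c > 0"
  shows "X \<le> c powr (- 1 / (real n - 1)) + c * X ^ n"
proof (cases "X \<le> c powr (- 1 / (real n - 1))")
  case True
  then show ?thesis using X c by (simp add: add_increasing2)
next
  case False
  let ?b = "c powr (- 1 / (real n - 1))"
  have b: "?b > 0" using c by simp
  have "?b ^ (n - 1) = ?b powr (real n - 1)"
    using b n by (simp add: powr_realpow[symmetric])
  also have "\<dots> = c powr ((- 1 / (real n - 1)) * (real n - 1))" by (rule powr_powr)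
  also have "(- 1 / (real n - 1)) * (real n - 1) = - 1" using n by simp
  also have "c powr (- 1) = 1 / c" using c by (simp add: powr_minus_divide)
  finally have "1 / c \<le> X ^ (n - 1)"
    using False b by (metis power_mono less_imp_le not_le)
  then have "1 \<le> c * X ^ (n - 1)" using c by (simp add: field_simps)
  then have "X * 1 \<le> X * (c * X ^ (n - 1))" using X by (intro mult_left_mono) auto
  also have "\<dots> = c * X ^ n" using n by (cases n) auto
  finally have "X \<le> c * X ^ n" by simp
  with b show ?thesis by linarith
qed

section \<open>The Orlicz integrand at a dyadic scale\<close>

definition orlicz :: "nat \<Rightarrow> real \<Rightarrow> real \<Rightarrow> real" where
  "orlicz n lam t = t ^ n * (ln (exp 1 + t)) powr lam"

lemma ln_exp1_add_ge: "t \<ge> 0 \<Longrightarrow> ln (exp 1 + t) \<ge> (1::real)"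
  using ln_mono[of "exp 1" "exp 1 + t"] by (simp add: add_pos_nonneg)

lemma orlicz_ge_power:
  assumes "t \<ge> 0" "lam \<ge> 0" shows "t ^ n \<le> orlicz n lam t"
  using ln_exp1_add_ge[OF assms(1)] assms mult_left_mono[of 1 "ln (exp 1 + t) powr lam" "t ^ n"]
  by (simp add: orlicz_def ge_one_powr_ge_zero)

lemma orlicz_nonneg: "t \<ge> 0 \<Longrightarrow> orlicz n lam t \<ge> 0"
  by (simp add: orlicz_def)

text \<open>The part of the estimate at scale 2^(-k) that does not involve the gradient. Below 4J it
  is the bare threshold of \<open>power_dichotomy\<close> with c = \<tau>. From 4J on, 2^(-k/4)
  accounts for small gradients, and the other term is the threshold for c = \<tau> (k/3)^\<lambda>,
  whose exponent is -\<lambda>/(n-1) = \<alpha> - 1.\<close>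

definition scale_weight :: "nat \<Rightarrow> real \<Rightarrow> real \<Rightarrow> nat \<Rightarrow> nat \<Rightarrow> real" where
  "scale_weight n \<tau> \<alpha> J k = (if k < 4 * J then \<tau> powr (- 1 / (real n - 1))
     else 2 powr (- real k / 4) + \<tau> powr (- 1 / (real n - 1)) * (real k / 3) powr (\<alpha> - 1))"

lemma scale_weight_nonneg: "scale_weight n \<tau> \<alpha> J k \<ge> 0"
  by (simp add: scale_weight_def)

text \<open>At scale $2^{-k}$ with $k \ge 4J$, either the gradient is below $2^{k/2}$ and contributes a
  summable amount, or its logarithm is comparable to $k$, so that the Orlicz energy gains the
  factor $k^\lambda$.\<close>

lemma gradient_at_scale_le:
  fixes G U r \<tau> \<alpha> lam :: real
  assumes n: "n \<ge> 2" and \<tau>: "\<tau> > 0" and \<alpha>: "0 \<le> \<alpha>" "\<alpha> \<le> 1" and lam: "lam = (1 - \<alpha>) * (real n - 1)"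
    and G: "G \<ge> 0" and J: "J \<ge> 1" and U: "U \<ge> (1/2) ^ J" and r: "0 < r" "r \<le> (1/2) ^ k"
  shows "G / U * r \<le> scale_weight n \<tau> \<alpha> J k + \<tau> * (orlicz n lam G / U ^ n * r ^ n)"
proof -
  have lam0: "lam \<ge> 0" using \<alpha> n by (simp add: lam)
  have U0: "U > 0" using U by (rule less_le_trans[rotated]) simp
  define X where "X = G / U * r"
  have X0: "X \<ge> 0" using G U0 r by (simp add: X_def)
  have Xn: "X ^ n = G ^ n / U ^ n * r ^ n" by (simp add: X_def power_mult_distrib power_divide)
  have Q0: "0 \<le> \<tau> * (orlicz n lam G / U ^ n * r ^ n)"
    using \<tau> U0 r orlicz_nonneg[OF G] by simp
  let ?\<tau>' = "\<tau> powr (- 1 / (real n - 1))"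
  show ?thesis
  proof (cases "k < 4 * J")
    case True
    have "X \<le> ?\<tau>' + \<tau> * X ^ n" by (rule power_dichotomy[OF n X0 \<tau>])
    also have "\<tau> * X ^ n \<le> \<tau> * (orlicz n lam G / U ^ n * r ^ n)"
      unfolding Xn using \<tau> U0 r orlicz_ge_power[OF G lam0]
      by (intro mult_left_mono mult_right_mono divide_right_mono) auto
    finally show ?thesis using True by (simp add: scale_weight_def X_def)
  next
    case False
    then have k: "4 * J \<le> k" "k \<ge> 4" using J by auto
    show ?thesis
    proof (cases "G < 2 powr (real k / 2)")
      case True
      have "X \<le> 2 powr (real k / 2) / (1/2) ^ J * (1/2) ^ k"
        unfolding X_def using True G U U0 r by (intro mult_mono frac_le) auto
      also have "\<dots> = 2 powr (real k / 2 + real J - real k)"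
      proof -
        have "(1/2::real) ^ i = 2 powr (- real i)" for i
          by (simp add: powr_minus_divide powr_realpow power_one_over)
        then show ?thesis by (simp only: powr_add[symmetric] powr_diff[symmetric]) (simp add: algebra_simps)
      qed
      \<comment> \<open>k/2 + J - k <= -k/4 because J <= k/4; this is the reason for splitting the
        scales at 4J.\<close>
      also have "\<dots> \<le> 2 powr (- real k / 4)"
        using k by (intro powr_mono) auto
      finally show ?thesis using False Q0 by (simp add: scale_weight_def X_def add_increasing2)
    next
      case G2: False
      \<comment> \<open>From ln 2 >= 2/3: ln (e + G) >= (k/2) ln 2 >= k/3.\<close>
      define L where "L = real k / 3"
      have L: "L > 0" using k by (simp add: L_def)
      have "L \<le> real k / 2 * ln 2" using ln2_ge_two_thirds k by (simp add: L_def)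
      also have "\<dots> = ln (2 powr (real k / 2))" by (simp add: ln_powr)
      also have "\<dots> \<le> ln (exp 1 + G)" using G2 by (intro ln_mono) (auto simp: add_increasing)
      finally have Lle: "L powr lam \<le> ln (exp 1 + G) powr lam"
        using L lam0 by (intro powr_mono2) auto
      \<comment> \<open>The dichotomy with c enlarged by L^\<lambda>: the logarithm in the Orlicz
        integrand pays for this factor, and the threshold gains L^(\<alpha>-1).\<close>
      have "X \<le> (\<tau> * L powr lam) powr (- 1 / (real n - 1)) + (\<tau> * L powr lam) * X ^ n"
        using \<tau> L by (intro power_dichotomy[OF n X0]) simp
      also have "(\<tau> * L powr lam) powr (- 1 / (real n - 1)) = ?\<tau>' * L powr (\<alpha> - 1)"
      proof -
        have "lam * (- 1 / (real n - 1)) = \<alpha> - 1" using n by (simp add: lam field_simps)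
        then show ?thesis using \<tau> L by (simp add: powr_mult powr_powr)
      qed
      also have "(\<tau> * L powr lam) * X ^ n \<le> \<tau> * (orlicz n lam G / U ^ n * r ^ n)"
      proof -
        have "L powr lam * G ^ n \<le> orlicz n lam G"
          unfolding orlicz_def using mult_left_mono[OF Lle, of "G ^ n"] G by (simp add: mult.commute)
        then have "\<tau> * ((L powr lam * G ^ n) / U ^ n * r ^ n) \<le> \<tau> * (orlicz n lam G / U ^ n * r ^ n)"
          using \<tau> U0 r by (intro mult_left_mono mult_right_mono divide_right_mono) auto
        then show ?thesis by (simp add: Xn mult_ac)
      qed
      finally have "X \<le> ?\<tau>' * L powr (\<alpha> - 1) + \<tau> * (orlicz n lam G / U ^ n * r ^ n)" by simp
      moreover have "0 \<le> 2 powr (- real k / 4)" by simp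
      ultimately have "X \<le> 2 powr (- real k / 4) + ?\<tau>' * L powr (\<alpha> - 1) + \<tau> * (orlicz n lam G / U ^ n * r ^ n)"
        by linarith
      then show ?thesis using False unfolding scale_weight_def X_def L_def by simp
    qed
  qed
qed

lemma sum_scale_weight_le:
  assumes \<alpha>: "0 \<le> \<alpha>" "\<alpha> \<le> 1" and J: "J \<ge> 1"
  shows "(\<Sum>k\<le>K. scale_weight n \<tau> \<alpha> J k) \<le> 7 + \<tau> powr (- 1 / (real n - 1)) * (4 * real J + 3 * (\<Sum>k=1..K. real k powr (\<alpha> - 1)))"
proof -
  let ?\<tau>' = "\<tau> powr (- 1 / (real n - 1))"
  \<comment> \<open>The ratio is at most 17/20 because (17/20)^4 > 1/2, so the geometric series is
    at most 20/3 < 7.\<close>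
  define \<theta> where "\<theta> = (2::real) powr (- 1 / 4)"
  have \<theta>: "0 < \<theta>" "\<theta> \<le> 17/20"
  proof -
    show "0 < \<theta>" by (simp add: \<theta>_def)
    have "\<theta> ^ 4 = \<theta> powr 4" using \<open>0 < \<theta>\<close> by simp
    also have "\<dots> = 2 powr (- 1 / 4 * 4)" unfolding \<theta>_def by (rule powr_powr)
    also have "\<dots> = 1 / 2" by (simp add: powr_minus_divide)
    finally have "\<theta> ^ 4 = 1 / 2" .
    then have "\<theta> ^ 4 \<le> (17/20) ^ 4" by (simp add: power_divide)
    then show "\<theta> \<le> 17/20" using power_le_imp_le_base[of \<theta> 3 "17/20"] by simp
  qed
  have pt: "scale_weight n \<tau> \<alpha> J k \<le> (if k < 4 * J then ?\<tau>' else 0) + \<theta> ^ k + ?\<tau>' * (if 1 \<le> k then 3 * real k powr (\<alpha> - 1) else 0)" for k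
  proof (cases "k < 4 * J")
    case True
    then show ?thesis using \<theta> by (simp add: scale_weight_def add_increasing2)
  next
    case False
    then have k: "k \<ge> 1" using J by simp
    have "(real k / 3) powr (\<alpha> - 1) = real k powr (\<alpha> - 1) * 3 powr (1 - \<alpha>)"
      by (simp add: powr_divide powr_diff)
    also have "\<dots> \<le> real k powr (\<alpha> - 1) * 3 powr 1"
      using \<alpha> by (intro mult_left_mono powr_mono) auto
    finally have "?\<tau>' * (real k / 3) powr (\<alpha> - 1) \<le> ?\<tau>' * (3 * real k powr (\<alpha> - 1))"
      by (intro mult_left_mono) auto
    moreover have "2 powr (- real k / 4) = \<theta> ^ k"
      by (simp add: \<theta>_def powr_power)
    ultimately show ?thesis using False k by (simp add: scale_weight_def)
  qed
  have "(\<Sum>k\<le>K. scale_weight n \<tau> \<alpha> J k) \<le> (\<Sum>k\<le>K. (if k < 4 * J then ?\<tau>' else 0) + \<theta> ^ k + ?\<tau>' * (if 1 \<le> k then 3 * real k powr (\<alpha> - 1) else 0))"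
    by (intro sum_mono pt)
  also have "\<dots> = (\<Sum>k\<le>K. if k < 4 * J then ?\<tau>' else 0) + (\<Sum>k\<le>K. \<theta> ^ k) + ?\<tau>' * (\<Sum>k\<le>K. if 1 \<le> k then 3 * real k powr (\<alpha> - 1) else 0)"
    by (simp only: sum.distrib sum_distrib_left)
  also have "(\<Sum>k\<le>K. if k < 4 * J then ?\<tau>' else 0) \<le> 4 * real J * ?\<tau>'"
  proof -
    have "(\<Sum>k\<le>K. if k < 4 * J then ?\<tau>' else 0) = (\<Sum>k\<in>{..K} \<inter> {..<4 * J}. ?\<tau>')"
      by (simp add: sum.If_cases lessThan_def)
    also have "\<dots> \<le> (\<Sum>k<4 * J. ?\<tau>')" by (intro sum_mono2) auto
    finally show ?thesis by simp
  qed
  also have "(\<Sum>k\<le>K. \<theta> ^ k) \<le> 7"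
  proof -
    have "(\<Sum>k\<le>K. \<theta> ^ k) = (1 - \<theta> ^ Suc K) / (1 - \<theta>)"
      using \<theta> by (subst sum_gp0) auto
    also have "\<dots> \<le> 1 / (1 - \<theta>)" using \<theta> by (intro divide_right_mono) auto
    also have "\<dots> \<le> 7" using \<theta> by (simp add: field_simps)
    finally show ?thesis .
  qed
  also have "(\<Sum>k\<le>K. if 1 \<le> k then 3 * real k powr (\<alpha> - 1) else 0) = 3 * (\<Sum>k=1..K. real k powr (\<alpha> - 1))"
  proof -
    have "{..K} \<inter> {k. 1 \<le> k} = {1..K}" by auto
    then show ?thesis by (simp add: sum.If_cases sum_distrib_left)
  qed
  finally show ?thesis by (simp add: algebra_simps)
qed

text \<open>Take the largest admissible j; if it is J, the cutoff in the maximum steps in. Used both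
  for distances to x in the domain and for distances to f(x) in the target.\<close>

lemma dyadic_level:
  fixes d c :: real
  assumes c: "c > 0" and le: "j0 \<le> J" and d: "d < c * (1/2) ^ j0"
  shows "\<exists>j. j0 \<le> j \<and> j \<le> J \<and> d < c * (1/2) ^ j \<and> c * (1/2) ^ (j + 1) \<le> max d (c * (1/2) ^ J)"
proof -
  define A where "A = {j. j \<le> J \<and> d < c * (1/2) ^ j}"
  have A: "finite A" "j0 \<in> A" using le d by (auto simp: A_def)
  define j where "j = Max A"
  have j: "j \<in> A" "j0 \<le> j" unfolding j_def using A by (auto intro: Max_in Max_ge)
  have "c * (1/2) ^ (j + 1) \<le> max d (c * (1/2) ^ J)"
  proof (cases "j = J")
    case True
    have "c * (1/2) ^ (j + 1) \<le> c * (1/2) ^ j" using c by simp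
    then show ?thesis unfolding True by linarith
  next
    case False
    have "j + 1 \<notin> A" using Max_ge[OF A(1), of "j + 1"] unfolding j_def[symmetric] by linarith
    then show ?thesis using False j(1) by (auto simp: A_def)
  qed
  then show ?thesis using j by (auto simp: A_def)
qed


section \<open>Measurability of level sets and the median modulus\<close>

lemma locally_integrable_measurable:
  fixes f :: "'a::euclidean_space \<Rightarrow> 'b::euclidean_space"
  assumes f: "locally_integrable_on f \<Omega>" and \<Omega>: "open \<Omega>"
  shows "(\<lambda>y. indicator \<Omega> y *\<^sub>R f y) \<in> borel_measurable lebesgue"
proof -
  obtain C where C: "\<And>n. compact (C n)" "\<And>n. C n \<subseteq> \<Omega>" "\<And>n. C n \<subseteq> interior (C (Suc n))" "\<Union>(range C) = \<Omega>"
    using open_Union_compact_subsets[OF \<Omega>] by metis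
  have inc: "incseq C"
    using C(3) interior_subset by (intro incseq_SucI) blast
  show ?thesis
  proof (rule borel_measurable_LIMSEQ_metric)
    fix n show "(\<lambda>y. indicator (C n) y *\<^sub>R f y) \<in> borel_measurable lebesgue"
      using f C(1,2) unfolding locally_integrable_on_def set_integrable_def
      by (intro borel_measurable_integrable) auto
  next
    fix y
    show "(\<lambda>n. indicator (C n) y *\<^sub>R f y) \<longlonglongrightarrow> indicator \<Omega> y *\<^sub>R f y"
    proof (cases "y \<in> \<Omega>")
      case True
      then obtain m where m: "y \<in> C m" using C(4) by auto
      have "indicator (C n) y *\<^sub>R f y = indicator \<Omega> y *\<^sub>R f y" if "n \<ge> m" for n
        using m True incseqD[OF inc that] by auto
      then show ?thesis by (intro tendsto_eventually eventually_sequentiallyI) auto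
    next
      case False
      then have "y \<notin> C n" for n using C(2) by auto
      then show ?thesis using False by simp
    qed
  qed
qed

lemma level_set_lebesgue:
  fixes f :: "'a::euclidean_space \<Rightarrow> 'b::euclidean_space"
  assumes f: "(\<lambda>y. indicator \<Omega> y *\<^sub>R f y) \<in> borel_measurable lebesgue"
    and A: "A \<subseteq> \<Omega>" "A \<in> sets lebesgue" and P: "{v. P v} \<in> sets borel"
  shows "{y \<in> A. P (f y)} \<in> sets lebesgue"
proof -
  have "A \<inter> (\<lambda>y. indicator \<Omega> y *\<^sub>R f y) -` {v. P v} \<in> sets lebesgue"
    using measurable_sets[OF f P] A(2) by (intro sets.Int) auto
  moreover have "A \<inter> (\<lambda>y. indicator \<Omega> y *\<^sub>R f y) -` {v. P v} = {y \<in> A. P (f y)}"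
    using A(1) by auto
  ultimately show ?thesis by simp
qed

text \<open>Some t < b belongs to the set whose infimum is the median modulus. The points where |f -
  f(x)| >= t then fill less than half of the ball, and at all others the distance is below
  b.\<close>

lemma median_modulus_half:
  fixes f :: "'a::euclidean_space \<Rightarrow> 'b::euclidean_space"
  assumes f: "(\<lambda>y. indicator \<Omega> y *\<^sub>R f y) \<in> borel_measurable lebesgue"
    and sub: "ball x r \<subseteq> \<Omega>" and r: "r > 0" and b: "median_modulus f x r < b"
  shows "measure lebesgue (ball x r) / 2 \<le> measure lebesgue {y \<in> ball x r. norm (f y - f x) \<le> b}"
proof -
  let ?A = "\<lambda>t. {y \<in> ball x r. norm (f y - f x) \<ge> t}"
  have A: "?A t \<in> sets lebesgue" for t
    by (rule level_set_lebesgue[OF f sub]) (auto, measurable)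
  have fin: "emeasure lebesgue (ball x r) \<noteq> \<infinity>"
    using emeasure_lborel_ball_finite[of x r] by simp
  have Am: "?A t \<in> fmeasurable lebesgue" for t
    by (rule fmeasurableI2[of "ball x r"]) (use A in auto)
  define X where "X = {s. s \<ge> 0 \<and> measure lebesgue (?A s) < measure lebesgue (ball x r) / 2}"
  \<comment> \<open>\<open>Inf\<close> of an empty set of reals would carry no information. The set
    is nonempty since the superlevel sets decrease to the empty set inside a ball of finite
    measure.\<close>
  have "X \<noteq> {}"
  proof -
    have "(\<lambda>m. emeasure lebesgue (?A (real m))) \<longlonglongrightarrow> emeasure lebesgue (\<Inter>m. ?A (real m))"
    proof (rule Lim_emeasure_decseq)
      show "range (\<lambda>m. ?A (real m)) \<subseteq> sets lebesgue" using A by auto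
      show "decseq (\<lambda>m. ?A (real m))" by (rule decseq_SucI) auto
      show "emeasure lebesgue (?A (real m)) \<noteq> \<infinity>" for m
        using Am[of "real m"] by (auto simp: fmeasurable_def)
    qed
    also have "(\<Inter>m. ?A (real m)) = {}"
    proof -
      have "\<exists>m. \<not> real m \<le> norm (f y - f x)" for y
        using reals_Archimedean2[of "norm (f y - f x)"] by (simp add: not_le)
      then show ?thesis by blast
    qed
    finally have "(\<lambda>m. emeasure lebesgue (?A (real m))) \<longlonglongrightarrow> 0" by simp
    moreover have pos: "measure lebesgue (ball x r) > 0"
      using r content_ball_pos[of r x] by simp
    ultimately have "\<forall>\<^sub>F m in sequentially. emeasure lebesgue (?A (real m)) < ennreal (measure lebesgue (ball x r) / 2)"
      by (intro order_tendstoD(2)) auto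
    then obtain m where "emeasure lebesgue (?A (real m)) < ennreal (measure lebesgue (ball x r) / 2)"
      unfolding eventually_sequentially by blast
    then have "measure lebesgue (?A (real m)) < measure lebesgue (ball x r) / 2"
      using Am[of "real m"] by (simp add: emeasure_eq_measure2 ennreal_less_iff)
    then show ?thesis unfolding X_def by (intro ex_in_conv[THEN iffD1] exI[of _ "real m"]) simp
  qed
  moreover have "Inf X < b" using b by (simp add: X_def median_modulus_def)
  ultimately obtain t where t: "t \<in> X" "t < b" by (meson cInf_lessD)
  let ?B = "{y \<in> ball x r. norm (f y - f x) \<le> b}"
  have B: "?B \<in> sets lebesgue"
    by (rule level_set_lebesgue[OF f sub]) (auto, measurable)
  have Bm: "?B \<in> fmeasurable lebesgue"
    by (rule fmeasurableI2[of "ball x r"]) (use B in auto)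
  have "measure lebesgue (ball x r) \<le> measure lebesgue (?A t \<union> ?B)"
    using t Am[of t] Bm by (intro measure_mono_fmeasurable) auto
  also have "\<dots> \<le> measure lebesgue (?A t) + measure lebesgue ?B"
    using Am[of t] Bm by (intro measure_Un_le) auto
  finally show ?thesis using t by (simp add: X_def)
qed

text \<open>Each z is charged to a radius r_k with |x - z| < r_k and r_k / 2 at most the truncated
  distance. There the kernel is at most 2^(n-1) r_k / r_k^n and \<open>gradient_at_scale_le\<close>
  applies. In the Orlicz term the factor r_k^n cancels, so it no longer depends on k and is counted
  once, while the weights are summed.\<close>

lemma kernel_integral_le:
  fixes G U :: "'a::euclidean_space \<Rightarrow> real"
  assumes n: "DIM('a) \<ge> 2" and \<tau>: "\<tau> > 0" and \<alpha>: "0 \<le> \<alpha>" "\<alpha> \<le> 1" and lam: "lam = (1 - \<alpha>) * (real DIM('a) - 1)"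
    and G: "\<And>z. G z \<ge> 0" and J: "J \<ge> 1" and U: "\<And>z. U z \<ge> (1/2) ^ J" and S: "0 < S" "S \<le> 1"
    and meas: "(\<lambda>z. ennreal (orlicz DIM('a) lam (G z) / U z ^ DIM('a)) * indicator (ball x S) z) \<in> borel_measurable lebesgue"
  shows "(\<integral>\<^sup>+z\<in>ball x S. ennreal (G z / U z) * ennreal (1 / max (dist x z) (S * (1/2) ^ K) ^ (DIM('a) - 1)) \<partial>lebesgue)
    \<le> ennreal (2 ^ (DIM('a) - 1)) * (ennreal (unit_ball_vol (real DIM('a)) * (\<Sum>k\<le>K. scale_weight DIM('a) \<tau> \<alpha> J k))
       + ennreal \<tau> * (\<integral>\<^sup>+z\<in>ball x S. ennreal (orlicz DIM('a) lam (G z) / U z ^ DIM('a)) \<partial>lebesgue))"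
proof -
  define n where "n = DIM('a)"
  have n2: "n \<ge> 2" using n by (simp add: n_def)
  define r where "r k = S * (1/2) ^ k" for k :: nat
  have r: "r k > 0" "r k \<le> (1/2) ^ k" for k
    using S by (auto simp: r_def mult_left_le_one_le)
  let ?o = "unit_ball_vol (real DIM('a))"
  let ?w = "scale_weight n \<tau> \<alpha> J"
  \<comment> \<open>Scaled so that each summand integrates to the volume of the unit ball times the
    weight. Summing over all k, rather than selecting the one for z, avoids a partition into
    annuli.\<close>
  let ?H = "\<lambda>z. \<Sum>k\<le>K. ennreal (?w k / r k ^ n) * indicator (ball x (r k)) z"
  let ?P = "\<lambda>z. ennreal (orlicz n lam (G z) / U z ^ n) * indicator (ball x S) z"
  have P: "?P \<in> borel_measurable lebesgue" using meas by (simp add: n_def)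
  have pt: "ennreal (G z / U z) * ennreal (1 / max (dist x z) (S * (1/2) ^ K) ^ (n - 1)) * indicator (ball x S) z
     \<le> ennreal (2 ^ (n - 1)) * (?H z + ennreal \<tau> * ?P z)" for z
  proof (cases "z \<in> ball x S")
    case True
    have U0: "U z > 0" using U[of z] by (rule less_le_trans[rotated]) simp
    define m where "m = max (dist x z) (S * (1/2) ^ K)"
    obtain k where k: "k \<le> K" "dist x z < r k" "S * (1/2) ^ (k + 1) \<le> m"
      using dyadic_level[of S 0 K "dist x z"] S True unfolding r_def m_def by auto
    have rm: "r k / 2 \<le> m" using k(3) by (simp add: r_def)
    have "1 / m ^ (n - 1) \<le> 1 / (r k / 2) ^ (n - 1)"
      using r[of k] rm by (intro divide_left_mono power_mono mult_pos_pos zero_less_power) auto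
    also have "\<dots> = 2 ^ (n - 1) * r k / r k ^ n"
      using n2 r[of k] by (cases n) (auto simp: power_divide)
    finally have "G z / U z * (1 / m ^ (n - 1)) \<le> G z / U z * (2 ^ (n - 1) * r k / r k ^ n)"
      using G[of z] U0 by (intro mult_left_mono) auto
    also have "\<dots> = 2 ^ (n - 1) * ((G z / U z * r k) / r k ^ n)" by simp
    also have "\<dots> \<le> 2 ^ (n - 1) * ((?w k + \<tau> * (orlicz n lam (G z) / U z ^ n * r k ^ n)) / r k ^ n)"
      using n2 \<tau> \<alpha> lam G J U r[of k]
      by (intro mult_left_mono divide_right_mono gradient_at_scale_le) (auto simp: n_def)
    also have "\<dots> = 2 ^ (n - 1) * (?w k / r k ^ n + \<tau> * (orlicz n lam (G z) / U z ^ n))"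
      using r[of k] by (simp add: add_divide_distrib)
    finally have "ennreal (G z / U z * (1 / m ^ (n - 1))) \<le> ennreal (2 ^ (n - 1) * (?w k / r k ^ n + \<tau> * (orlicz n lam (G z) / U z ^ n)))"
      by (rule ennreal_leI)
    also have "\<dots> = ennreal (2 ^ (n - 1)) * (ennreal (?w k / r k ^ n) + ennreal \<tau> * ennreal (orlicz n lam (G z) / U z ^ n))"
    proof -
      have "ennreal (\<tau> * (orlicz n lam (G z) / U z ^ n)) = ennreal \<tau> * ennreal (orlicz n lam (G z) / U z ^ n)"
        using \<tau> by (intro ennreal_mult') simp
      moreover have "0 \<le> ?w k / r k ^ n" "0 \<le> \<tau> * (orlicz n lam (G z) / U z ^ n)"
        using \<tau> U0 r[of k] orlicz_nonneg[OF G[of z], of n lam] scale_weight_nonneg[of n \<tau> \<alpha> J k] by auto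
      ultimately show ?thesis by (simp only: ennreal_plus ennreal_mult' zero_le_power zero_le_numeral)
    qed
    also have "\<dots> \<le> ennreal (2 ^ (n - 1)) * (?H z + ennreal \<tau> * ennreal (orlicz n lam (G z) / U z ^ n))"
    proof (intro mult_left_mono add_right_mono)
      have "ennreal (?w k / r k ^ n) = (\<Sum>k\<in>{k}. ennreal (?w k / r k ^ n) * indicator (ball x (r k)) z)"
        using k by simp
      also have "\<dots> \<le> ?H z"
        using k by (intro sum_mono2) auto
      finally show "ennreal (?w k / r k ^ n) \<le> ?H z" .
    qed simp
    finally have "ennreal (G z / U z * (1 / m ^ (n - 1))) \<le> ennreal (2 ^ (n - 1)) * (?H z + ennreal \<tau> * ennreal (orlicz n lam (G z) / U z ^ n))" .
    moreover have "ennreal (G z / U z * (1 / m ^ (n - 1))) = ennreal (G z / U z) * ennreal (1 / m ^ (n - 1))"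
      using G[of z] U0 by (intro ennreal_mult') simp
    ultimately show ?thesis using True by (simp add: m_def)
  qed simp
  have "(\<integral>\<^sup>+z\<in>ball x S. ennreal (G z / U z) * ennreal (1 / max (dist x z) (S * (1/2) ^ K) ^ (n - 1)) \<partial>lebesgue)
    \<le> (\<integral>\<^sup>+z. ennreal (2 ^ (n - 1)) * (?H z + ennreal \<tau> * ?P z) \<partial>lebesgue)"
    by (intro nn_integral_mono pt)
  also have "\<dots> = ennreal (2 ^ (n - 1)) * ((\<integral>\<^sup>+z. ?H z \<partial>lebesgue) + ennreal \<tau> * (\<integral>\<^sup>+z. ?P z \<partial>lebesgue))"
  proof -
    have [measurable]: "?P \<in> borel_measurable lebesgue" by (rule P)
    have [measurable]: "ball x (r k) \<in> sets lebesgue" for k by simp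
    have "(\<lambda>z. ?H z) \<in> borel_measurable lebesgue"
      by (intro borel_measurable_sum borel_measurable_times_ennreal borel_measurable_const borel_measurable_indicator) simp
    then show ?thesis using P
      by (simp add: nn_integral_cmult nn_integral_add)
  qed
  also have "(\<integral>\<^sup>+z. ?H z \<partial>lebesgue)
     = (\<Sum>k\<le>K. \<integral>\<^sup>+z. ennreal (?w k / r k ^ n) * indicator (ball x (r k)) z \<partial>lebesgue)"
    by (intro nn_integral_sum borel_measurable_times_ennreal borel_measurable_const borel_measurable_indicator) simp
  also have "\<dots> = (\<Sum>k\<le>K. ennreal (?o * ?w k))"
  proof (intro sum.cong refl)
    fix k
    have "(\<integral>\<^sup>+z. ennreal (?w k / r k ^ n) * indicator (ball x (r k)) z \<partial>lebesgue) = ennreal (?w k / r k ^ n) * emeasure lebesgue (ball x (r k))"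
      by (rule nn_integral_cmult_indicator) simp
    also have "\<dots> = ennreal (?w k / r k ^ n) * ennreal (?o * r k ^ n)"
      using r[of k] by (simp add: emeasure_ball n_def)
    also have "\<dots> = ennreal (?w k / r k ^ n * (?o * r k ^ n))"
      using r[of k] scale_weight_nonneg[of n \<tau> \<alpha> J k] by (intro ennreal_mult[symmetric]) auto
    also have "?w k / r k ^ n * (?o * r k ^ n) = ?o * ?w k"
      using r[of k] by simp
    finally show "(\<integral>\<^sup>+z. ennreal (?w k / r k ^ n) * indicator (ball x (r k)) z \<partial>lebesgue) = ennreal (?o * ?w k)" .
  qed
  also have "\<dots> = ennreal (?o * (\<Sum>k\<le>K. ?w k))"
    by (simp add: sum_distrib_left scale_weight_nonneg)
  finally show ?thesis unfolding n_def .
qed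

text \<open>Where U >= 2^(-j-1), dividing by U^n costs at most 2^((j+1)n), which cancels the layer
  bound \<epsilon> 2^(-jn) up to 2^n. Each of the at most J + 1 layers thus contributes 2^n
  \<epsilon>. Off the first layer, U >= 2^(-j0) gives the term that does not grow with J.\<close>

lemma energy_layers_le:
  fixes \<Phi> U u :: "'a::euclidean_space \<Rightarrow> real"
  assumes \<Phi>: "\<And>z. \<Phi> z \<ge> 0" and le: "j0 \<le> J"
    and U: "\<And>z. u z \<le> U z" "\<And>z. (1/2) ^ J \<le> U z"
    and meas: "(\<lambda>z. ennreal (\<Phi> z) * indicator B z) \<in> borel_measurable lebesgue"
    and lev: "\<And>j. {z \<in> B. u z < (1/2) ^ j} \<in> sets lebesgue"
    and layer: "\<And>j. j0 \<le> j \<Longrightarrow> (\<integral>\<^sup>+z\<in>{z \<in> B. u z < (1/2) ^ j}. ennreal (\<Phi> z) \<partial>lebesgue) \<le> ennreal (\<epsilon> * (1/2) ^ (j * n))"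
    and \<epsilon>: "\<epsilon> \<ge> 0"
  shows "(\<integral>\<^sup>+z\<in>B. ennreal (\<Phi> z / U z ^ n) \<partial>lebesgue)
    \<le> ennreal (2 ^ n * \<epsilon> * (real J + 1)) + ennreal (2 ^ (j0 * n)) * (\<integral>\<^sup>+z\<in>B. ennreal (\<Phi> z) \<partial>lebesgue)"
proof -
  let ?L = "\<lambda>j. {z \<in> B. u z < (1/2) ^ j}"
  let ?H = "\<lambda>z. \<Sum>j=j0..J. ennreal (2 ^ ((j + 1) * n)) * (ennreal (\<Phi> z) * indicator (?L j) z)"
  have U0: "U z > 0" for z using U(2)[of z] by (rule less_le_trans[rotated]) simp
  have inv: "1 / U z ^ n \<le> 2 ^ (j * n)" if "(1/2) ^ j \<le> U z" for z j
  proof -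
    have "1 / U z ^ n \<le> 1 / ((1/2) ^ j) ^ n"
      using that U0[of z] by (intro divide_left_mono power_mono mult_pos_pos zero_less_power) auto
    then show ?thesis by (simp add: power_divide power_mult)
  qed
  have pt: "ennreal (\<Phi> z / U z ^ n) * indicator B z \<le>
      ?H z
        + ennreal (2 ^ (j0 * n)) * (ennreal (\<Phi> z) * indicator B z)" for z
  proof (cases "z \<in> B")
    case z: True
    have mult: "ennreal (\<Phi> z / U z ^ n) \<le> ennreal (2 ^ (j * n)) * ennreal (\<Phi> z)" if "(1/2) ^ j \<le> U z" for j
      using mult_left_mono[OF inv[OF that], of "\<Phi> z"] \<Phi>[of z]
      by (simp add: ennreal_mult[symmetric] ennreal_leI mult.commute)
    show ?thesis
    proof (cases "u z < (1/2) ^ j0")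
      case True
      then obtain j where j: "j0 \<le> j" "j \<le> J" "u z < (1/2) ^ j" "(1/2) ^ (j + 1) \<le> max (u z) ((1/2) ^ J)"
        using dyadic_level[of 1 j0 J "u z"] le by auto
      then have "(1/2) ^ (j + 1) \<le> U z" using U[of z] by linarith
      then have "ennreal (\<Phi> z / U z ^ n) \<le> (\<Sum>j\<in>{j}. ennreal (2 ^ ((j + 1) * n)) * (ennreal (\<Phi> z) * indicator (?L j) z))"
        using mult[of "j + 1"] j z by simp
      also have "\<dots> \<le> ?H z"
        using j by (intro sum_mono2) auto
      finally show ?thesis using z by (simp add: add_increasing2)
    next
      case False
      then have "(1/2) ^ j0 \<le> U z" using U(1)[of z] by simp
      from mult[OF this] show ?thesis using z by (simp add: add_increasing)
    qed
  qed simp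
  have Lm: "(\<lambda>z. ennreal (\<Phi> z) * indicator (?L j) z) \<in> borel_measurable lebesgue" for j
  proof -
    have "(\<lambda>z. ennreal (\<Phi> z) * indicator (?L j) z) = (\<lambda>z. (ennreal (\<Phi> z) * indicator B z) * indicator (?L j) z)"
      by (auto simp: fun_eq_iff indicator_def)
    then show ?thesis
      using borel_measurable_times_ennreal[OF meas borel_measurable_indicator[OF lev[of j]]] by simp
  qed
  have "(\<integral>\<^sup>+z\<in>B. ennreal (\<Phi> z / U z ^ n) \<partial>lebesgue) \<le> (\<integral>\<^sup>+z. ?H z
        + ennreal (2 ^ (j0 * n)) * (ennreal (\<Phi> z) * indicator B z) \<partial>lebesgue)"
    by (intro nn_integral_mono pt)
  also have "\<dots> = (\<Sum>j=j0..J. ennreal (2 ^ ((j + 1) * n)) * (\<integral>\<^sup>+z. ennreal (\<Phi> z) * indicator (?L j) z \<partial>lebesgue))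
      + ennreal (2 ^ (j0 * n)) * (\<integral>\<^sup>+z\<in>B. ennreal (\<Phi> z) \<partial>lebesgue)"
    using Lm meas
    by (subst nn_integral_add) (auto simp: nn_integral_sum nn_integral_cmult intro!: borel_measurable_sum borel_measurable_times_ennreal)
  also have "\<dots> \<le> (\<Sum>j=j0..J. ennreal (2 ^ ((j + 1) * n)) * ennreal (\<epsilon> * (1/2) ^ (j * n)))
      + ennreal (2 ^ (j0 * n)) * (\<integral>\<^sup>+z\<in>B. ennreal (\<Phi> z) \<partial>lebesgue)"
    by (intro add_right_mono sum_mono mult_left_mono layer) auto
  also have "(\<Sum>j=j0..J. ennreal (2 ^ ((j + 1) * n)) * ennreal (\<epsilon> * (1/2) ^ (j * n))) = (\<Sum>j=j0..J. ennreal (2 ^ n * \<epsilon>))"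
  proof (intro sum.cong refl)
    fix j
    have "2 ^ ((j + 1) * n) * (\<epsilon> * (1/2) ^ (j * n)) = 2 ^ n * \<epsilon>"
      by (simp add: power_add power_one_over)
    then show "ennreal (2 ^ ((j + 1) * n)) * ennreal (\<epsilon> * (1/2) ^ (j * n)) = ennreal (2 ^ n * \<epsilon>)"
      using \<epsilon> by (simp add: ennreal_mult[symmetric])
  qed
  also have "\<dots> \<le> ennreal (2 ^ n * \<epsilon> * (real J + 1))"
  proof -
    have "(\<Sum>j=j0..J. ennreal (2 ^ n * \<epsilon>)) = ennreal (\<Sum>j=j0..J. 2 ^ n * \<epsilon>)"
      using \<epsilon> by (intro sum_ennreal) auto
    also have "(\<Sum>j=j0..J. 2 ^ n * \<epsilon>) = real (Suc J - j0) * (2 ^ n * \<epsilon>)" by simp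
    also have "\<dots> \<le> (real J + 1) * (2 ^ n * \<epsilon>)" using \<epsilon> by (intro mult_right_mono) auto
    finally show ?thesis by (simp add: mult.commute ennreal_leI)
  qed
  finally show ?thesis by (simp add: add_right_mono)
qed


section \<open>Measurability of the gradient and of the energy\<close>

lemma weak_gradient_measurable:
  fixes f :: "'a::euclidean_space \<Rightarrow> 'b::euclidean_space"
  assumes sob: "weak_gradient_W11loc f \<Omega> g" and \<Omega>: "open \<Omega>"
  shows "(\<lambda>y. indicator \<Omega> y *\<^sub>R f y) \<in> borel_measurable lebesgue"
    and "(\<lambda>y. indicator \<Omega> y * grad_norm g y) \<in> borel_measurable lebesgue"
proof -
  show "(\<lambda>y. indicator \<Omega> y *\<^sub>R f y) \<in> borel_measurable lebesgue"
    using sob \<Omega> unfolding weak_gradient_W11loc_def by (blast intro: locally_integrable_measurable)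
  have "(\<lambda>y. indicator \<Omega> y *\<^sub>R g i y) \<in> borel_measurable lebesgue" if "i \<in> Basis" for i
    using sob \<Omega> that unfolding weak_gradient_W11loc_def by (blast intro: locally_integrable_measurable)
  then have "(\<lambda>y. grad_norm (\<lambda>i y. indicator \<Omega> y *\<^sub>R g i y) y) \<in> borel_measurable lebesgue"
    unfolding grad_norm_def by measurable
  moreover have "grad_norm (\<lambda>i y. indicator \<Omega> y *\<^sub>R g i y) y = indicator \<Omega> y * grad_norm g y" for y
    by (simp add: grad_norm_def indicator_def)
  ultimately show "(\<lambda>y. indicator \<Omega> y * grad_norm g y) \<in> borel_measurable lebesgue" by simp
qed

lemma measurable_orlicz [measurable]: "orlicz n lam \<in> borel_measurable borel"
  unfolding orlicz_def[abs_def] by measurable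

text \<open>The functions p and q are left free so that one statement serves the plain energy, with
  q = 1, and the energy divided by a power of \<open>reg_dist\<close>.\<close>

lemma orlicz_energy_measurable:
  fixes f :: "'a::euclidean_space \<Rightarrow> 'b::euclidean_space"
  assumes sob: "weak_gradient_W11loc f \<Omega> g" and \<Omega>: "open \<Omega>"
    and A: "A \<subseteq> \<Omega>" "A \<in> sets lebesgue" and p: "p \<in> borel_measurable borel" and q: "q \<in> borel_measurable borel"
  shows "(\<lambda>y. ennreal (p (grad_norm g y) / q (f y)) * indicator A y) \<in> borel_measurable lebesgue"
proof -
  note [measurable] = weak_gradient_measurable[OF sob \<Omega>] A(2) p q
  have "(\<lambda>y. ennreal (p (indicator \<Omega> y * grad_norm g y) / q (indicator \<Omega> y *\<^sub>R f y)) * indicator A y) \<in> borel_measurable lebesgue"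
    by measurable
  moreover have "(\<lambda>y. ennreal (p (indicator \<Omega> y * grad_norm g y) / q (indicator \<Omega> y *\<^sub>R f y)) * indicator A y)
      = (\<lambda>y. ennreal (p (grad_norm g y) / q (f y)) * indicator A y)"
    using A(1) by (auto simp: fun_eq_iff indicator_def)
  ultimately show ?thesis by simp
qed

text \<open>The key claim with dyadic radii, so that its failure bounds every layer from some
  \<open>j1\<close> on.\<close>

definition recurrent_energy :: "real \<Rightarrow> real \<Rightarrow> ('a::euclidean_space \<Rightarrow> 'b::euclidean_space) \<Rightarrow> ('a \<Rightarrow> 'a \<Rightarrow> 'b) \<Rightarrow> 'a set \<Rightarrow> 'a \<Rightarrow> bool" where
  "recurrent_energy \<epsilon> lam f g V x \<longleftrightarrow> (\<forall>j1. \<exists>j\<ge>j1. ennreal (\<epsilon> * (1/2) ^ (j * DIM('a))) \<le>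
        (\<integral>\<^sup>+z\<in>{z \<in> V. norm (f z - f x) < (1/2) ^ j}. ennreal (1 + orlicz DIM('a) lam (grad_norm g z)) \<partial>lebesgue))"

text \<open>\<epsilon> is fixed before \<open>f\<close>, \<open>V\<close>, \<open>x\<close> and
  \<open>R\<close>, because the covering needs one value for all points that share an exponent and
  for neighbourhoods \<open>V\<close> of arbitrarily small energy. The constants give each of the
  two terms linear in J the coefficient 1/8, against at least 1/2 on the left.\<close>

lemma image_energy_lower:
  fixes lam \<alpha> \<mu> :: real
  assumes n: "DIM('a::euclidean_space) \<ge> 2" and \<alpha>: "0 \<le> \<alpha>" "\<alpha> \<le> 1"
    and lam: "lam = (1 - \<alpha>) * (real DIM('a) - 1)" and \<mu>: "\<mu> > 0"
  obtains \<epsilon> where "\<epsilon> > 0"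
    "\<And>(f :: 'a \<Rightarrow> 'b::euclidean_space) g \<Omega> V x R.
      weak_gradient_W11loc f \<Omega> g \<Longrightarrow> open \<Omega> \<Longrightarrow> open V \<Longrightarrow> V \<subseteq> \<Omega> \<Longrightarrow> x \<in> V \<Longrightarrow> R > 0 \<Longrightarrow>
      (\<And>r. 0 < r \<Longrightarrow> r \<le> R \<Longrightarrow> median_modulus f x r \<le> modulus_bound \<alpha> \<mu> r) \<Longrightarrow>
      (\<integral>\<^sup>+z\<in>V. ennreal (orlicz DIM('a) lam (grad_norm g z)) \<partial>lebesgue) < \<infinity> \<Longrightarrow>
      recurrent_energy \<epsilon> lam f g V x"
proof -
  define n where "n = DIM('a)"
  have n2: "n \<ge> 2" using n by (simp add: n_def)
  define \<omega> where "\<omega> = unit_ball_vol (real DIM('a))"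
  have \<omega>: "\<omega> > 0" by (simp add: \<omega>_def)
  obtain C where C: "C \<ge> 0" "\<And>J. \<exists>K\<ge>1. (\<forall>r. 0 < r \<and> r \<le> (1/2) ^ K \<longrightarrow> modulus_bound \<alpha> \<mu> r \<le> (1/2) ^ J) \<and>
      (\<Sum>k=1..K. real k powr (\<alpha> - 1)) \<le> C * (real J + 1)"
    using modulus_scale_choice[OF \<mu> \<alpha>] by blast
  \<comment> \<open>The product of the constants of \<open>sobolev_capacity\<close> and
    \<open>kernel_integral_le\<close>.\<close>
  define B where "B = (2 ^ (n + 4) / \<omega>) * 2 ^ (n - 1)"
  have B: "B > 0" using \<omega> by (simp add: B_def)
  \<comment> \<open>Makes B \<omega> (4 + 3C) \<tau>' = 1/8, the share of the scale weights; 4 + 3C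
    is their growth rate in J by \<open>sum_scale_weight_le\<close> and the choice of K.\<close>
  define \<tau>' where "\<tau>' = 1 / (8 * B * \<omega> * (4 + 3 * C))"
  have \<tau>': "\<tau>' > 0" using B \<omega> C by (auto simp: \<tau>'_def intro!: divide_pos_pos mult_pos_pos add_pos_nonneg)
  \<comment> \<open>Solves \<tau>' = \<tau>^(-1/(n-1)), the threshold of
    \<open>power_dichotomy\<close>.\<close>
  define \<tau> where "\<tau> = \<tau>' powr (- (real n - 1))"
  have \<tau>: "\<tau> > 0" using \<tau>' by (simp add: \<tau>_def)
  have \<tau>\<tau>': "\<tau> powr (- 1 / (real n - 1)) = \<tau>'"
  proof -
    have "\<tau> powr (- 1 / (real n - 1)) = \<tau>' powr ((- (real n - 1)) * (- 1 / (real n - 1)))"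
      unfolding \<tau>_def by (rule powr_powr)
    also have "(- (real n - 1)) * (- 1 / (real n - 1)) = 1" using n2 by (simp add: field_simps)
    finally show ?thesis using \<tau>' by simp
  qed
  \<comment> \<open>Makes B \<tau> 2^n \<epsilon> = 1/8, the share of the energy layers.\<close>
  define \<epsilon> where "\<epsilon> = 1 / (8 * B * \<tau> * 2 ^ n)"
  have \<epsilon>: "\<epsilon> > 0" using B \<tau> by (simp add: \<epsilon>_def)
  show thesis
  proof (rule that[OF \<epsilon>], rule ccontr)
    fix f :: "'a \<Rightarrow> 'b" and g \<Omega> V x R
    assume sob: "weak_gradient_W11loc f \<Omega> g" and \<Omega>: "open \<Omega>" and V: "open V" "V \<subseteq> \<Omega>" "x \<in> V" and R: "R > 0"
      and mm: "\<And>r. 0 < r \<Longrightarrow> r \<le> R \<Longrightarrow> median_modulus f x r \<le> modulus_bound \<alpha> \<mu> r"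
      and fin: "(\<integral>\<^sup>+z\<in>V. ennreal (orlicz DIM('a) lam (grad_norm g z)) \<partial>lebesgue) < \<infinity>"
      and "\<not> recurrent_energy \<epsilon> lam f g V x"
    then obtain j1 where neg: "\<not> (\<exists>j\<ge>j1. ennreal (\<epsilon> * (1/2) ^ (j * DIM('a))) \<le>
        (\<integral>\<^sup>+z\<in>{z \<in> V. norm (f z - f x) < (1/2) ^ j}. ennreal (1 + orlicz DIM('a) lam (grad_norm g z)) \<partial>lebesgue))"
      unfolding recurrent_energy_def by blast
    define \<Phi> where "\<Phi> z = orlicz n lam (grad_norm g z)" for z
    have \<Phi>0: "\<Phi> z \<ge> 0" for z by (simp add: \<Phi>_def orlicz_nonneg grad_norm_nonneg)
    define p where "p = f x"
    define u where "u z = norm (f z - p)" for z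
    have small: "(\<integral>\<^sup>+z\<in>{z \<in> V. u z < (1/2) ^ j}. ennreal (1 + \<Phi> z) \<partial>lebesgue) \<le> ennreal (\<epsilon> * (1/2) ^ (j * n))"
      if "j \<ge> j1" for j
      using neg that unfolding u_def p_def \<Phi>_def n_def by (meson linear)
    obtain e where e: "e > 0" "cball x e \<subseteq> V" using V open_contains_cball by blast
    define S where "S = min (e / 2) (min 1 R)"
    have S: "S > 0" "S < e" "S \<le> 1" "S \<le> R" using e R by (auto simp: S_def)
    let ?B = "ball x S"
    have "?B \<subseteq> cball x e" using S by auto
    then have BV: "?B \<subseteq> V" and B\<Omega>: "?B \<subseteq> \<Omega>" using e(2) V(2) by blast+
    have fm: "(\<lambda>y. indicator \<Omega> y *\<^sub>R f y) \<in> borel_measurable lebesgue"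
      by (rule weak_gradient_measurable(1)[OF sob \<Omega>])
    have lev: "{z \<in> ?B. u z < t} \<in> sets lebesgue" for t
      unfolding u_def by (rule level_set_lebesgue[OF fm B\<Omega>]) (auto, measurable)
    have lev': "{z \<in> ?B. t \<le> u z} \<in> sets lebesgue" for t
      unfolding u_def by (rule level_set_lebesgue[OF fm B\<Omega>]) (auto, measurable)
    have layer: "(\<integral>\<^sup>+z\<in>{z \<in> ?B. u z < (1/2) ^ j}. ennreal (1 + \<Phi> z) \<partial>lebesgue) \<le> ennreal (\<epsilon> * (1/2) ^ (j * n))"
      if "j \<ge> j1" for j
    proof -
      have "(\<integral>\<^sup>+z\<in>{z \<in> ?B. u z < (1/2) ^ j}. ennreal (1 + \<Phi> z) \<partial>lebesgue) \<le> (\<integral>\<^sup>+z\<in>{z \<in> V. u z < (1/2) ^ j}. ennreal (1 + \<Phi> z) \<partial>lebesgue)"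
        using BV by (intro nn_integral_mono) (auto simp: indicator_def)
      then show ?thesis using small[OF that] by simp
    qed
    define vol where "vol = measure lebesgue ?B"
    have vol: "vol > 0" using S content_ball_pos[of S x] by (simp add: vol_def)
    have "(\<lambda>j. \<epsilon> * ((1/2) ^ n) ^ j) \<longlonglongrightarrow> \<epsilon> * 0"
      using n2 by (intro tendsto_mult tendsto_const LIMSEQ_realpow_zero) (auto simp: power_less_one_iff)
    then have "\<forall>\<^sub>F j in sequentially. \<epsilon> * ((1/2) ^ n) ^ j < vol / 2"
      using vol by (intro order_tendstoD) auto
    then obtain j2 where j2: "\<And>j. j \<ge> j2 \<Longrightarrow> \<epsilon> * ((1/2) ^ n) ^ j < vol / 2"
      unfolding eventually_sequentially by blast
    \<comment> \<open>At this level the layer bounds already hold and the set u < 2^(-j0) has less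
      than half the measure of the ball. The index is chosen before J.\<close>
    define j0 where "j0 = max j1 j2"
    have j0: "j0 \<ge> j1" "\<epsilon> * (1/2) ^ (j0 * n) < vol / 2"
      using j2[of j0] by (simp_all add: j0_def power_mult[symmetric] mult.commute)
    have Bfm: "?B \<in> fmeasurable lebesgue"
      using emeasure_lborel_ball_finite[of x S] by (auto simp: fmeasurable_def)
    have half_a: "measure lebesgue ?B / 2 \<le> measure lebesgue {z \<in> ?B. (1/2) ^ j0 \<le> norm (f z - p)}"
    proof -
      let ?L = "{z \<in> ?B. u z < (1/2) ^ j0}" and ?H = "{z \<in> ?B. (1/2) ^ j0 \<le> u z}"
      have Lf: "?L \<in> fmeasurable lebesgue" by (rule fmeasurableI2[OF Bfm _ lev]) auto
      have Hf: "?H \<in> fmeasurable lebesgue" by (rule fmeasurableI2[OF Bfm _ lev']) auto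
      have "emeasure lebesgue ?L = (\<integral>\<^sup>+z. indicator ?L z \<partial>lebesgue)"
        using lev by simp
      also have "\<dots> \<le> (\<integral>\<^sup>+z\<in>?L. ennreal (1 + \<Phi> z) \<partial>lebesgue)"
      proof (intro nn_integral_mono)
        fix z
        have "ennreal 1 \<le> ennreal (1 + \<Phi> z)" using \<Phi>0[of z] by (intro ennreal_leI) simp
        then show "indicator ?L z \<le> ennreal (1 + \<Phi> z) * indicator ?L z"
          by (cases "z \<in> ?L") simp_all
      qed
      also have "\<dots> \<le> ennreal (\<epsilon> * (1/2) ^ (j0 * n))" by (rule layer[OF j0(1)])
      finally have "measure lebesgue ?L \<le> \<epsilon> * (1/2) ^ (j0 * n)"
        using Lf \<epsilon> by (simp add: emeasure_eq_measure2)
      moreover have "measure lebesgue ?B \<le> measure lebesgue (?L \<union> ?H)"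
        using Lf Hf Bfm by (intro measure_mono_fmeasurable) auto
      moreover have "\<dots> \<le> measure lebesgue ?L + measure lebesgue ?H"
        using Lf Hf by (intro measure_Un_le) auto
      ultimately have "measure lebesgue ?B / 2 \<le> measure lebesgue ?H"
        using j0(2) unfolding vol_def by linarith
      then show ?thesis by (simp only: u_def)
    qed
    have \<Phi>m: "(\<lambda>z. ennreal (\<Phi> z) * indicator ?B z) \<in> borel_measurable lebesgue"
      using orlicz_energy_measurable[OF sob \<Omega> B\<Omega>, of "orlicz n lam" "\<lambda>_. 1"] by (simp add: \<Phi>_def)
    have "(\<integral>\<^sup>+z\<in>?B. ennreal (\<Phi> z) \<partial>lebesgue) \<le> (\<integral>\<^sup>+z\<in>V. ennreal (\<Phi> z) \<partial>lebesgue)"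
      using BV by (intro nn_integral_mono) (auto simp: indicator_def)
    also have "\<dots> < \<infinity>" using fin by (simp add: \<Phi>_def n_def)
    finally obtain E where E: "(\<integral>\<^sup>+z\<in>?B. ennreal (\<Phi> z) \<partial>lebesgue) = ennreal E" "E \<ge> 0"
      by (cases "\<integral>\<^sup>+z\<in>?B. ennreal (\<Phi> z) \<partial>lebesgue") auto
    \<comment> \<open>Collects all contributions that do not depend on J.\<close>
    define D where "D = 7 * B * \<omega> + B * \<tau> * (2 ^ (j0 * n) * E)"
    have main: "(real J - real j0) / 2 - 3 / 2 \<le> (real J + 1) / 4 + D" if J: "J \<ge> j0" "J \<ge> 1" for J
    proof -
      obtain K where K: "K \<ge> 1" "\<And>r. 0 < r \<Longrightarrow> r \<le> (1/2) ^ K \<Longrightarrow> modulus_bound \<alpha> \<mu> r \<le> (1/2) ^ J"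
        "(\<Sum>k=1..K. real k powr (\<alpha> - 1)) \<le> C * (real J + 1)"
        using C(2)[of J] by blast
      define s where "s = S * (1/2) ^ K"
      have s: "0 < s" "s \<le> S" "s \<le> (1/2) ^ K" "s \<le> R"
      proof -
        show "0 < s" using S by (simp add: s_def)
        have "(1/2::real) ^ K \<le> 1" by (simp add: power_le_one)
        then show *: "s \<le> S" using S mult_left_mono[of "(1/2::real) ^ K" 1 S] by (simp add: s_def)
        show "s \<le> (1/2) ^ K" using S by (simp add: s_def mult_left_le_one_le)
        show "s \<le> R" using * S by simp
      qed
      define h where "h = (1/2::real) ^ J"
      have h: "h > 0" by (simp add: h_def)
      have "median_modulus f x s \<le> h"
        using mm[OF s(1,4)] K(2)[OF s(1,3)] by (simp add: h_def)
      \<comment> \<open>Twice h, since \<open>median_modulus_half\<close> wants a strict inequality.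
        With b = 2h the sum h^2 + b^2 becomes 5 h^2, the source of ln 5 below.\<close>
      then have "median_modulus f x s < 2 * h" using h by simp
      moreover have "ball x s \<subseteq> \<Omega>" using subset_ball[OF s(2)] B\<Omega> by blast
      ultimately have half_b: "measure lebesgue (ball x s) / 2 \<le> measure lebesgue {y \<in> ball x s. norm (f y - p) \<le> 2 * h}"
        unfolding p_def using s by (intro median_modulus_half[OF fm])
      let ?U = "\<lambda>z. reg_dist h p (f z)"
      have U: "u z \<le> ?U z" "(1/2) ^ J \<le> ?U z" for z
        using reg_dist_ge_norm[of "f z" p h] reg_dist_ge[OF h, of p "f z"] by (auto simp: u_def h_def)
      have rm: "(\<lambda>v. reg_dist h p v ^ n) \<in> borel_measurable borel"
        by (intro borel_measurable_power borel_measurable_continuous_onI continuous_on_reg_dist)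
      have Pm: "(\<lambda>z. ennreal (orlicz DIM('a) lam (grad_norm g z) / ?U z ^ DIM('a)) * indicator ?B z) \<in> borel_measurable lebesgue"
        using orlicz_energy_measurable[OF sob \<Omega> B\<Omega> _ _ rm, of "orlicz n lam"] by (simp add: n_def)
      let ?c = "ln ((1/2::real) ^ j0) - ln (h\<^sup>2 + (2 * h)\<^sup>2) / 2"
      let ?sw = "\<Sum>k\<le>K. scale_weight n \<tau> \<alpha> J k"
      let ?R = "(2 ^ (n + 4) / \<omega>) * (2 ^ (n - 1) * (\<omega> * ?sw + \<tau> * (2 ^ n * \<epsilon> * (real J + 1) + 2 ^ (j0 * n) * E)))"
      have "ennreal (?c) \<le> ennreal (2 ^ (DIM('a) + 4) / unit_ball_vol (real DIM('a))) *
          (\<integral>\<^sup>+z\<in>?B. ennreal (grad_norm g z / ?U z) * ennreal (1 / max (dist x z) s ^ (DIM('a) - 1)) \<partial>lebesgue)"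
        using e V(2) s S h by (intro sobolev_capacity[OF n sob _ s(1,2) S(2) h _ _ half_a half_b]) auto
      also have "(\<integral>\<^sup>+z\<in>?B. ennreal (grad_norm g z / ?U z) * ennreal (1 / max (dist x z) s ^ (DIM('a) - 1)) \<partial>lebesgue)
         \<le> ennreal (2 ^ (DIM('a) - 1)) * (ennreal (unit_ball_vol (real DIM('a)) * (\<Sum>k\<le>K. scale_weight DIM('a) \<tau> \<alpha> J k))
            + ennreal \<tau> * (\<integral>\<^sup>+z\<in>?B. ennreal (orlicz DIM('a) lam (grad_norm g z) / ?U z ^ DIM('a)) \<partial>lebesgue))"
        unfolding s_def
        by (rule kernel_integral_le[OF n \<tau> \<alpha> lam grad_norm_nonneg J(2) U(2) S(1,3) Pm])
      also have "(\<integral>\<^sup>+z\<in>?B. ennreal (orlicz DIM('a) lam (grad_norm g z) / ?U z ^ DIM('a)) \<partial>lebesgue)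
         \<le> ennreal (2 ^ n * \<epsilon> * (real J + 1)) + ennreal (2 ^ (j0 * n)) * (\<integral>\<^sup>+z\<in>?B. ennreal (\<Phi> z) \<partial>lebesgue)"
        unfolding \<Phi>_def[symmetric] n_def[symmetric]
      proof (rule energy_layers_le[where u = u, OF \<Phi>0 J(1) U \<Phi>m lev])
        fix j assume "j0 \<le> j"
        then have "j1 \<le> j" using j0 by simp
        have "(\<integral>\<^sup>+z\<in>{z \<in> ?B. u z < (1/2) ^ j}. ennreal (\<Phi> z) \<partial>lebesgue) \<le> (\<integral>\<^sup>+z\<in>{z \<in> ?B. u z < (1/2) ^ j}. ennreal (1 + \<Phi> z) \<partial>lebesgue)"
          by (intro nn_integral_mono mult_right_mono ennreal_leI) auto
        then show "(\<integral>\<^sup>+z\<in>{z \<in> ?B. u z < (1/2) ^ j}. ennreal (\<Phi> z) \<partial>lebesgue) \<le> ennreal (\<epsilon> * (1/2) ^ (j * n))"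
          using layer[OF \<open>j1 \<le> j\<close>] by simp
      qed (use \<epsilon> in simp)
      finally have "ennreal (?c) \<le> ennreal (2 ^ (n + 4) / \<omega>) *
         (ennreal (2 ^ (n - 1)) * (ennreal (\<omega> * ?sw) + ennreal \<tau> * (ennreal (2 ^ n * \<epsilon> * (real J + 1)) + ennreal (2 ^ (j0 * n)) * ennreal E)))"
        unfolding E(1) n_def \<omega>_def by (simp add: mult_left_mono add_left_mono)
      also have "\<dots> = ennreal (?R)"
      proof -
        have "ennreal a * (ennreal b * (ennreal c + ennreal t * (ennreal d + ennreal e * ennreal E)))
            = ennreal (a * (b * (c + t * (d + e * E))))"
          if "0 \<le> a" "0 \<le> b" "0 \<le> c" "0 \<le> t" "0 \<le> d" "0 \<le> e" for a b c t d e
          using that E(2) by (simp add: ennreal_mult ennreal_plus)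
        then show ?thesis
          using \<omega> \<tau> \<epsilon> by (simp only: mult_nonneg_nonneg sum_nonneg scale_weight_nonneg less_imp_le
            zero_le_power zero_le_numeral divide_nonneg_nonneg of_nat_0_le_iff add_nonneg_nonneg zero_le_one)
      qed
      finally have c_le: "?c \<le> ?R"
      proof (subst (asm) ennreal_le_iff)
        show "0 \<le> ?R"
          using \<omega> \<tau> \<epsilon> E(2) by (intro mult_nonneg_nonneg add_nonneg_nonneg sum_nonneg scale_weight_nonneg) auto
      qed
      also have "\<dots> = B * \<omega> * ?sw + B * \<tau> * (2 ^ n * \<epsilon> * (real J + 1)) + B * \<tau> * (2 ^ (j0 * n) * E)"
        unfolding B_def by (simp only: ring_distribs mult_ac add_ac)
      also have "B * \<tau> * (2 ^ n * \<epsilon> * (real J + 1)) = (real J + 1) / 8"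
        using B \<tau> by (simp add: \<epsilon>_def)
      also have "B * \<omega> * ?sw \<le> 7 * B * \<omega> + (real J + 1) / 8"
      proof -
        have "?sw \<le> 7 + \<tau>' * (4 * real J + 3 * (\<Sum>k=1..K. real k powr (\<alpha> - 1)))"
          using sum_scale_weight_le[OF \<alpha> J(2), where \<tau> = \<tau> and n = n and K = K] by (simp only: \<tau>\<tau>')
        also have "\<dots> \<le> 7 + \<tau>' * ((4 + 3 * C) * (real J + 1))"
          using \<tau>' K(3) by (intro add_left_mono mult_left_mono) (auto simp: algebra_simps)
        finally have "B * \<omega> * ?sw \<le> B * \<omega> * (7 + \<tau>' * ((4 + 3 * C) * (real J + 1)))"
          using B \<omega> by (intro mult_left_mono) auto
        also have "\<dots> = 7 * B * \<omega> + (B * \<omega> * (4 + 3 * C) * \<tau>') * (real J + 1)"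
          by (simp add: algebra_simps)
        also have "B * \<omega> * (4 + 3 * C) * \<tau>' = 1 / 8"
        proof -
          have "4 + 3 * C \<noteq> 0" using C(1) by simp
          then show ?thesis using B \<omega> by (simp add: \<tau>'_def)
        qed
        finally show ?thesis by simp
      qed
      finally have "?c \<le> (real J + 1) / 4 + D"
        by (simp add: D_def)
      moreover have "?c = (real J - real j0) * ln 2 - ln 5 / 2"
      proof -
        have l: "ln ((1/2::real) ^ i) = - real i * ln 2" for i
          by (simp add: ln_realpow ln_div)
        have "h\<^sup>2 + (2 * h)\<^sup>2 = 5 * h\<^sup>2" by (simp add: power2_eq_square)
        then have "ln (h\<^sup>2 + (2 * h)\<^sup>2) = ln 5 + 2 * ln h" using h by (simp add: ln_mult ln_realpow)
        then show ?thesis unfolding h_def l by (simp add: algebra_simps)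
      qed
      moreover have "(real J - real j0) * (1/2) \<le> (real J - real j0) * ln 2"
        using J ln_two_bounds by (intro mult_left_mono) auto
      moreover have "ln (5::real) \<le> 3"
      proof -
        have "ln (5::real) \<le> ln (2 ^ 3)" by (intro ln_mono) auto
        also have "\<dots> \<le> 3" using ln_two_bounds ln_realpow[of "2::real" 3] by simp
        finally show ?thesis .
      qed
      ultimately show ?thesis by (simp add: field_simps)
    qed
    \<comment> \<open>Solving \<open>main\<close> for J gives J <= 4D + 2 j0 + 7.\<close>
    obtain J where "real J > 4 * D + 2 * real j0 + 8 + real j0" using reals_Archimedean2 by blast
    moreover have "D \<ge> 0" using B \<omega> \<tau> E(2) by (auto simp: D_def)
    ultimately have "J \<ge> j0" "J \<ge> 1" "real J > 4 * D + 2 * real j0 + 8" by linarith+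
    with main[of J] show False by (simp add: field_simps)
  qed
qed

section \<open>Covering the image\<close>

text \<open>Radii up to 1/e have ln (1/r) >= 1, so that in the logarithmic case, too, a larger
  exponent gives a smaller bound. This permits lowering \<mu> to a value 1/(m+1).\<close>

lemma modulus_bound_mono:
  assumes "\<mu>1 \<le> \<mu>2" "0 < r" "r \<le> exp (- 1)"
  shows "modulus_bound \<alpha> \<mu>2 r \<le> modulus_bound \<alpha> \<mu>1 r"
proof -
  have "exp 1 \<le> 1 / r" using assms by (simp add: exp_minus field_simps)
  then have L: "ln (1 / r) \<ge> 1" using ln_mono[of "exp 1" "1 / r"] by simp
  have "\<mu>1 * ln (1 / r) powr \<alpha> \<le> \<mu>2 * ln (1 / r) powr \<alpha>"
    using assms by (intro mult_right_mono) auto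
  moreover have "ln (1 / r) powr (- \<mu>2) \<le> ln (1 / r) powr (- \<mu>1)"
    using assms L by (intro powr_mono) auto
  ultimately show ?thesis by (simp add: modulus_bound_def)
qed

lemma ennreal_eq_0I:
  fixes X :: ennreal
  assumes "\<And>\<gamma>. \<gamma> > 0 \<Longrightarrow> X \<le> ennreal \<gamma>"
  shows "X = 0"
proof (cases X)
  case (real r)
  then show ?thesis using assms[of "r / 2"] by (cases "r = 0") auto
next
  case top
  then show ?thesis using assms[of 1] by (simp add: top_unique)
qed

section \<open>Null sets of the Hausdorff content\<close>

lemma hausdorff_pre_0_iff:
  "hausdorff_pre m \<delta> A = 0 \<longleftrightarrow> (\<forall>\<eta>>0. \<exists>C :: nat \<Rightarrow> 'b::euclidean_space set. A \<subseteq> (\<Union>k. C k) \<and>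
      (\<forall>k. bounded (C k) \<and> diameter (C k) \<le> \<delta>) \<and>
      (\<Sum>k. ennreal (unit_ball_vol (real m) * (diameter (C k) / 2) ^ m)) < ennreal \<eta>)" (is "_ \<longleftrightarrow> ?R")
proof
  assume "hausdorff_pre m \<delta> A = 0"
  then have "hausdorff_pre m \<delta> A < ennreal \<eta>" if "\<eta> > 0" for \<eta> using that by simp
  then show ?R unfolding hausdorff_pre_def INF_less_iff by (simp add: conj_assoc Bex_def)
next
  assume R: ?R
  have "hausdorff_pre m \<delta> A < ennreal \<eta>" if "\<eta> > 0" for \<eta>
    using R that unfolding hausdorff_pre_def INF_less_iff by (simp add: conj_assoc Bex_def)
  then show "hausdorff_pre m \<delta> A = 0" by (intro ennreal_eq_0I less_imp_le)
qed

lemma hausdorff_measure_0I: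
  "(\<And>\<delta>. \<delta> > 0 \<Longrightarrow> hausdorff_pre m \<delta> A = 0) \<Longrightarrow> hausdorff_measure m A = 0"
  unfolding hausdorff_measure_def by (intro le_zero_eq[THEN iffD1] SUP_least) simp

lemma hausdorff_pre_UN_0:
  fixes A :: "nat \<Rightarrow> 'b::euclidean_space set"
  assumes A: "\<And>i. hausdorff_pre m \<delta> (A i) = 0"
  shows "hausdorff_pre m \<delta> (\<Union>i. A i) = 0"
  unfolding hausdorff_pre_0_iff
proof (intro allI impI)
  fix \<eta> :: real assume \<eta>: "\<eta> > 0"
  let ?v = "\<lambda>D :: 'b set. ennreal (unit_ball_vol (real m) * (diameter D / 2) ^ m)"
  \<comment> \<open>The errors add up to \<eta>/2, which keeps the total strictly below
    \<eta>.\<close>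
  have "\<exists>C :: nat \<Rightarrow> 'b set. A i \<subseteq> (\<Union>k. C k) \<and> (\<forall>k. bounded (C k) \<and> diameter (C k) \<le> \<delta>) \<and>
      (\<Sum>k. ?v (C k)) < ennreal (\<eta> / 2 * (1/2) ^ Suc i)" for i
    using A[of i] \<eta> unfolding hausdorff_pre_0_iff by simp
  then obtain C :: "nat \<Rightarrow> nat \<Rightarrow> 'b set" where C: "\<And>i. A i \<subseteq> (\<Union>k. C i k)"
    "\<And>i k. bounded (C i k) \<and> diameter (C i k) \<le> \<delta>" "\<And>i. (\<Sum>k. ?v (C i k)) < ennreal (\<eta> / 2 * (1/2) ^ Suc i)"
    by metis
  define D where "D l = (case prod_decode l of (i, k) \<Rightarrow> C i k)" for l
  have "(\<Sum>l. ?v (D l)) = (\<Sum>i. \<Sum>k. ?v (C i k))"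
    using suminf_ennreal_2dimen[of "\<lambda>i. \<Sum>k. ?v (C i k)" "\<lambda>(i, k). ?v (C i k)"]
    by (simp add: D_def case_prod_beta)
  also have "\<dots> \<le> (\<Sum>i. ennreal (\<eta> / 2 * (1/2) ^ Suc i))"
    by (intro suminf_le less_imp_le C(3)) auto
  also have "\<dots> = ennreal (\<eta> / 2)"
  proof -
    have "(\<lambda>i. \<eta> / 2 * (1/2) ^ Suc i) sums (\<eta> / 2 * 1)"
      by (intro sums_mult power_half_series)
    then show ?thesis
      using \<eta> by (subst suminf_ennreal2) (auto simp: sums_iff)
  qed
  also have "\<dots> < ennreal \<eta>" using \<eta> by (simp add: ennreal_less_iff)
  finally have sum: "(\<Sum>l. ?v (D l)) < ennreal \<eta>" .
  have "(\<Union>i. A i) \<subseteq> (\<Union>l. D l)"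
  proof
    fix y assume "y \<in> (\<Union>i. A i)"
    then obtain i k where "y \<in> C i k" using C(1) by blast
    then have "y \<in> D (prod_encode (i, k))" by (simp add: D_def)
    then show "y \<in> (\<Union>l. D l)" by blast
  qed
  moreover have "bounded (D l) \<and> diameter (D l) \<le> \<delta>" for l
    using C(2) by (simp add: D_def case_prod_beta)
  ultimately show "\<exists>C :: nat \<Rightarrow> 'b set. (\<Union>i. A i) \<subseteq> (\<Union>k. C k) \<and>
      (\<forall>k. bounded (C k) \<and> diameter (C k) \<le> \<delta>) \<and> (\<Sum>k. ?v (C k)) < ennreal \<eta>"
    using sum by blast
qed

lemma hausdorff_pre_mono:
  "A \<subseteq> B \<Longrightarrow> hausdorff_pre m \<delta> A \<le> hausdorff_pre m \<delta> B"
  unfolding hausdorff_pre_def by (rule INF_superset_mono) auto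

text \<open>Open sets of measure tending to 0 around \<open>N\<close> are intersected successively,
  so that they decrease to a null set; dominated convergence then drives the energy to 0. The first
  of them has finite measure, which makes the summand 1 integrable.\<close>

lemma null_set_small_energy:
  fixes N \<Omega> :: "'a::euclidean_space set" and \<Phi> :: "'a \<Rightarrow> ennreal"
  assumes \<Omega>: "open \<Omega>" and N: "N \<subseteq> \<Omega>" "N \<in> null_sets lebesgue"
    and \<Phi>: "(\<lambda>z. \<Phi> z * indicator \<Omega> z) \<in> borel_measurable lebesgue"
    and fin: "(\<integral>\<^sup>+z\<in>\<Omega>. \<Phi> z \<partial>lebesgue) < \<infinity>" and \<eta>: "\<eta> > (0::ennreal)"
  obtains V where "open V" "N \<subseteq> V" "V \<subseteq> \<Omega>" "(\<integral>\<^sup>+z\<in>V. (1 + \<Phi> z) \<partial>lebesgue) < \<eta>"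
proof -
  have Nl: "N \<in> sets lebesgue" and N0: "emeasure lebesgue N = 0" using N(2) by auto
  have "\<exists>T. open T \<and> N \<subseteq> T \<and> emeasure lebesgue (T - N) < ennreal ((1/2) ^ k)" for k :: nat
    using sets_lebesgue_outer_open[OF Nl, of "(1/2) ^ k"] by (metis zero_less_power half_gt_zero zero_less_one)
  then obtain T where T: "\<And>k. open (T k)" "\<And>k. N \<subseteq> T k" "\<And>k. emeasure lebesgue (T k - N) < ennreal ((1/2) ^ k)"
    by metis
  have Tm: "emeasure lebesgue (T k) < ennreal ((1/2) ^ k)" for k
  proof -
    have "emeasure lebesgue (T k) = emeasure lebesgue (T k - N)"
      using T(1,2)[of k] Nl N(2) by (intro emeasure_Diff_null_set[symmetric]) auto
    then show ?thesis using T(3)[of k] by simp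
  qed
  define V where "V k = \<Omega> \<inter> (\<Inter>i\<le>k. T i)" for k :: nat
  have V: "open (V k)" "N \<subseteq> V k" "V k \<subseteq> \<Omega>" "V k \<subseteq> T k" for k
    using \<Omega> T N by (auto simp: V_def)
  have Vl: "V k \<in> sets lebesgue" for k using V(1)[of k] by simp
  have dec: "V j \<subseteq> V i" if "i \<le> j" for i j
    using that by (auto simp: V_def)
  have "emeasure lebesgue (\<Inter>k. V k) \<le> ennreal \<gamma>" if "\<gamma> > 0" for \<gamma>
  proof -
    obtain k where k: "(1/2::real) ^ k < \<gamma>" using real_arch_pow_inv[of \<gamma> "1/2"] \<open>\<gamma> > 0\<close> by auto
    have "emeasure lebesgue (\<Inter>k. V k) \<le> emeasure lebesgue (T k)"
      using V(4)[of k] T(1)[of k] by (intro emeasure_mono) auto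
    also have "\<dots> \<le> ennreal \<gamma>" using Tm[of k] k by (meson ennreal_leI less_imp_le order.trans)
    finally show ?thesis .
  qed
  then have "emeasure lebesgue (\<Inter>k. V k) = 0" by (rule ennreal_eq_0I)
  then have null: "(\<Inter>k. V k) \<in> null_sets lebesgue"
    using Vl by (intro null_setsI) auto
  let ?w = "\<lambda>k z. (1 + \<Phi> z) * indicator (V k) z"
  have Wm: "(\<lambda>z. ?w k z) \<in> borel_measurable lebesgue" for k
  proof -
    have "(\<lambda>z. (1 + \<Phi> z * indicator \<Omega> z) * indicator (V k) z) \<in> borel_measurable lebesgue"
      by (rule borel_measurable_times_ennreal[OF borel_measurable_add[OF borel_measurable_const \<Phi>]
            borel_measurable_indicator[OF Vl]])
    moreover have "(\<lambda>z. (1 + \<Phi> z * indicator \<Omega> z) * indicator (V k) z) = (\<lambda>z. ?w k z)"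
      using V(3)[of k] by (auto simp: fun_eq_iff indicator_def)
    ultimately show ?thesis by simp
  qed
  have "(\<lambda>k. \<integral>\<^sup>+z. ?w k z \<partial>lebesgue) \<longlonglongrightarrow> (\<integral>\<^sup>+z. 0 \<partial>(lebesgue :: 'a measure))"
  proof (rule nn_integral_dominated_convergence[where w="\<lambda>z. ?w 0 z"])
    show "AE z in lebesgue. ?w k z \<le> ?w 0 z" for k
      using dec[of 0 k] by (intro AE_I2 mult_left_mono) (auto simp: indicator_def)
    have "(\<integral>\<^sup>+z. ?w 0 z \<partial>lebesgue) \<le> (\<integral>\<^sup>+z. indicator (T 0) z + \<Phi> z * indicator \<Omega> z \<partial>lebesgue)"
      using V(3,4)[of 0] by (intro nn_integral_mono) (auto simp: indicator_def distrib_right)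
    also have "\<dots> = emeasure lebesgue (T 0) + (\<integral>\<^sup>+z. \<Phi> z * indicator \<Omega> z \<partial>lebesgue)"
      using T(1)[of 0] \<Phi> by (subst nn_integral_add) (auto intro!: borel_measurable_indicator)
    also have "\<dots> < \<infinity>" using fin Tm[of 0] by (auto simp: ennreal_add_less_top intro: less_trans)
    finally show "(\<integral>\<^sup>+z. ?w 0 z \<partial>lebesgue) < \<infinity>" .
    show "AE z in lebesgue. (\<lambda>k. ?w k z) \<longlonglongrightarrow> 0"
      using AE_not_in[OF null]
    proof eventually_elim
      case (elim z)
      then obtain m where m: "z \<notin> V m" by auto
      then have "?w k z = 0" if "k \<ge> m" for k
        using dec[OF that] m by (auto simp: indicator_def)
      then show ?case by (intro tendsto_eventually eventually_sequentiallyI) auto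
    qed
  qed (use Wm in auto)
  then have "\<forall>\<^sub>F k in sequentially. (\<integral>\<^sup>+z. ?w k z \<partial>lebesgue) < \<eta>"
    using \<eta> by (intro order_tendstoD(2)) auto
  then obtain k where "(\<integral>\<^sup>+z\<in>V k. (1 + \<Phi> z) \<partial>lebesgue) < \<eta>"
    unfolding eventually_sequentially by blast
  then show thesis by (rule that[OF V(1-3)])
qed

text \<open>Vitali is applied to balls around the values f(x). Their disjointness passes to the
  preimages \<open>E\<close> without any continuity of \<open>f\<close>; measurability of the
  preimages is enough. Each enlarged ball costs a fixed multiple of the energy on its
  \<open>E\<close>, and these energies add up inside \<open>V\<close>.\<close>

lemma hausdorff_pre_image_le:
  fixes f :: "'a::euclidean_space \<Rightarrow> 'b::euclidean_space" and w :: "'a \<Rightarrow> ennreal"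
  assumes n: "n \<ge> 1" and \<epsilon>: "\<epsilon> > 0" and \<delta>: "\<delta> > 0"
    and w: "(\<lambda>z. w z * indicator V z) \<in> borel_measurable lebesgue"
    and f: "\<And>p r. {z \<in> V. norm (f z - p) < r} \<in> sets lebesgue"
    and lower: "\<And>x j1. x \<in> M \<Longrightarrow> \<exists>j\<ge>j1. ennreal (\<epsilon> * (1/2) ^ (j * n)) \<le>
        (\<integral>\<^sup>+z\<in>{z \<in> V. norm (f z - f x) < (1/2) ^ j}. w z \<partial>lebesgue)"
  shows "hausdorff_pre n \<delta> (f ` M) \<le> ennreal (unit_ball_vol (real n) * 5 ^ n / \<epsilon>) * (\<integral>\<^sup>+z\<in>V. w z \<partial>lebesgue)"
proof -
  \<comment> \<open>The enlarged balls have radius 5r, hence diameter 10r.\<close>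
  obtain j1 where j1: "(1/2::real) ^ j1 < \<delta> / 10" using real_arch_pow_inv[of "\<delta> / 10" "1/2"] \<delta> by auto
  have "\<forall>x\<in>M. \<exists>j. j1 \<le> j \<and> ennreal (\<epsilon> * (1/2) ^ (j * n)) \<le>
        (\<integral>\<^sup>+z\<in>{z \<in> V. norm (f z - f x) < (1/2) ^ j}. w z \<partial>lebesgue)"
    using lower by blast
  from bchoice[OF this]
  obtain j where j: "\<And>x. x \<in> M \<Longrightarrow> j x \<ge> j1" "\<And>x. x \<in> M \<Longrightarrow> ennreal (\<epsilon> * (1/2) ^ (j x * n)) \<le>
        (\<integral>\<^sup>+z\<in>{z \<in> V. norm (f z - f x) < (1/2) ^ j x}. w z \<partial>lebesgue)"
    by blast
  define r where "r x = (1/2::real) ^ j x" for x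
  have r: "r x > 0" "r x \<le> 1" for x by (auto simp: r_def power_le_one)
  have r\<delta>: "10 * r x \<le> \<delta>" if "x \<in> M" for x
  proof -
    have "r x \<le> (1/2) ^ j1" unfolding r_def using j(1)[OF that] by (intro power_decreasing) auto
    then show ?thesis using j1 by simp
  qed
  obtain C where C: "countable C" "C \<subseteq> M"
    "pairwise (\<lambda>i j. disjnt (ball (f i) (r i)) (ball (f j) (r j))) C"
    "f ` M \<subseteq> (\<Union>i\<in>C. ball (f i) (5 * r i))"
  proof (rule Vitali_covering_lemma_balls[where S = "f ` M" and K = M and a = f and r = r and B = 1])
    show "f ` M \<subseteq> (\<Union>i\<in>M. ball (f i) (r i))" using r by force
    show "0 < r i \<and> r i \<le> 1" for i using r by auto
  qed auto
  \<comment> \<open>The countable, possibly finite family is laid out along the naturals; the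
    remaining indices get empty sets in \<open>D\<close> and \<open>E\<close>.\<close>
  define I where "I = to_nat_on C ` C"
  define c where "c = from_nat_into C"
  have cC: "c k \<in> C" if "k \<in> I" for k
    using that C(1) by (auto simp: I_def c_def)
  have cI: "\<exists>k\<in>I. c k = x" if "x \<in> C" for x
    using that C(1) by (auto simp: I_def c_def)
  have c_inj: "k = l" if "k \<in> I" "l \<in> I" "c k = c l" for k l
    using that C(1) by (auto simp: I_def c_def)
  define D where "D k = (if k \<in> I then ball (f (c k)) (5 * r (c k)) else {})" for k
  define E where "E k = (if k \<in> I then {z \<in> V. norm (f z - f (c k)) < r (c k)} else {})" for k
  have Em: "E k \<in> sets lebesgue" for k using f by (simp add: E_def)
  have disj: "disjoint_family E"
    unfolding disjoint_family_on_def
  proof (intro ballI impI)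
    fix k l :: nat assume "k \<noteq> l"
    show "E k \<inter> E l = {}"
    proof (cases "k \<in> I \<and> l \<in> I")
      case True
      then have "c k \<noteq> c l" using c_inj \<open>k \<noteq> l\<close> by blast
      then have "disjnt (ball (f (c k)) (r (c k))) (ball (f (c l)) (r (c l)))"
        using C(3) cC True by (auto simp: pairwise_def)
      then show ?thesis using True
        by (auto simp: E_def disjnt_iff dist_norm norm_minus_commute)
    qed (auto simp: E_def)
  qed
  \<comment> \<open>The energy is turned into a measure to have countable additivity over the sets
    \<open>E\<close>.\<close>
  define W where "W z = w z * indicator V z" for z
  let ?\<nu> = "emeasure (density lebesgue W)"
  have W: "W \<in> borel_measurable lebesgue" using w by (simp add: W_def[abs_def])
  have WE: "?\<nu> A = (\<integral>\<^sup>+z\<in>A. w z \<partial>lebesgue)" if "A \<subseteq> V" "A \<in> sets lebesgue" for A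
    using that W by (auto simp: emeasure_density W_def intro!: nn_integral_cong split: split_indicator)
  have EV: "E k \<subseteq> V" for k by (auto simp: E_def)
  let ?v = "\<lambda>D :: 'b set. ennreal (unit_ball_vol (real n) * (diameter D / 2) ^ n)"
  let ?c = "ennreal (unit_ball_vol (real n) * 5 ^ n / \<epsilon>)"
  have vD: "?v (D k) \<le> ?c * ?\<nu> (E k)" for k
  proof (cases "k \<in> I")
    case True
    define x where "x = c k"
    have x: "x \<in> M" using cC[OF True] C(2) by (auto simp: x_def)
    have "diameter (D k) / 2 = 5 * r x"
      using True r[of x] by (simp add: D_def x_def diameter_ball)
    then have "unit_ball_vol (real n) * (diameter (D k) / 2) ^ n = (unit_ball_vol (real n) * 5 ^ n / \<epsilon>) * (\<epsilon> * (1/2) ^ (j x * n))"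
      using \<epsilon> by (simp add: power_mult_distrib r_def power_mult)
    then have "?v (D k) = ?c * ennreal (\<epsilon> * (1/2) ^ (j x * n))"
      using \<epsilon> by (simp only:) (intro ennreal_mult', simp)
    also have "\<dots> \<le> ?c * ?\<nu> (E k)"
      using j(2)[OF x] True WE[OF EV Em, of k] by (intro mult_left_mono) (auto simp: E_def x_def r_def)
    finally show ?thesis .
  next
    case False
    \<comment> \<open>The empty set costs 0^n, which vanishes because n >= 1.\<close>
    then show ?thesis using n by (simp add: D_def zero_power)
  qed
  have "(\<Sum>k. ?v (D k)) \<le> (\<Sum>k. ?c * ?\<nu> (E k))"
    by (intro suminf_le vD) auto
  also have "\<dots> = ?c * (\<Sum>k. ?\<nu> (E k))"
    by (rule ennreal_suminf_cmult)
  also have "(\<Sum>k. ?\<nu> (E k)) = ?\<nu> (\<Union>k. E k)"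
    using Em disj by (intro suminf_emeasure) auto
  also have "\<dots> = (\<integral>\<^sup>+z\<in>(\<Union>k. E k). w z \<partial>lebesgue)"
    using EV Em by (intro WE) auto
  also have "\<dots> \<le> (\<integral>\<^sup>+z\<in>V. w z \<partial>lebesgue)"
    using EV by (intro nn_integral_mono mult_left_mono) (auto simp: indicator_def)
  finally have sum: "(\<Sum>k. ?v (D k)) \<le> ?c * (\<integral>\<^sup>+z\<in>V. w z \<partial>lebesgue)"
    by (simp add: mult_left_mono)
  have "f ` M \<subseteq> (\<Union>k. D k)"
  proof
    fix y assume "y \<in> f ` M"
    then obtain x where x: "x \<in> C" "y \<in> ball (f x) (5 * r x)" using C(4) by blast
    then obtain k where "k \<in> I" "c k = x" using cI by blast
    then show "y \<in> (\<Union>k. D k)" using x by (auto simp: D_def)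
  qed
  moreover have "bounded (D k) \<and> diameter (D k) \<le> \<delta>" for k
  proof (cases "k \<in> I")
    case True
    then have "c k \<in> M" using cC C(2) by auto
    then show ?thesis using True r\<delta>[of "c k"] r[of "c k"] by (simp add: D_def diameter_ball)
  qed (use \<delta> in \<open>simp add: D_def\<close>)
  ultimately have "hausdorff_pre n \<delta> (f ` M) \<le> (\<Sum>k. ?v (D k))"
    unfolding hausdorff_pre_def by (intro INF_lower) auto
  then show ?thesis using sum by simp
qed

theorem theorem3p1:
  fixes f :: "'a::euclidean_space \<Rightarrow> 'b::euclidean_space"
    and g :: "'a \<Rightarrow> 'a \<Rightarrow> 'b"
    and \<Omega> N :: "'a set" and lam alpha :: real
  assumes n2: "DIM('a) \<ge> 2"
    and \<Omega>: "open \<Omega>"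
    and lam: "0 \<le> lam" "lam \<le> real DIM('a) - 1"
    and alpha: "alpha = 1 - lam / (real DIM('a) - 1)"
    and sob: "weak_gradient_W11loc f \<Omega> g"
    and N: "N \<subseteq> \<Omega>" "N \<in> null_sets lebesgue"
    and modc: "\<forall>x\<in>N. \<exists>R \<mu>. 0 < R \<and> R < 1 \<and> 0 < \<mu> \<and> ball x R \<subseteq> \<Omega> \<and>
        (\<forall>r. 0 < r \<and> r \<le> R \<longrightarrow>
           median_modulus f x r \<le>
             (if alpha > 0 then exp (- \<mu> * (ln (1 / r)) powr alpha) else (ln (1 / r)) powr (- \<mu>)))"
    and energy: "(\<integral>\<^sup>+ y \<in> \<Omega>. ennreal ((grad_norm g y) ^ DIM('a) * (ln (exp 1 + grad_norm g y)) powr lam) \<partial>lebesgue) < \<infinity>"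
  shows "hausdorff_measure DIM('a) (f ` N) = 0"
proof -
  define n where "n = DIM('a)"
  have \<alpha>: "0 \<le> alpha" "alpha \<le> 1" and lam_eq: "lam = (1 - alpha) * (real DIM('a) - 1)"
    using lam n2 by (auto simp: alpha field_simps)
  let ?\<Phi> = "\<lambda>z. ennreal (orlicz DIM('a) lam (grad_norm g z))"
  have fin: "(\<integral>\<^sup>+z\<in>\<Omega>. ?\<Phi> z \<partial>lebesgue) < \<infinity>" using energy by (simp add: orlicz_def)
  have \<Phi>m: "(\<lambda>z. ?\<Phi> z * indicator A z) \<in> borel_measurable lebesgue" if "A \<subseteq> \<Omega>" "A \<in> sets lebesgue" for A
    using orlicz_energy_measurable[OF sob \<Omega> that, of "orlicz DIM('a) lam" "\<lambda>_. 1"] by simp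
  have w_eq: "ennreal (1 + orlicz DIM('a) lam (grad_norm g z)) = 1 + ?\<Phi> z" for z
    by (simp add: orlicz_nonneg grad_norm_nonneg)
  \<comment> \<open>The exponent determines \<epsilon>, the radius does not, so \<open>N\<close> is
    split by \<mu> alone. The pieces may be non-measurable, as the content is defined for arbitrary
    sets.\<close>
  define M where "M m = {x \<in> N. \<exists>R>0. \<forall>r. 0 < r \<and> r \<le> R \<longrightarrow> median_modulus f x r \<le> modulus_bound alpha (1 / real (Suc m)) r}" for m
  have cover: "N \<subseteq> (\<Union>m. M m)"
  proof
    fix x assume x: "x \<in> N"
    then obtain R \<mu> where R: "0 < R" "0 < \<mu>" "\<And>r. 0 < r \<Longrightarrow> r \<le> R \<Longrightarrow> median_modulus f x r \<le> modulus_bound alpha \<mu> r"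
      using modc unfolding modulus_bound_def by meson
    obtain m where m: "1 / real (Suc m) < \<mu>" using nat_approx_posE[OF R(2)] by metis
    \<comment> \<open>The radius is cut at 1/e so that \<mu> may be replaced by the smaller
      1/(m+1).\<close>
    have "median_modulus f x r \<le> modulus_bound alpha (1 / real (Suc m)) r"
      if "0 < r" "r \<le> min R (exp (- 1))" for r
      using R(3)[of r] modulus_bound_mono[of "1 / real (Suc m)" \<mu> r alpha] m that by simp
    then have "x \<in> M m"
      unfolding M_def using x R(1) by (auto intro!: exI[of _ "min R (exp (- 1))"])
    then show "x \<in> (\<Union>m. M m)" by blast
  qed
  have "hausdorff_pre n \<delta> (f ` M m) = 0" if \<delta>: "\<delta> > 0" for \<delta> m
  proof -
    have pos: "1 / real (Suc m) > 0" by simp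
    show ?thesis
    proof (rule image_energy_lower[OF n2 \<alpha> lam_eq pos, where 'b = 'b])
      fix \<epsilon> :: real
      assume \<epsilon>: "\<epsilon> > 0"
        "\<And>(f :: 'a \<Rightarrow> 'b) g \<Omega> V x R.
        weak_gradient_W11loc f \<Omega> g \<Longrightarrow> open \<Omega> \<Longrightarrow> open V \<Longrightarrow> V \<subseteq> \<Omega> \<Longrightarrow> x \<in> V \<Longrightarrow> R > 0 \<Longrightarrow>
        (\<And>r. 0 < r \<Longrightarrow> r \<le> R \<Longrightarrow> median_modulus f x r \<le> modulus_bound alpha (1 / real (Suc m)) r) \<Longrightarrow>
        (\<integral>\<^sup>+z\<in>V. ennreal (orlicz DIM('a) lam (grad_norm g z)) \<partial>lebesgue) < \<infinity> \<Longrightarrow>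
        recurrent_energy \<epsilon> lam f g V x"
      let ?c = "unit_ball_vol (real n) * 5 ^ n / \<epsilon>"
      have c: "?c > 0" using \<epsilon>(1) by simp
      have "hausdorff_pre n \<delta> (f ` M m) \<le> ennreal \<gamma>" if \<gamma>: "\<gamma> > 0" for \<gamma>
      proof -
        \<comment> \<open>Energy below \<gamma> / c absorbs the covering constant c. This is not
          circular: c depends on \<epsilon>, which was fixed before \<open>V\<close>.\<close>
        obtain V where V: "open V" "N \<subseteq> V" "V \<subseteq> \<Omega>" "(\<integral>\<^sup>+z\<in>V. (1 + ?\<Phi> z) \<partial>lebesgue) < ennreal (\<gamma> / ?c)"
        proof (rule null_set_small_energy[OF \<Omega> N \<Phi>m fin])
          show "0 < ennreal (\<gamma> / ?c)" using \<gamma> c by (simp only: ennreal_less_zero_iff divide_pos_pos)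
        qed (use \<Omega> in auto)
        have Vl: "V \<in> sets lebesgue" using V(1) by simp
        have "hausdorff_pre n \<delta> (f ` M m) \<le> ennreal ?c * (\<integral>\<^sup>+z\<in>V. (1 + ?\<Phi> z) \<partial>lebesgue)"
        proof (rule hausdorff_pre_image_le[OF _ \<epsilon>(1) \<delta>])
          show "n \<ge> 1" using n2 by (simp add: n_def)
          have "(\<lambda>z. indicator V z + ?\<Phi> z * indicator V z) \<in> borel_measurable lebesgue"
            using Vl \<Phi>m[OF V(3) Vl] by (intro borel_measurable_add borel_measurable_indicator)
          then show "(\<lambda>z. (1 + ?\<Phi> z) * indicator V z) \<in> borel_measurable lebesgue"
            by (simp add: distrib_right)
          show "{z \<in> V. norm (f z - p) < r} \<in> sets lebesgue" for p r
            by (rule level_set_lebesgue[OF weak_gradient_measurable(1)[OF sob \<Omega>] V(3) Vl]) measurable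
        next
          fix x j1 assume "x \<in> M m"
          then obtain R where x: "x \<in> V" and R: "R > 0" "\<And>r. 0 < r \<Longrightarrow> r \<le> R \<Longrightarrow> median_modulus f x r \<le> modulus_bound alpha (1 / real (Suc m)) r"
            using V(2) by (auto simp: M_def)
          have "(\<integral>\<^sup>+z\<in>V. ?\<Phi> z \<partial>lebesgue) \<le> (\<integral>\<^sup>+z\<in>\<Omega>. ?\<Phi> z \<partial>lebesgue)"
            using V(3) by (intro nn_integral_mono mult_left_mono) (auto simp: indicator_def)
          then have "(\<integral>\<^sup>+z\<in>V. ?\<Phi> z \<partial>lebesgue) < \<infinity>" using fin by simp
          from \<epsilon>(2)[OF sob \<Omega> V(1,3) x R this]
          show "\<exists>j\<ge>j1. ennreal (\<epsilon> * (1/2) ^ (j * n)) \<le> (\<integral>\<^sup>+z\<in>{z \<in> V. norm (f z - f x) < (1/2) ^ j}. (1 + ?\<Phi> z) \<partial>lebesgue)"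
            unfolding recurrent_energy_def w_eq n_def by (rule spec)
        qed
        also have "\<dots> \<le> ennreal ?c * ennreal (\<gamma> / ?c)"
          using V(4) by (intro mult_left_mono) auto
        also have "\<dots> = ennreal (?c * (\<gamma> / ?c))" 
          by (rule ennreal_mult[OF less_imp_le[OF c] less_imp_le[OF divide_pos_pos[OF \<gamma> c]], symmetric])
        also have "?c * (\<gamma> / ?c) = \<gamma>" 
          using c[THEN less_imp_neq, THEN not_sym] by (simp only: times_divide_eq_right nonzero_mult_div_cancel_left simp_thms)
        finally show ?thesis by simp
      qed
      then show ?thesis by (rule ennreal_eq_0I)
    qed
  qed
  then have "hausdorff_pre n \<delta> (\<Union>m. f ` M m) = 0" if "\<delta> > 0" for \<delta>
    using that by (intro hausdorff_pre_UN_0)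
  moreover have "f ` N \<subseteq> (\<Union>m. f ` M m)" using cover by blast
  ultimately have "hausdorff_pre n \<delta> (f ` N) = 0" if "\<delta> > 0" for \<delta>
    using that hausdorff_pre_mono[of "f ` N" "\<Union>m. f ` M m" n \<delta>] by simp
  then show ?thesis unfolding n_def by (intro hausdorff_measure_0I)
qed

end
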